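(* Let $V_1,\ldots,V_m$ be finite, pairwise disjoint sets, regarded as $0$-dimensional simplicial complexes, and let $V_1*\cdots*V_m$ denote their join. Let $\Delta_{m-1}$ be the simplex on the vertex set $[m]=\{1,\ldots,m\}$ and let $\pi: V_1*\cdots*V_m\to\Delta_{m-1}$ be the simplicial map given by $\pi(v)=i$ for $v\in V_i$. Let $X\subset V_1*\cdots*V_m$ be a subcomplex, let $Y=\pi(X)$, and let $r=r(X,\pi)=\max\{|\pi^{-1}(\pi(x))|: x\in|X|\}$. Then $$L(Y)\le r\,L(X)+r-1.$$
   Context: The join $V_1*\cdots*V_m$ is the simplicial complex on the vertex set $V_1\cup\cdots\cup V_m$ whose simplices are the subsets containing at most one vertex from each $V_i$. The map $\pi$ is extended linearly to geometric realizations, and in $r(X,\pi)$ the preimage $\pi^{-1}(\pi(x))$ is taken inside $|X|$; $Y=\pi(X)=\{\pi(\sigma):\sigma\in X\}$ is a subcomplex of $\Delta_{m-1}$. For a simplicial complex $K$ on vertex set $W$ and $S\subset W$, the induced subcomplex is $K[S]=\{\sigma\in K:\sigma\subset S\}$. The rational Leray number $L(K)$ is the minimal integer $d$ such that $\tilde{\mathrm H}_i(Z;\mathbb Q)=0$ for every induced subcomplex $Z$ of $K$ and every $i\ge d$. *)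

theory Defs
  imports Complex_Main
begin

definition simplicial_complex :: "'a set set \<Rightarrow> bool" where
  "simplicial_complex K \<longleftrightarrow> (\<forall>\<sigma>\<in>K. finite \<sigma>) \<and> (\<forall>\<sigma>\<in>K. \<forall>\<tau>. \<tau> \<subseteq> \<sigma> \<longrightarrow> \<tau> \<in> K)"

definition induced :: "'a set set \<Rightarrow> 'a set \<Rightarrow> 'a set set" where
  "induced K S = {\<sigma> \<in> K. \<sigma> \<subseteq> S}"

text \<open>Rational simplicial chains (augmented, i.e. for reduced homology): a chain of
  size k is a rational function on the faces with exactly k vertices (dimension k-1).
  Orientation is fixed by the linear order on vertices.\<close>
definition chains :: "'a set set \<Rightarrow> nat \<Rightarrow> ('a set \<Rightarrow> rat) set" where
  "chains K k = {c. \<forall>\<sigma>. c \<sigma> \<noteq> 0 \<longrightarrow> \<sigma> \<in> K \<and> card \<sigma> = k}"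

definition bdry :: "'a::linorder set set \<Rightarrow> ('a set \<Rightarrow> rat) \<Rightarrow> 'a set \<Rightarrow> rat" where
  "bdry K c \<tau> = (\<Sum>v\<in>{v. v \<notin> \<tau> \<and> insert v \<tau> \<in> K}.
      (-1) ^ card {w\<in>\<tau>. w < v} * c (insert v \<tau>))"

text \<open>Vanishing of reduced rational homology in dimension i (i \<ge> 0):
  every i-cycle is a boundary. For i = 0 the boundary to the empty face is the augmentation.\<close>
definition red_hom_vanishes :: "'a::linorder set set \<Rightarrow> nat \<Rightarrow> bool" where
  "red_hom_vanishes K i \<longleftrightarrow>
     (\<forall>c\<in>chains K (i+1). (\<forall>\<tau>. bdry K c \<tau> = 0) \<longrightarrow>
        (\<exists>d\<in>chains K (i+2). \<forall>\<tau>. bdry K d \<tau> = c \<tau>))"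

definition leray :: "'a::linorder set set \<Rightarrow> nat" where
  "leray K = (LEAST d. \<forall>S \<subseteq> \<Union>K. \<forall>i\<ge>d. red_hom_vanishes (induced K S) i)"

definition join :: "(nat \<Rightarrow> 'a set) \<Rightarrow> nat \<Rightarrow> 'a set set" where
  "join V m = {\<sigma>. finite \<sigma> \<and> \<sigma> \<subseteq> (\<Union>i\<in>{1..m}. V i) \<and> (\<forall>i\<in>{1..m}. card (\<sigma> \<inter> V i) \<le> 1)}"

text \<open>The vertex map pi(v) = i for v in V i (meaningful for v in the join's vertex set).\<close>
definition pimap :: "(nat \<Rightarrow> 'a set) \<Rightarrow> nat \<Rightarrow> 'a \<Rightarrow> nat" where
  "pimap V m v = (THE i. i \<in> {1..m} \<and> v \<in> V i)"

definition realization :: "'a set set \<Rightarrow> ('a \<Rightarrow> real) set" where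
  "realization K = {x. (\<forall>v. 0 \<le> x v) \<and> {v. x v \<noteq> 0} \<in> K \<and> (\<Sum>v\<in>{v. x v \<noteq> 0}. x v) = 1}"

definition pilin :: "(nat \<Rightarrow> 'a set) \<Rightarrow> nat \<Rightarrow> ('a \<Rightarrow> real) \<Rightarrow> nat \<Rightarrow> real" where
  "pilin V m x = (\<lambda>i. \<Sum>v\<in>{v. x v \<noteq> 0 \<and> pimap V m v = i}. x v)"

definition rXpi :: "(nat \<Rightarrow> 'a set) \<Rightarrow> nat \<Rightarrow> 'a set set \<Rightarrow> nat" where
  "rXpi V m X = Max ((\<lambda>x. card {y \<in> realization X. pilin V m y = pilin V m x}) ` realization X)"

end

theory Submission
  imports Defs "HOL-Library.Function_Algebras"
begin

text \<open>
  Chains of X are chains of the functor F on the Boolean lattice of [m] that sends a set of colours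
  to the free vector space on the faces of X over it; deleting a colour deletes the vertex of that
  colour. Let the Leray number of such a functor be the largest size at which some restriction of it
  to an interval below S has homology.

  (1) The pointwise tensor product satisfies L(F . G) \<le> L(F) + L(G). The two copies of a colour i are
  identified one at a time: the cone of F1.G1 -> F0.G0 is an extension of the cones of F1.G1 -> F1.G0
  and F1.G0 -> F0.G0, where the index says whether i is present. Once all colours are treated,
  what remains are honest tensor products of a link in F with a restriction of G, to which
  Kuenneth applies.

  (2) Hence the k-th exterior power of F, a direct summand of the k-th tensor power, has Leray number
  at most k L(X). Contraction with the augmentation makes the exterior powers a resolution of the
  functor of Y, of length r because fibres have at most r elements. Shifting
  dimensions along it gives vanishing for Y from dimension r L(X) + r - 1 on. This replaces the
  multiple point spectral sequence.
\<close>

section \<open>Functors on a Boolean lattice\<close>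

text \<open>The argument runs in functors because its intermediate objects, exterior powers and
  their syzygies, are not spanned by the faces of a complex. Counting sizes instead of dimensions
  (size s is dimension s - 1) makes the Leray number additive under tensor products without a
  correction term. Exterior powers are used because a Cech-type resolution by full tensor powers
  would not stop: a skew function of more arguments than a fibre has elements is zero. The price is
  division by k!, one of the two places where rational coefficients matter; the other is the choice
  of a complement of the boundaries in the Kuenneth step. Links enter because a colour may have been
  removed from the second factor and still be present in the first. Origin of the constant: shifting
  along the resolution, the exterior power of degree k + 1 is needed at size s - k, and it is exact
  there as soon as (k + 1) L(X) < s - k. The last degree, k + 1 = r, is the most demanding and asks
  for r (L(X) + 1) \<le> s, that is, dimension at least r L(X) + r - 1.\<close>

definition signed :: "nat \<Rightarrow> 'v::ab_group_add \<Rightarrow> 'v" where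
  "signed n v = (if even n then v else - v)"

lemma signed_zero [simp]: "signed n 0 = 0"
  and signed_0 [simp]: "signed 0 v = v"
  and signed_Suc: "signed (Suc n) v = - signed n v"
  and signed_add: "signed n (v + w) = signed n v + signed n w"
  and signed_signed: "signed n (signed k v) = signed (n + k) v"
  by (auto simp: signed_def)

lemma signed_eq_0_iff [simp]: "signed n v = 0 \<longleftrightarrow> v = 0"
  by (simp add: signed_def)

lemma signed_sum: "signed n (\<Sum>i\<in>A. f i) = (\<Sum>i\<in>A. signed n (f i))"
  by (simp add: signed_def sum_negf)

lemma signed_cong: "even n = even k \<Longrightarrow> signed n v = signed k v"
  by (simp add: signed_def)

lemma signed_fun: "signed n f x = signed n (f x)"
  by (simp add: signed_def)

lemma (in additive) signed: "f (signed n v) = signed n (f v)"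
  by (simp add: signed_def minus)

lemma sum_fun_apply: "(\<Sum>i\<in>A. f i) x = (\<Sum>i\<in>A. f i x)"
  by (induction A rule: infinite_finite_induct) auto

text \<open>The orientation order is a parameter \<open>\<rho>\<close>, not a type class order,
  because it is changed in the course of the proof: one colour is moved to the front, or one block
  of colours is put before another.\<close>

definition pos :: "('i \<Rightarrow> 'o::linorder) \<Rightarrow> 'i \<Rightarrow> 'i set \<Rightarrow> nat" where
  "pos \<rho> i \<tau> = card {j\<in>\<tau>. \<rho> j < \<rho> i}"

lemma pos_insert:
  assumes "finite \<tau>" "j \<notin> \<tau>"
  shows "pos \<rho> i (insert j \<tau>) = (if \<rho> j < \<rho> i then Suc (pos \<rho> i \<tau>) else pos \<rho> i \<tau>)"
proof -
  have "{k \<in> insert j \<tau>. \<rho> k < \<rho> i} =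
    (if \<rho> j < \<rho> i then insert j {k\<in>\<tau>. \<rho> k < \<rho> i} else {k\<in>\<tau>. \<rho> k < \<rho> i})"
    by auto
  then show ?thesis using assms by (simp add: pos_def)
qed

text \<open>The parity is the sign of the permutation that relates the two orientations of the cell
  \<open>\<tau>\<close>.\<close>

definition inversions :: "('i \<Rightarrow> 'o::linorder) \<Rightarrow> ('i \<Rightarrow> 'p::linorder) \<Rightarrow> 'i set \<Rightarrow> nat" where
  "inversions \<rho> \<rho>' \<tau> = card {(j, k). j \<in> \<tau> \<and> k \<in> \<tau> \<and> \<rho> j < \<rho> k \<and> \<rho>' k < \<rho>' j}"

text \<open>Elements before i in both orders (\<open>a\<close>) count in both positions; those
  before i in exactly one order (\<open>b\<close> or \<open>b'\<close>) count in one position and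
  are the new inversions created by i. Hence rescaling each cell by its inversion sign turns the
  boundary signs of one order into those of the other.\<close>

lemma even_pos_inversions:
  assumes fin: "finite \<tau>" and i: "i \<notin> \<tau>"
    and inj: "inj_on \<rho> (insert i \<tau>)" "inj_on \<rho>' (insert i \<tau>)"
  shows "even (pos \<rho>' i \<tau> + inversions \<rho> \<rho>' (insert i \<tau>)) = even (inversions \<rho> \<rho>' \<tau> + pos \<rho> i \<tau>)"
proof -
  define a where "a = {j\<in>\<tau>. \<rho> j < \<rho> i \<and> \<rho>' j < \<rho>' i}"
  define b where "b = {j\<in>\<tau>. \<rho> j < \<rho> i \<and> \<rho>' i < \<rho>' j}"
  define b' where "b' = {j\<in>\<tau>. \<rho> i < \<rho> j \<and> \<rho>' j < \<rho>' i}"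
  have ne: "\<rho> j \<noteq> \<rho> i" "\<rho>' j \<noteq> \<rho>' i" if "j \<in> \<tau>" for j
    using that i inj by (auto simp: inj_on_def)
  have f: "finite a" "finite b" "finite b'" using fin by (auto simp: a_def b_def b'_def)
  have "{j\<in>\<tau>. \<rho> j < \<rho> i} = a \<union> b" using ne by (force simp: a_def b_def)
  moreover have "a \<inter> b = {}" by (auto simp: a_def b_def)
  ultimately have p: "pos \<rho> i \<tau> = card a + card b" using f by (simp add: pos_def card_Un_disjoint)
  have "{j\<in>\<tau>. \<rho>' j < \<rho>' i} = a \<union> b'" using ne by (force simp: a_def b'_def)
  moreover have "a \<inter> b' = {}" by (auto simp: a_def b'_def)
  ultimately have p': "pos \<rho>' i \<tau> = card a + card b'" using f by (simp add: pos_def card_Un_disjoint)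
  let ?N = "\<lambda>\<tau>. {(j, k). j \<in> \<tau> \<and> k \<in> \<tau> \<and> \<rho> j < \<rho> k \<and> \<rho>' k < \<rho>' j}"
  have fN: "finite (?N \<tau>)"
    by (rule finite_subset[of _ "\<tau> \<times> \<tau>"]) (use fin in auto)
  have eq: "?N (insert i \<tau>) = ?N \<tau> \<union> (Pair i ` b' \<union> (\<lambda>j. (j, i)) ` b)"
    by (auto simp: b_def b'_def)
  have "card (Pair i ` b' \<union> (\<lambda>j. (j, i)) ` b) = card b' + card b"
    using f i by (subst card_Un_disjoint) (auto simp: card_image inj_on_def b_def b'_def)
  then have "inversions \<rho> \<rho>' (insert i \<tau>) = inversions \<rho> \<rho>' \<tau> + (card b' + card b)"
    unfolding inversions_def eq using fN f i
    by (subst card_Un_disjoint) (auto simp: b_def b'_def)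
  then show ?thesis using p p' by auto
qed

section \<open>The total complex of a functor on a Boolean lattice\<close>

definition cube_bd :: "'i set \<Rightarrow> ('i \<Rightarrow> nat) \<Rightarrow> ('i \<Rightarrow> 'v \<Rightarrow> 'v::ab_group_add) \<Rightarrow> ('i set \<Rightarrow> 'v) \<Rightarrow> 'i set \<Rightarrow> 'v" where
  "cube_bd I \<rho> R c \<tau> =
     (if \<tau> \<subseteq> I then \<Sum>i\<in>I-\<tau>. signed (pos \<rho> i \<tau>) (R i (c (insert i \<tau>))) else 0)"

definition cube_chains :: "'i set \<Rightarrow> ('i set \<Rightarrow> 'v::ab_group_add set) \<Rightarrow> nat \<Rightarrow> ('i set \<Rightarrow> 'v) set" where
  "cube_chains I F s = {c. \<forall>\<tau>. if \<tau> \<subseteq> I \<and> card \<tau> = s then c \<tau> \<in> F \<tau> else c \<tau> = 0}"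

text \<open>Size s corresponds to reduced dimension s - 1, so vanishing in all dimensions from d on
  reads: exact at every s with d < s.\<close>

definition exact_at ::
  "'i set \<Rightarrow> ('i \<Rightarrow> nat) \<Rightarrow> ('i set \<Rightarrow> 'v::ab_group_add set) \<Rightarrow> ('i \<Rightarrow> 'v \<Rightarrow> 'v) \<Rightarrow> nat \<Rightarrow> bool" where
  "exact_at I \<rho> F R s \<longleftrightarrow>
     (\<forall>c\<in>cube_chains I F s. cube_bd I \<rho> R c = 0 \<longrightarrow> (\<exists>b\<in>cube_chains I F (Suc s). cube_bd I \<rho> R b = c))"

lemma cube_chainsI:
  assumes "\<And>\<tau>. \<tau> \<subseteq> I \<Longrightarrow> card \<tau> = s \<Longrightarrow> c \<tau> \<in> F \<tau>"
    and "\<And>\<tau>. \<not> (\<tau> \<subseteq> I \<and> card \<tau> = s) \<Longrightarrow> c \<tau> = 0"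
  shows "c \<in> cube_chains I F s"
  using assms by (auto simp: cube_chains_def)

lemma cube_chains_mem: "c \<in> cube_chains I F s \<Longrightarrow> \<tau> \<subseteq> I \<Longrightarrow> card \<tau> = s \<Longrightarrow> c \<tau> \<in> F \<tau>"
  by (auto simp: cube_chains_def split: if_splits)

lemma cube_chains_zero: "c \<in> cube_chains I F s \<Longrightarrow> \<not> (\<tau> \<subseteq> I \<and> card \<tau> = s) \<Longrightarrow> c \<tau> = 0"
  by (auto simp: cube_chains_def dest: spec[of _ \<tau>] split: if_splits)

lemma cube_bd_cong:
  assumes "\<And>i. i \<in> I \<Longrightarrow> R i = R' i"
  shows "cube_bd I \<rho> R c = cube_bd I \<rho> R' c"
  unfolding cube_bd_def fun_eq_iff using assms by (auto intro!: sum.cong)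

lemma sum_antisymmetric:
  fixes f :: "'i \<Rightarrow> 'i \<Rightarrow> 'v::ab_group_add"
  assumes "finite A" "\<And>i j. i \<in> A \<Longrightarrow> j \<in> A \<Longrightarrow> i \<noteq> j \<Longrightarrow> f i j = - f j i"
  shows "(\<Sum>i\<in>A. \<Sum>j\<in>A-{i}. f i j) = 0"
  using assms
proof (induction A rule: finite_induct)
  case (insert a A)
  have "(\<Sum>j\<in>insert a A - {i}. f i j) = f i a + (\<Sum>j\<in>A-{i}. f i j)" if "i \<in> A" for i
  proof -
    have "insert a A - {i} = insert a (A - {i})" using that insert.hyps by auto
    then show ?thesis using insert.hyps by simp
  qed
  moreover have "insert a A - {a} = A" using insert.hyps by auto
  ultimately have "(\<Sum>i\<in>insert a A. \<Sum>j\<in>insert a A-{i}. f i j)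
      = (\<Sum>j\<in>A. f a j) + ((\<Sum>i\<in>A. f i a) + (\<Sum>i\<in>A. \<Sum>j\<in>A-{i}. f i j))"
    using insert.hyps by (simp add: sum.distrib)
  also have "(\<Sum>i\<in>A. \<Sum>j\<in>A-{i}. f i j) = 0"
    by (rule insert.IH) (rule insert.prems, auto)
  also have "(\<Sum>i\<in>A. f i a) = (\<Sum>i\<in>A. - f a i)"
    using insert.hyps by (intro sum.cong refl insert.prems) auto
  finally show ?case by (simp add: sum_negf)
qed simp

text \<open>Functors on subsets of I, contravariant for inclusion. All groups sit in one ambient
  type, so that a single additive map \<open>R i\<close> serves as the deletion of i on every
  \<open>F \<tau>\<close>; the deletions have to commute only on elements of these groups.\<close>

locale cube =
  fixes I :: "'i set" and F :: "'i set \<Rightarrow> 'v::ab_group_add set" and R :: "'i \<Rightarrow> 'v \<Rightarrow> 'v"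
  assumes fin: "finite I"
    and R_additive: "additive (R i)"
    and F_0: "\<tau> \<subseteq> I \<Longrightarrow> 0 \<in> F \<tau>"
    and F_add: "\<tau> \<subseteq> I \<Longrightarrow> x \<in> F \<tau> \<Longrightarrow> y \<in> F \<tau> \<Longrightarrow> x + y \<in> F \<tau>"
    and F_minus: "\<tau> \<subseteq> I \<Longrightarrow> x \<in> F \<tau> \<Longrightarrow> - x \<in> F \<tau>"
    and R_mem: "\<tau> \<subseteq> I \<Longrightarrow> i \<in> I \<Longrightarrow> i \<notin> \<tau> \<Longrightarrow> x \<in> F (insert i \<tau>) \<Longrightarrow> R i x \<in> F \<tau>"
    and R_commute: "\<tau> \<subseteq> I \<Longrightarrow> i \<in> I \<Longrightarrow> j \<in> I \<Longrightarrow> i \<notin> \<tau> \<Longrightarrow> j \<notin> \<tau> \<Longrightarrow> i \<noteq> j \<Longrightarrow>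
      x \<in> F (insert i (insert j \<tau>)) \<Longrightarrow> R i (R j x) = R j (R i x)"
begin

lemma subcube:
  assumes "S \<subseteq> I"
  shows "cube S F R"
proof (rule cube.intro)
  show "finite S" using assms fin finite_subset by blast
  show "additive (R i)" for i by (rule R_additive)
  fix \<tau> assume "\<tau> \<subseteq> S"
  then have \<tau>: "\<tau> \<subseteq> I" using assms by blast
  show "0 \<in> F \<tau>" using \<tau> by (rule F_0)
  show "x + y \<in> F \<tau>" if "x \<in> F \<tau>" "y \<in> F \<tau>" for x y using \<tau> that by (rule F_add)
  show "- x \<in> F \<tau>" if "x \<in> F \<tau>" for x using \<tau> that by (rule F_minus)
  show "R i x \<in> F \<tau>" if "i \<in> S" "i \<notin> \<tau>" "x \<in> F (insert i \<tau>)" for i x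
    using that assms by (intro R_mem[OF \<tau>]) auto
  show "R i (R j x) = R j (R i x)"
    if "i \<in> S" "j \<in> S" "i \<notin> \<tau>" "j \<notin> \<tau>" "i \<noteq> j" "x \<in> F (insert i (insert j \<tau>))" for i j x
    using that assms by (intro R_commute[OF \<tau>]) auto
qed

lemma F_signed: "\<tau> \<subseteq> I \<Longrightarrow> x \<in> F \<tau> \<Longrightarrow> signed n x \<in> F \<tau>"
  by (simp add: signed_def F_minus)

lemma F_sum: "\<tau> \<subseteq> I \<Longrightarrow> (\<And>i. i \<in> A \<Longrightarrow> f i \<in> F \<tau>) \<Longrightarrow> (\<Sum>i\<in>A. f i) \<in> F \<tau>"
  by (induction A rule: infinite_finite_induct) (auto simp: F_0 F_add)

lemma chains_zero: "0 \<in> cube_chains I F s"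
  by (rule cube_chainsI) (auto simp: F_0)

lemma chains_add: "c \<in> cube_chains I F s \<Longrightarrow> c' \<in> cube_chains I F s \<Longrightarrow> c + c' \<in> cube_chains I F s"
  by (rule cube_chainsI) (auto simp: F_add cube_chains_mem cube_chains_zero)

lemma chains_minus: "c \<in> cube_chains I F s \<Longrightarrow> - c \<in> cube_chains I F s"
  by (rule cube_chainsI) (auto simp: F_minus cube_chains_mem cube_chains_zero)

lemma chains_diff: "c \<in> cube_chains I F s \<Longrightarrow> c' \<in> cube_chains I F s \<Longrightarrow> c - c' \<in> cube_chains I F s"
  using chains_add[of c s "- c'"] chains_minus[of c' s] by simp

lemma bd_add: "cube_bd I \<rho> R (c + c') = cube_bd I \<rho> R c + cube_bd I \<rho> R c'"
  by (auto simp: cube_bd_def fun_eq_iff additive.add[OF R_additive] signed_add sum.distrib)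

lemma bd_additive: "additive (cube_bd I \<rho> R)"
  by (simp add: additive_def bd_add)

lemma bd_chains:
  assumes c: "c \<in> cube_chains I F (Suc s)"
  shows "cube_bd I \<rho> R c \<in> cube_chains I F s"
proof (rule cube_chainsI)
  fix \<tau> assume \<tau>: "\<tau> \<subseteq> I" "card \<tau> = s"
  then have "c (insert i \<tau>) \<in> F (insert i \<tau>)" if "i \<in> I - \<tau>" for i
    using that c fin by (intro cube_chains_mem[OF c]) (auto simp: card_insert_if finite_subset)
  then show "cube_bd I \<rho> R c \<tau> \<in> F \<tau>"
    using \<tau> by (auto simp: cube_bd_def intro!: F_sum F_signed R_mem)
next
  fix \<tau> assume \<tau>: "\<not> (\<tau> \<subseteq> I \<and> card \<tau> = s)"
  have "c (insert i \<tau>) = 0" if "i \<in> I - \<tau>" "\<tau> \<subseteq> I" for i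
    using that \<tau> fin by (intro cube_chains_zero[OF c]) (auto simp: card_insert_if finite_subset)
  then show "cube_bd I \<rho> R c \<tau> = 0"
    using additive.zero[OF R_additive] by (auto simp: cube_bd_def intro!: sum.neutral)
qed

lemma bd_bd:
  assumes c: "c \<in> cube_chains I F s" and inj: "inj_on \<rho> I"
  shows "cube_bd I \<rho> R (cube_bd I \<rho> R c) = 0"
proof
  fix \<tau>
  show "cube_bd I \<rho> R (cube_bd I \<rho> R c) \<tau> = 0 \<tau>"
  proof (cases "\<tau> \<subseteq> I")
    case True
    then have fin\<tau>: "finite \<tau>" using fin finite_subset by blast
    define f where "f i j = signed (pos \<rho> i \<tau> + pos \<rho> j (insert i \<tau>)) (R i (R j (c (insert j (insert i \<tau>)))))" for i j
    have "cube_bd I \<rho> R (cube_bd I \<rho> R c) \<tau> = (\<Sum>i\<in>I-\<tau>. \<Sum>j\<in>I-\<tau>-{i}. f i j)"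
    proof -
      have "I - insert i \<tau> = I - \<tau> - {i}" for i by auto
      then show ?thesis
        using True by (auto simp: cube_bd_def f_def additive.sum[OF R_additive] signed_sum
            additive.signed[OF R_additive] signed_signed intro!: sum.cong)
    qed
    also have "\<dots> = 0"
    proof (rule sum_antisymmetric)
      fix i j assume ij: "i \<in> I - \<tau>" "j \<in> I - \<tau>" "i \<noteq> j"
      have mem: "c (insert i (insert j \<tau>)) \<in> F (insert i (insert j \<tau>))"
        using cube_chains_mem[OF c, of "insert i (insert j \<tau>)"] cube_chains_zero[OF c, of "insert i (insert j \<tau>)"]
          F_0[of "insert i (insert j \<tau>)"] ij True by auto metis
      have "R i (R j (c (insert i (insert j \<tau>)))) = R j (R i (c (insert i (insert j \<tau>))))"
        using ij True mem by (intro R_commute[of \<tau>]) auto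
      \<comment> \<open>Exactly one of i and j precedes the other, so exactly one of the two
        positions is raised by the insertion.\<close>
      moreover have "even (pos \<rho> i \<tau> + pos \<rho> j (insert i \<tau>)) \<longleftrightarrow> odd (pos \<rho> j \<tau> + pos \<rho> i (insert j \<tau>))"
      proof -
        have "\<rho> i \<noteq> \<rho> j" using ij inj by (auto simp: inj_on_def)
        then have "\<rho> i < \<rho> j \<or> \<rho> j < \<rho> i" by auto
        then show ?thesis using ij fin\<tau> by (auto simp: pos_insert)
      qed
      ultimately show "f i j = - f j i"
        by (auto simp: f_def signed_def insert_commute)
    qed (use fin in auto)
    finally show ?thesis by simp
  qed (simp add: cube_bd_def)
qed

end

text \<open>Multiplication by the inversion sign is an involution of the chains that intertwines the
  two boundaries.\<close>

lemma exact_at_reorder: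
  assumes cube: "cube I F R" and inj: "inj_on \<rho> I" "inj_on \<rho>' I" and ex: "exact_at I \<rho> F R s"
  shows "exact_at I \<rho>' F R s"
  unfolding exact_at_def
proof (intro ballI impI)
  interpret cube I F R by fact
  define tw where "tw c \<tau> = signed (inversions \<rho> \<rho>' \<tau>) (c \<tau>)" for c :: "'a set \<Rightarrow> 'b" and \<tau>
  have tw: "tw c \<in> cube_chains I F k" if "c \<in> cube_chains I F k" for c k
    using that by (intro cube_chainsI) (auto simp: tw_def F_signed cube_chains_mem cube_chains_zero)
  have tw_tw: "tw (tw c) = c" for c
    by (auto simp: tw_def signed_def)
  have bd_tw: "cube_bd I \<rho>' R (tw c) = tw (cube_bd I \<rho> R c)" for c
  proof
    fix \<tau>
    show "cube_bd I \<rho>' R (tw c) \<tau> = tw (cube_bd I \<rho> R c) \<tau>"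
    proof (cases "\<tau> \<subseteq> I")
      case True
      then have f: "finite \<tau>" using fin finite_subset by blast
      have "signed (pos \<rho>' i \<tau>) (R i (tw c (insert i \<tau>))) =
          signed (inversions \<rho> \<rho>' \<tau>) (signed (pos \<rho> i \<tau>) (R i (c (insert i \<tau>))))" if i: "i \<in> I - \<tau>" for i
      proof -
        have "insert i \<tau> \<subseteq> I" using i True by auto
        then have "even (pos \<rho>' i \<tau> + inversions \<rho> \<rho>' (insert i \<tau>)) = even (inversions \<rho> \<rho>' \<tau> + pos \<rho> i \<tau>)"
          using i f inj by (meson DiffD2 even_pos_inversions inj_on_subset)
        then show ?thesis
          unfolding tw_def additive.signed[OF R_additive] signed_signed by (rule signed_cong)
      qed
      then show ?thesis using True by (simp add: cube_bd_def tw_def signed_sum)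
    qed (simp add: cube_bd_def tw_def)
  qed
  fix c assume c: "c \<in> cube_chains I F s" "cube_bd I \<rho>' R c = 0"
  have "tw (cube_bd I \<rho> R (tw c)) = 0"
    using bd_tw[of "tw c"] c tw_tw by simp
  then have "cube_bd I \<rho> R (tw c) = 0"
    by (auto simp: tw_def fun_eq_iff)
  then obtain b where b: "b \<in> cube_chains I F (Suc s)" "cube_bd I \<rho> R b = tw c"
    using ex tw[OF c(1)] by (auto simp: exact_at_def)
  show "\<exists>b\<in>cube_chains I F (Suc s). cube_bd I \<rho>' R b = c"
    using tw[OF b(1)] bd_tw[of b] b(2) tw_tw by auto
qed

section \<open>Maps of functors, retracts and quotients\<close>

definition cube_map :: "'i set \<Rightarrow> ('i set \<Rightarrow> 'v::ab_group_add set) \<Rightarrow> ('i \<Rightarrow> 'v \<Rightarrow> 'v) \<Rightarrow>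
    ('i set \<Rightarrow> 'w::ab_group_add set) \<Rightarrow> ('i \<Rightarrow> 'w \<Rightarrow> 'w) \<Rightarrow> ('v \<Rightarrow> 'w) \<Rightarrow> bool" where
  "cube_map I F R F' R' f \<longleftrightarrow> additive f \<and> (\<forall>\<tau>\<subseteq>I. f ` F \<tau> \<subseteq> F' \<tau>) \<and>
     (\<forall>\<tau>\<subseteq>I. \<forall>i\<in>I-\<tau>. \<forall>x\<in>F (insert i \<tau>). f (R i x) = R' i (f x))"

lemma cube_map_chains:
  assumes "cube_map I F R F' R' f" "c \<in> cube_chains I F s"
  shows "(\<lambda>\<tau>. f (c \<tau>)) \<in> cube_chains I F' s"
  using assms additive.zero[of f]
  by (intro cube_chainsI) (auto simp: cube_map_def image_subset_iff cube_chains_mem cube_chains_zero)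

lemma cube_map_bd:
  assumes f: "cube_map I F R F' R' f" and c: "c \<in> cube_chains I F s" and "cube I F R"
  shows "cube_bd I \<rho> R' (\<lambda>\<tau>. f (c \<tau>)) = (\<lambda>\<tau>. f (cube_bd I \<rho> R c \<tau>))"
proof
  fix \<tau>
  interpret cube I F R by fact
  interpret f: additive f using f by (simp add: cube_map_def)
  have "R' i (f (c (insert i \<tau>))) = f (R i (c (insert i \<tau>)))" if "i \<in> I - \<tau>" "\<tau> \<subseteq> I" for i
  proof -
    have "c (insert i \<tau>) \<in> F (insert i \<tau>)"
      using that cube_chains_mem[OF c, of "insert i \<tau>"] cube_chains_zero[OF c, of "insert i \<tau>"]
        F_0[of "insert i \<tau>"] by auto metis
    then show ?thesis using f that by (auto simp: cube_map_def)
  qed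
  then show "cube_bd I \<rho> R' (\<lambda>\<tau>. f (c \<tau>)) \<tau> = f (cube_bd I \<rho> R c \<tau>)"
    by (auto simp: cube_bd_def f.zero f.sum f.signed intro!: sum.cong)
qed

text \<open>The section g carries a cycle to F, where it bounds, and f carries the bounding chain
  back. This serves both for changes of encoding and for the passage to a direct summand.\<close>

lemma exact_at_retract:
  assumes "cube I F R" "cube I F' R'" and f: "cube_map I F R F' R' f" and g: "cube_map I F' R' F R g"
    and fg: "\<And>\<tau> x. \<tau> \<subseteq> I \<Longrightarrow> x \<in> F' \<tau> \<Longrightarrow> f (g x) = x"
    and ex: "exact_at I \<rho> F R s"
  shows "exact_at I \<rho> F' R' s"
  unfolding exact_at_def
proof (intro ballI impI)
  fix c assume c: "c \<in> cube_chains I F' s" "cube_bd I \<rho> R' c = 0"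
  interpret f: additive f using f by (simp add: cube_map_def)
  interpret g: additive g using g by (simp add: cube_map_def)
  have "cube_bd I \<rho> R (\<lambda>\<tau>. g (c \<tau>)) = 0"
    using cube_map_bd[OF g c(1) assms(2)] c(2) by (simp add: g.zero fun_eq_iff)
  then obtain b where b: "b \<in> cube_chains I F (Suc s)" "cube_bd I \<rho> R b = (\<lambda>\<tau>. g (c \<tau>))"
    using ex cube_map_chains[OF g c(1)] by (auto simp: exact_at_def)
  have "f (g (c \<tau>)) = c \<tau>" for \<tau>
    using fg[of \<tau> "c \<tau>"] cube_chains_mem[OF c(1), of \<tau>] cube_chains_zero[OF c(1), of \<tau>] f.zero g.zero
    by metis
  then have "cube_bd I \<rho> R' (\<lambda>\<tau>. f (b \<tau>)) = c"
    using cube_map_bd[OF f b(1) assms(1)] b(2) by simp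
  then show "\<exists>b\<in>cube_chains I F' (Suc s). cube_bd I \<rho> R' b = c"
    using cube_map_chains[OF f b(1)] by blast
qed

text \<open>In the long exact sequence of 0 \<rightarrow> K \<rightarrow> F \<rightarrow> F'
  \<rightarrow> 0 the homology of F' at size s + 1 lies between that of F at size s + 1 and that of
  K at size s. This is one step of dimension shifting.\<close>

lemma exact_at_quotient:
  assumes K: "cube I K R" and F: "cube I F R" and F': "cube I F' R'"
    and f: "cube_map I F R F' R' f" and inj: "inj_on \<rho> I"
    and ker: "\<And>\<tau>. \<tau> \<subseteq> I \<Longrightarrow> K \<tau> = {x \<in> F \<tau>. f x = 0}"
    and surj: "\<And>\<tau> y. \<tau> \<subseteq> I \<Longrightarrow> y \<in> F' \<tau> \<Longrightarrow> \<exists>x\<in>F \<tau>. f x = y"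
    and exF: "exact_at I \<rho> F R (Suc s)" and exK: "exact_at I \<rho> K R s"
  shows "exact_at I \<rho> F' R' (Suc s)"
  unfolding exact_at_def
proof (intro ballI impI)
  fix c assume c: "c \<in> cube_chains I F' (Suc s)" "cube_bd I \<rho> R' c = 0"
  interpret F: cube I F R by fact
  interpret f: additive f using f by (simp add: cube_map_def)
  have K_F: "cube_chains I K k \<subseteq> cube_chains I F k" for k
    using ker by (auto simp: cube_chains_def split: if_splits)
  \<comment> \<open>A lift of c that is 0 wherever c is, so that the lift is again supported on
    cells of the right size.\<close>
  define c' where "c' \<tau> = (if c \<tau> = 0 then 0 else SOME x. x \<in> F \<tau> \<and> f x = c \<tau>)" for \<tau>
  have c': "c' \<tau> \<in> F \<tau> \<and> f (c' \<tau>) = c \<tau>" if "\<tau> \<subseteq> I" "card \<tau> = Suc s" for \<tau>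
  proof (cases "c \<tau> = 0")
    case False
    have "\<exists>x. x \<in> F \<tau> \<and> f x = c \<tau>" using surj[OF that(1)] cube_chains_mem[OF c(1) that] by blast
    from someI_ex[OF this] show ?thesis using False by (simp add: c'_def)
  qed (use that F.F_0 f.zero in \<open>auto simp: c'_def\<close>)
  have c'_ch: "c' \<in> cube_chains I F (Suc s)"
    using c' by (intro cube_chainsI) (auto simp: c'_def cube_chains_zero[OF c(1)])
  have fc': "(\<lambda>\<tau>. f (c' \<tau>)) = c"
  proof
    fix \<tau> show "f (c' \<tau>) = c \<tau>"
      using c'[of \<tau>] cube_chains_zero[OF c(1), of \<tau>] f.zero by (cases "\<tau> \<subseteq> I \<and> card \<tau> = Suc s") (auto simp: c'_def)
  qed
  have "f (cube_bd I \<rho> R c' \<tau>) = 0" for \<tau>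
    using cube_map_bd[OF f c'_ch F, of \<rho>] fc' c(2) by (simp add: fun_eq_iff)
  then have "cube_bd I \<rho> R c' \<in> cube_chains I K s"
    using F.bd_chains[OF c'_ch, of \<rho>] ker by (auto simp: cube_chains_def)
  then obtain z where z: "z \<in> cube_chains I K (Suc s)" "cube_bd I \<rho> R z = cube_bd I \<rho> R c'"
    using exK F.bd_bd[OF c'_ch inj] by (auto simp: exact_at_def)
  \<comment> \<open>The boundary of the lift lies in K and bounds some z there; subtracting z makes
    the lift a cycle without changing its image under f.\<close>
  have "cube_bd I \<rho> R (c' - z) = 0"
    using z(2) additive.diff[OF F.bd_additive] by simp
  moreover have z_F: "z \<in> cube_chains I F (Suc s)" using z(1) K_F by blast
  ultimately obtain b where b: "b \<in> cube_chains I F (Suc (Suc s))" "cube_bd I \<rho> R b = c' - z"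
    using exF F.chains_diff[OF c'_ch z_F] by (auto simp: exact_at_def)
  have "f (z \<tau>) = 0" for \<tau>
    using cube_chains_mem[OF z(1), of \<tau>] cube_chains_zero[OF z(1), of \<tau>] ker[of \<tau>] f.zero by auto metis
  then have "cube_bd I \<rho> R' (\<lambda>\<tau>. f (b \<tau>)) = c"
    using cube_map_bd[OF f b(1) F, of \<rho>] b(2) fc' by (auto simp: f.diff fun_eq_iff)
  then show "\<exists>b\<in>cube_chains I F' (Suc (Suc s)). cube_bd I \<rho> R' b = c"
    using cube_map_chains[OF f b(1)] by blast
qed

section \<open>Mapping cones and links\<close>

text \<open>Exactness at size s + 1 of the mapping cone of g, written out on components.\<close>

definition cone_exact :: "'i set \<Rightarrow> ('i \<Rightarrow> nat) \<Rightarrow> ('i set \<Rightarrow> 'v::ab_group_add set) \<Rightarrow> ('i set \<Rightarrow> 'v set) \<Rightarrow>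
    ('i \<Rightarrow> 'v \<Rightarrow> 'v) \<Rightarrow> ('v \<Rightarrow> 'v) \<Rightarrow> nat \<Rightarrow> bool" where
  "cone_exact J \<rho> P Q R g s \<longleftrightarrow>
    (\<forall>p\<in>cube_chains J P s. \<forall>q\<in>cube_chains J Q (Suc s).
       cube_bd J \<rho> R p = 0 \<longrightarrow> (\<lambda>\<tau>. g (p \<tau>)) + cube_bd J \<rho> R q = 0 \<longrightarrow>
       (\<exists>p'\<in>cube_chains J P (Suc s). \<exists>q'\<in>cube_chains J Q (Suc (Suc s)).
          cube_bd J \<rho> R p' = - p \<and> (\<lambda>\<tau>. g (p' \<tau>)) + cube_bd J \<rho> R q' = q))"

section \<open>Splitting off one colour\<close>

context
  fixes I J :: "'i set" and i :: 'i and F :: "'i set \<Rightarrow> 'v::ab_group_add set"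
    and R :: "'i \<Rightarrow> 'v \<Rightarrow> 'v" and \<rho> :: "'i \<Rightarrow> nat"
  assumes cube: "cube I F R" and I: "I = insert i J" and i: "i \<notin> J" and min: "\<And>j. j \<in> J \<Longrightarrow> \<rho> i < \<rho> j"
begin

interpretation cube I F R by (rule cube)

text \<open>A chain on \<open>insert i J\<close> is a pair: p holds the values on cells containing
  i, indexed by the rest of the cell, and q the values on cells without i.\<close>

private definition glue :: "('i set \<Rightarrow> 'v) \<Rightarrow> ('i set \<Rightarrow> 'v) \<Rightarrow> 'i set \<Rightarrow> 'v" where
  "glue p q \<tau> = (if i \<in> \<tau> then p (\<tau> - {i}) else q \<tau>)"

private lemma finite_subset_J: "\<tau> \<subseteq> J \<Longrightarrow> finite \<tau>"
  using fin I finite_subset by auto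

private lemma glue_chains:
  assumes p: "p \<in> cube_chains J (\<lambda>\<tau>. F (insert i \<tau>)) s" and q: "q \<in> cube_chains J F (Suc s)"
  shows "glue p q \<in> cube_chains I F (Suc s)"
proof (rule cube_chainsI)
  fix \<tau> assume \<tau>: "\<tau> \<subseteq> I" "card \<tau> = Suc s"
  show "glue p q \<tau> \<in> F \<tau>"
  proof (cases "i \<in> \<tau>")
    case True
    then have "\<tau> - {i} \<subseteq> J" "card (\<tau> - {i}) = s" using \<tau> I by auto
    from cube_chains_mem[OF p this] show ?thesis using True by (simp add: glue_def insert_absorb)
  next
    case False
    then have "\<tau> \<subseteq> J" using \<tau> I by auto
    from cube_chains_mem[OF q this \<tau>(2)] show ?thesis using False by (simp add: glue_def)
  qed
next
  fix \<tau> assume \<tau>: "\<not> (\<tau> \<subseteq> I \<and> card \<tau> = Suc s)"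
  show "glue p q \<tau> = 0"
  proof (cases "i \<in> \<tau>")
    case True
    have "\<not> (\<tau> - {i} \<subseteq> J \<and> card (\<tau> - {i}) = s)"
    proof
      assume *: "\<tau> - {i} \<subseteq> J \<and> card (\<tau> - {i}) = s"
      then have "card (insert i (\<tau> - {i})) = Suc s"
        using finite_subset_J[of "\<tau> - {i}"] by (subst card_insert_disjoint) auto
      then show False using * \<tau> I True by (auto simp: insert_absorb)
    qed
    then show ?thesis using cube_chains_zero[OF p] True by (simp add: glue_def)
  next
    case False
    then show ?thesis using cube_chains_zero[OF q, of \<tau>] \<tau> I by (auto simp: glue_def)
  qed
qed

private lemma unglue:
  assumes c: "c \<in> cube_chains I F (Suc s)"
  obtains p q where "p \<in> cube_chains J (\<lambda>\<tau>. F (insert i \<tau>)) s" "q \<in> cube_chains J F (Suc s)" "c = glue p q"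
proof
  let ?p = "\<lambda>\<tau>. if \<tau> \<subseteq> J then c (insert i \<tau>) else 0"
  let ?q = "\<lambda>\<tau>. if \<tau> \<subseteq> J then c \<tau> else 0"
  have card: "card (insert i \<tau>) = Suc (card \<tau>)" if "\<tau> \<subseteq> J" for \<tau>
    using that i finite_subset_J by (subst card_insert_disjoint) auto
  show "?p \<in> cube_chains J (\<lambda>\<tau>. F (insert i \<tau>)) s"
    using I card by (intro cube_chainsI) (auto intro!: cube_chains_mem[OF c] cube_chains_zero[OF c])
  show "?q \<in> cube_chains J F (Suc s)"
    using I by (intro cube_chainsI) (auto intro!: cube_chains_mem[OF c] cube_chains_zero[OF c])
  show "c = glue ?p ?q"
  proof
    fix \<tau>
    have "c \<tau> = 0" if "\<not> \<tau> \<subseteq> I" using that by (intro cube_chains_zero[OF c]) auto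
    then show "c \<tau> = glue ?p ?q \<tau>"
      using I by (auto simp: glue_def insert_absorb)
  qed
qed

text \<open>Since i comes first, its own deletion has sign +, and on cells containing i it raises
  the position of every other colour by one, whence the minus sign on p. The right-hand side is the
  differential of the mapping cone of \<open>R i\<close>.\<close>

private lemma glue_bd:
  assumes p: "p \<in> cube_chains J P s" and q: "q \<in> cube_chains J Q t"
  shows "cube_bd I \<rho> R (glue p q) = glue (- cube_bd J \<rho> R p) ((\<lambda>\<tau>. R i (p \<tau>)) + cube_bd J \<rho> R q)"
proof
  fix \<tau>
  consider "\<not> \<tau> \<subseteq> I" | "\<tau> \<subseteq> I" "i \<in> \<tau>" | "\<tau> \<subseteq> J" using I by auto
  then show "cube_bd I \<rho> R (glue p q) \<tau> = glue (- cube_bd J \<rho> R p) ((\<lambda>\<tau>. R i (p \<tau>)) + cube_bd J \<rho> R q) \<tau>"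
  proof cases
    case 1
    then have "\<not> \<tau> - {i} \<subseteq> J" "\<not> \<tau> \<subseteq> J" using I by auto
    then show ?thesis
      using 1 cube_chains_zero[OF p, of \<tau>] additive.zero[OF R_additive]
      by (simp add: cube_bd_def glue_def)
  next
    case 2
    define \<sigma> where "\<sigma> = \<tau> - {i}"
    have \<sigma>: "\<tau> = insert i \<sigma>" "i \<notin> \<sigma>" "\<sigma> \<subseteq> J" using 2 I by (auto simp: \<sigma>_def)
    have "pos \<rho> j \<tau> = Suc (pos \<rho> j \<sigma>)" if "j \<in> J" for j
      using \<sigma> finite_subset_J[of \<sigma>] min[OF that] by (simp add: pos_insert)
    moreover have "I - \<tau> = J - \<sigma>" using \<sigma> I i by auto
    moreover have "insert j \<tau> - {i} = insert j \<sigma>" if "j \<in> J" for j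
      using that \<sigma> i by auto
    ultimately show ?thesis
      using \<sigma> 2 by (simp add: cube_bd_def glue_def signed_Suc sum_negf)
  next
    case 3
    then have \<tau>: "i \<notin> \<tau>" "\<tau> \<subseteq> I" using i I by auto
    have "{j \<in> \<tau>. \<rho> j < \<rho> i} = {}" using min 3 by force
    then have "pos \<rho> i \<tau> = 0" by (simp only: pos_def card.empty)
    moreover have "I - \<tau> = insert i (J - \<tau>)" using \<tau> I by auto
    moreover have "finite (J - \<tau>)" using fin I by auto
    moreover have "(\<Sum>j\<in>J-\<tau>. signed (pos \<rho> j \<tau>) (R j (glue p q (insert j \<tau>)))) =
        (\<Sum>j\<in>J-\<tau>. signed (pos \<rho> j \<tau>) (R j (q (insert j \<tau>))))"
      using \<tau> i by (intro sum.cong refl) (auto simp: glue_def)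
    moreover have "glue p q (insert i \<tau>) = p \<tau>"
      using \<tau> by (simp add: glue_def)
    ultimately show ?thesis using 3 \<tau> i
      by (simp add: cube_bd_def glue_def)
  qed
qed

private lemma glue_eqD:
  assumes "glue p q = glue p' q'"
    "p \<in> cube_chains J P s" "q \<in> cube_chains J Q t" "p' \<in> cube_chains J P' s'" "q' \<in> cube_chains J Q' t'"
  shows "p = p'" "q = q'"
proof -
  have "p \<tau> = p' \<tau>" for \<tau>
  proof (cases "\<tau> \<subseteq> J")
    case True
    then have "insert i \<tau> - {i} = \<tau>" using i by auto
    then have "glue p q (insert i \<tau>) = p \<tau>" "glue p' q' (insert i \<tau>) = p' \<tau>" by (simp_all only: glue_def insertI1 if_True)
    then show ?thesis using assms(1) by simp
  qed (use assms(2,4)[THEN cube_chains_zero] in simp)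
  moreover have "q \<tau> = q' \<tau>" for \<tau>
  proof (cases "\<tau> \<subseteq> J")
    case True
    then have "glue p q \<tau> = q \<tau>" "glue p' q' \<tau> = q' \<tau>" using i by (auto simp: glue_def)
    then show ?thesis using assms(1) by simp
  qed (use assms(3,5)[THEN cube_chains_zero] in simp)
  ultimately show "p = p'" "q = q'" by auto
qed

lemma cube_top: "cube J (\<lambda>\<tau>. F (insert i \<tau>)) R"
proof (rule cube.intro)
  show "finite J" using fin I by simp
  show "additive (R j)" for j by (rule R_additive)
  fix \<tau> assume "\<tau> \<subseteq> J"
  then have \<tau>: "insert i \<tau> \<subseteq> I" using I by auto
  show "0 \<in> F (insert i \<tau>)" using \<tau> by (rule F_0)
  show "x + y \<in> F (insert i \<tau>)" if "x \<in> F (insert i \<tau>)" "y \<in> F (insert i \<tau>)" for x y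
    using \<tau> that by (rule F_add)
  show "- x \<in> F (insert i \<tau>)" if "x \<in> F (insert i \<tau>)" for x using \<tau> that by (rule F_minus)
  show "R j x \<in> F (insert i \<tau>)" if "j \<in> J" "j \<notin> \<tau>" "x \<in> F (insert i (insert j \<tau>))" for j x
    using that I i by (intro R_mem[OF \<tau>]) (auto simp: insert_commute)
  show "R j (R k x) = R k (R j x)"
    if "j \<in> J" "k \<in> J" "j \<notin> \<tau>" "k \<notin> \<tau>" "j \<noteq> k" "x \<in> F (insert i (insert j (insert k \<tau>)))" for j k x
    using that I i by (intro R_commute[OF \<tau>]) (auto simp: insert_commute)
qed

lemma cube_map_top: "cube_map J (\<lambda>\<tau>. F (insert i \<tau>)) R F R (R i)"
  unfolding cube_map_def
proof (intro conjI allI impI ballI)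
  show "additive (R i)" by (rule R_additive)
  fix \<tau> assume \<tau>: "\<tau> \<subseteq> J"
  show "R i ` F (insert i \<tau>) \<subseteq> F \<tau>" using \<tau> I i by (auto intro: R_mem)
  fix j x assume "j \<in> J - \<tau>" "x \<in> F (insert i (insert j \<tau>))"
  then show "R i (R j x) = R j (R i x)"
    using \<tau> I i by (intro R_commute[of \<tau>]) auto
qed

text \<open>\<open>glue\<close> identifies the chains of the cone of \<open>R i\<close> with the
  chains on I, and by \<open>glue_bd\<close> the differentials correspond.\<close>

lemma exact_at_iff_cone:
  "exact_at I \<rho> F R (Suc s) \<longleftrightarrow> cone_exact J \<rho> (\<lambda>\<tau>. F (insert i \<tau>)) F R (R i) s" (is "?E \<longleftrightarrow> ?C")
proof
  interpret P: cube J "\<lambda>\<tau>. F (insert i \<tau>)" R by (rule cube_top)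
  interpret Q: cube J F R using I by (intro subcube) auto
  assume ?E
  show ?C unfolding cone_exact_def
  proof (intro ballI impI)
    fix p q assume pq: "p \<in> cube_chains J (\<lambda>\<tau>. F (insert i \<tau>)) s" "q \<in> cube_chains J F (Suc s)"
      "cube_bd J \<rho> R p = 0" "(\<lambda>\<tau>. R i (p \<tau>)) + cube_bd J \<rho> R q = 0"
    then have "cube_bd I \<rho> R (glue p q) = 0"
      by (simp add: glue_bd) (auto simp: glue_def)
    then obtain b where "b \<in> cube_chains I F (Suc (Suc s))" "cube_bd I \<rho> R b = glue p q"
      using \<open>?E\<close> glue_chains[OF pq(1,2)] by (auto simp: exact_at_def)
    then obtain p' q' where pq': "p' \<in> cube_chains J (\<lambda>\<tau>. F (insert i \<tau>)) (Suc s)"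
        "q' \<in> cube_chains J F (Suc (Suc s))" "cube_bd I \<rho> R (glue p' q') = glue p q"
      using unglue by metis
    have "- cube_bd J \<rho> R p' \<in> cube_chains J (\<lambda>\<tau>. F (insert i \<tau>)) s"
      using pq'(1) by (intro P.chains_minus P.bd_chains)
    moreover have "(\<lambda>\<tau>. R i (p' \<tau>)) + cube_bd J \<rho> R q' \<in> cube_chains J F (Suc s)"
      using pq'(1,2) by (intro Q.chains_add Q.bd_chains cube_map_chains[OF cube_map_top])
    ultimately have "- cube_bd J \<rho> R p' = p" "(\<lambda>\<tau>. R i (p' \<tau>)) + cube_bd J \<rho> R q' = q"
      using glue_eqD[OF pq'(3)[unfolded glue_bd[OF pq'(1,2)]] _ _ pq(1,2)] by blast+
    then show "\<exists>p'\<in>cube_chains J (\<lambda>\<tau>. F (insert i \<tau>)) (Suc s). \<exists>q'\<in>cube_chains J F (Suc (Suc s)).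
          cube_bd J \<rho> R p' = - p \<and> (\<lambda>\<tau>. R i (p' \<tau>)) + cube_bd J \<rho> R q' = q"
      using pq'(1,2) by (metis minus_minus)
  qed
next
  interpret P: cube J "\<lambda>\<tau>. F (insert i \<tau>)" R by (rule cube_top)
  interpret Q: cube J F R using I by (intro subcube) auto
  assume ?C
  show ?E unfolding exact_at_def
  proof (intro ballI impI)
    fix c assume c: "c \<in> cube_chains I F (Suc s)" "cube_bd I \<rho> R c = 0"
    obtain p q where pq: "p \<in> cube_chains J (\<lambda>\<tau>. F (insert i \<tau>)) s" "q \<in> cube_chains J F (Suc s)" "c = glue p q"
      using unglue[OF c(1)] .
    have *: "glue (- cube_bd J \<rho> R p) ((\<lambda>\<tau>. R i (p \<tau>)) + cube_bd J \<rho> R q) = 0"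
      using c(2) pq glue_bd by metis
    have "cube_bd J \<rho> R p \<tau> = 0" for \<tau>
    proof (cases "\<tau> \<subseteq> J")
      case True
      then have "insert i \<tau> - {i} = \<tau>" using i by auto
      then have "- cube_bd J \<rho> R p \<tau> = 0"
        using fun_cong[OF *, of "insert i \<tau>"] by (simp only: glue_def insertI1 if_True zero_fun_def fun_Compl_def)
      then show ?thesis by simp
    qed (simp add: cube_bd_def)
    moreover have "((\<lambda>\<tau>. R i (p \<tau>)) + cube_bd J \<rho> R q) \<tau> = 0" for \<tau>
      using fun_cong[OF *, of \<tau>] i cube_chains_zero[OF pq(1), of \<tau>] additive.zero[OF R_additive]
      by (cases "\<tau> \<subseteq> J") (auto simp: glue_def cube_bd_def split: if_splits)
    ultimately have "cube_bd J \<rho> R p = 0" "(\<lambda>\<tau>. R i (p \<tau>)) + cube_bd J \<rho> R q = 0"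
      by (auto simp: fun_eq_iff)
    then obtain p' q' where pq': "p' \<in> cube_chains J (\<lambda>\<tau>. F (insert i \<tau>)) (Suc s)"
        "q' \<in> cube_chains J F (Suc (Suc s))"
        "cube_bd J \<rho> R p' = - p" "(\<lambda>\<tau>. R i (p' \<tau>)) + cube_bd J \<rho> R q' = q"
      using \<open>?C\<close> pq(1,2) unfolding cone_exact_def by blast
    then have "cube_bd I \<rho> R (glue p' q') = c"
      using glue_bd[OF pq'(1,2)] pq(3) by simp
    then show "\<exists>b\<in>cube_chains I F (Suc (Suc s)). cube_bd I \<rho> R b = c"
      using glue_chains[OF pq'(1,2)] by blast
  qed
qed

text \<open>The long exact sequence of the cone: a cycle p of the link of i has an image under
  \<open>R i\<close> that bounds some q on J; then (p, -q) is a cycle of the cone, and a chain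
  bounding it bounds p up to sign.\<close>

lemma exact_at_top:
  assumes "exact_at I \<rho> F R (Suc s)" "exact_at J \<rho> F R s"
  shows "exact_at J \<rho> (\<lambda>\<tau>. F (insert i \<tau>)) R s"
  unfolding exact_at_def
proof (intro ballI impI)
  interpret P: cube J "\<lambda>\<tau>. F (insert i \<tau>)" R by (rule cube_top)
  interpret Q: cube J F R using I by (intro subcube) auto
  fix p assume p: "p \<in> cube_chains J (\<lambda>\<tau>. F (insert i \<tau>)) s" "cube_bd J \<rho> R p = 0"
  have "cube_bd J \<rho> R (\<lambda>\<tau>. R i (p \<tau>)) = 0"
    using cube_map_bd[OF cube_map_top p(1) cube_top, of \<rho>] p(2) additive.zero[OF R_additive]
    by (simp add: fun_eq_iff)
  then obtain q where q: "q \<in> cube_chains J F (Suc s)" "cube_bd J \<rho> R q = (\<lambda>\<tau>. R i (p \<tau>))"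
    using assms(2) cube_map_chains[OF cube_map_top p(1)] by (auto simp: exact_at_def)
  have "(\<lambda>\<tau>. R i (p \<tau>)) + cube_bd J \<rho> R (- q) = 0"
    using q(2) additive.minus[OF Q.bd_additive] by simp
  then obtain p' where p': "p' \<in> cube_chains J (\<lambda>\<tau>. F (insert i \<tau>)) (Suc s)" "cube_bd J \<rho> R p' = - p"
    using assms(1)[unfolded exact_at_iff_cone] p Q.chains_minus[OF q(1)] unfolding cone_exact_def by blast
  have "cube_bd J \<rho> R (- p') = p"
    using p'(2) additive.minus[OF P.bd_additive] by simp
  then show "\<exists>b\<in>cube_chains J (\<lambda>\<tau>. F (insert i \<tau>)) (Suc s). cube_bd J \<rho> R b = p"
    using P.chains_minus[OF p'(1)] by blast
qed

end

text \<open>For a cycle (p, t) of the cone of the composite, (g p, t) is a cycle of the cone of f.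
  The q that comes from bounding it makes (p, q) a cycle of the cone of g, and the two bounding
  chains combine. The map h has to agree with the composite on P only, together with the default
  value 0 that chains take elsewhere.\<close>

lemma cone_exact_comp:
  assumes "cube J P R" "cube J Q R" "cube J T R"
    and g: "cube_map J P R Q R g" and f: "cube_map J Q R T R f"
    and gC: "cone_exact J \<rho> P Q R g s" and fC: "cone_exact J \<rho> Q T R f s"
    and h: "\<And>\<tau> x. \<tau> \<subseteq> J \<Longrightarrow> x \<in> P \<tau> \<Longrightarrow> h x = f (g x)" and "h 0 = 0"
  shows "cone_exact J \<rho> P T R h s"
  unfolding cone_exact_def
proof (intro ballI impI)
  interpret P: cube J P R by fact
  interpret Q: cube J Q R by fact
  interpret T: cube J T R by fact
  interpret f: additive f using f by (simp add: cube_map_def)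
  interpret g: additive g using g by (simp add: cube_map_def)
  have h_fg: "(\<lambda>\<tau>. h (p \<tau>)) = (\<lambda>\<tau>. f (g (p \<tau>)))" if "p \<in> cube_chains J P k" for p k
  proof
    fix \<tau> show "h (p \<tau>) = f (g (p \<tau>))"
      using h[of \<tau> "p \<tau>"] cube_chains_mem[OF that, of \<tau>] cube_chains_zero[OF that, of \<tau>] f.zero g.zero \<open>h 0 = 0\<close>
      by metis
  qed
  fix p t assume p: "p \<in> cube_chains J P s" and t: "t \<in> cube_chains J T (Suc s)"
    and bp: "cube_bd J \<rho> R p = 0" and bt: "(\<lambda>\<tau>. h (p \<tau>)) + cube_bd J \<rho> R t = 0"
  have "cube_bd J \<rho> R (\<lambda>\<tau>. g (p \<tau>)) = 0"
    using cube_map_bd[OF g p assms(1), of \<rho>] bp g.zero by (simp add: fun_eq_iff)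
  moreover have "(\<lambda>\<tau>. f (g (p \<tau>))) + cube_bd J \<rho> R t = 0"
    using bt h_fg[OF p] by simp
  ultimately obtain q t' where q: "q \<in> cube_chains J Q (Suc s)" "t' \<in> cube_chains J T (Suc (Suc s))"
      "cube_bd J \<rho> R q = - (\<lambda>\<tau>. g (p \<tau>))" "(\<lambda>\<tau>. f (q \<tau>)) + cube_bd J \<rho> R t' = t"
    using fC cube_map_chains[OF g p] t unfolding cone_exact_def by blast
  have "(\<lambda>\<tau>. g (p \<tau>)) + cube_bd J \<rho> R q = 0" using q(3) by simp
  then obtain p' q' where p': "p' \<in> cube_chains J P (Suc s)" "q' \<in> cube_chains J Q (Suc (Suc s))"
      "cube_bd J \<rho> R p' = - p" "(\<lambda>\<tau>. g (p' \<tau>)) + cube_bd J \<rho> R q' = q"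
    using gC p q(1) bp unfolding cone_exact_def by blast
  have "(\<lambda>\<tau>. h (p' \<tau>)) + cube_bd J \<rho> R ((\<lambda>\<tau>. f (q' \<tau>)) + t') = t"
    unfolding T.bd_add cube_map_bd[OF f p'(2) assms(2)] h_fg[OF p'(1)]
    using p'(4) q(4) by (auto simp: fun_eq_iff f.add[symmetric] add.assoc[symmetric])
  moreover have "(\<lambda>\<tau>. f (q' \<tau>)) + t' \<in> cube_chains J T (Suc (Suc s))"
    using q(2) cube_map_chains[OF f p'(2)] by (intro T.chains_add)
  ultimately show "\<exists>p'\<in>cube_chains J P (Suc s). \<exists>q'\<in>cube_chains J T (Suc (Suc s)).
      cube_bd J \<rho> R p' = - p \<and> (\<lambda>\<tau>. h (p' \<tau>)) + cube_bd J \<rho> R q' = t"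
    using p'(1,3) by blast
qed

section \<open>Links\<close>

lemma cube_link:
  assumes "cube I F R" "A \<subseteq> I" "B \<subseteq> I" "A \<inter> B = {}"
  shows "cube B (\<lambda>\<tau>. F (\<tau> \<union> A)) R"
proof (rule cube.intro)
  interpret cube I F R by fact
  show "finite B" using fin assms finite_subset by blast
  show "additive (R j)" for j by (rule R_additive)
  fix \<tau> assume "\<tau> \<subseteq> B"
  then have \<tau>: "\<tau> \<union> A \<subseteq> I" using assms by auto
  show "0 \<in> F (\<tau> \<union> A)" using \<tau> by (rule F_0)
  show "x + y \<in> F (\<tau> \<union> A)" if "x \<in> F (\<tau> \<union> A)" "y \<in> F (\<tau> \<union> A)" for x y
    using \<tau> that by (rule F_add)
  show "- x \<in> F (\<tau> \<union> A)" if "x \<in> F (\<tau> \<union> A)" for x using \<tau> that by (rule F_minus)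
  show "R j x \<in> F (\<tau> \<union> A)" if "j \<in> B" "j \<notin> \<tau>" "x \<in> F (insert j \<tau> \<union> A)" for j x
    using that assms by (intro R_mem[OF \<tau>]) auto
  show "R j (R k x) = R k (R j x)"
    if "j \<in> B" "k \<in> B" "j \<notin> \<tau>" "k \<notin> \<tau>" "j \<noteq> k" "x \<in> F (insert j (insert k \<tau>) \<union> A)" for j k x
    using that assms by (intro R_commute[OF \<tau>]) auto
qed

text \<open>The cone description wants the split-off colour to come first; the shift by
  \<open>Suc\<close> leaves 0 free for it.\<close>

definition first_order :: "'i \<Rightarrow> ('i \<Rightarrow> nat) \<Rightarrow> 'i \<Rightarrow> nat" where
  "first_order i \<rho> j = (if j = i then 0 else Suc (\<rho> j))"

lemma inj_on_first_order: "inj_on \<rho> I \<Longrightarrow> inj_on (first_order i \<rho>) I"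
  by (auto simp: inj_on_def first_order_def)

lemma first_order_less: "j \<noteq> i \<Longrightarrow> first_order i \<rho> i < first_order i \<rho> j"
  by (simp add: first_order_def)

text \<open>Links do not raise the Leray number. Colours of A are added one by one: by
  \<open>exact_at_top\<close>, the link of i on B at size s is controlled by size s + 1 on
  \<open>insert i B\<close> and size s on B, and both sizes are above d.\<close>

lemma exact_at_link:
  assumes cube: "cube I F R" and inj: "inj_on \<rho> I"
    and ex: "\<And>S s. S \<subseteq> I \<Longrightarrow> d < s \<Longrightarrow> exact_at S \<rho> F R s"
    and "A \<subseteq> I" "B \<subseteq> I" "A \<inter> B = {}" "d < s"
  shows "exact_at B \<rho> (\<lambda>\<tau>. F (\<tau> \<union> A)) R s"
proof -
  have "finite A" using cube.fin[OF cube] \<open>A \<subseteq> I\<close> finite_subset by blast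
  then show ?thesis using assms(4-)
  proof (induction A arbitrary: B s rule: finite_induct)
    case empty
    then show ?case using ex by simp
  next
    case (insert i A)
    let ?F = "\<lambda>\<tau>. F (\<tau> \<union> A)" and ?\<rho> = "first_order i \<rho>"
    have c: "cube (insert i B) ?F R" using insert by (intro cube_link[OF cube]) auto
    have cB: "cube B ?F R" using insert by (intro cube_link[OF cube]) auto
    have i: "i \<notin> B" using insert by auto
    have injB: "inj_on \<rho> (insert i B)" by (rule inj_on_subset[OF inj]) (use insert.prems in auto)
    then have injB': "inj_on \<rho> B" by simp
    have "exact_at (insert i B) \<rho> ?F R (Suc s)"
      using insert by (intro insert.IH) auto
    then have 1: "exact_at (insert i B) ?\<rho> ?F R (Suc s)"
      using exact_at_reorder[OF c injB inj_on_first_order[OF injB]] by blast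
    have "exact_at B \<rho> ?F R s" using insert by (intro insert.IH) auto
    then have 2: "exact_at B ?\<rho> ?F R s"
      using exact_at_reorder[OF cB injB' inj_on_first_order[OF injB']] by blast
    have "exact_at B ?\<rho> (\<lambda>\<tau>. F (insert i \<tau> \<union> A)) R s"
      using i by (intro exact_at_top[OF c refl _ _ 1 2] first_order_less) auto
    moreover have "cube B (\<lambda>\<tau>. F (\<tau> \<union> insert i A)) R"
      using insert.prems by (intro cube_link[OF cube]) auto
    ultimately show ?case
      using exact_at_reorder[OF _ inj_on_first_order[OF injB'] injB'] by simp
  qed
qed

section \<open>Exactness of the total complex of a bicomplex\<close>

text \<open>N projects away the D1-boundaries at column d. It serves to make the component of a cycle in
  column d a boundary; the columns below d are then cleared downwards with D2 and those above d
  upwards with D1.\<close>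

lemma bicomplex_total_exact:
  fixes D1 D2 :: "'w::ab_group_add \<Rightarrow> 'w" and K :: "nat \<Rightarrow> nat \<Rightarrow> 'w set"
  assumes add1: "additive D1" and add2: "additive D2"
    and K_diff: "\<And>p q x y. x \<in> K p q \<Longrightarrow> y \<in> K p q \<Longrightarrow> x - y \<in> K p q"
    and D1_mem: "\<And>p q x. x \<in> K (Suc p) q \<Longrightarrow> D1 x \<in> K p q"
    and D2_mem: "\<And>p q x. x \<in> K p (Suc q) \<Longrightarrow> D2 x \<in> K p q"
    and D1D1: "\<And>p q x. x \<in> K p q \<Longrightarrow> D1 (D1 x) = 0"
    and D2D2: "\<And>p q x. x \<in> K p q \<Longrightarrow> D2 (D2 x) = 0"
    and D1D2: "\<And>p q x. x \<in> K p q \<Longrightarrow> D1 (D2 x) = - D2 (D1 x)"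
    and ex1: "\<And>p q x. d < p \<Longrightarrow> x \<in> K p q \<Longrightarrow> D1 x = 0 \<Longrightarrow> \<exists>y\<in>K (Suc p) q. D1 y = x"
    and ex2: "\<And>p q x. e < q \<Longrightarrow> x \<in> K p q \<Longrightarrow> D2 x = 0 \<Longrightarrow> \<exists>y\<in>K p (Suc q). D2 y = x"
    and N_mem: "\<And>q x. x \<in> K d q \<Longrightarrow> N x \<in> K d q"
    and N_D2: "\<And>q x. x \<in> K d q \<Longrightarrow> D2 (N x) = N (D2 x)"
    and N_D1: "\<And>q x. x \<in> K (Suc d) q \<Longrightarrow> N (- D1 x) = 0"
    and N_split: "\<And>q x. x \<in> K d q \<Longrightarrow> \<exists>y\<in>K (Suc d) q. D1 y = x - N x"
    and s: "d + e < s"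
    and c: "\<And>p. p \<le> s \<Longrightarrow> c p \<in> K p (s - p)"
    and cyc: "\<And>p. p < s \<Longrightarrow> D1 (c (Suc p)) + D2 (c p) = 0"
  shows "\<exists>b. (\<forall>p\<le>Suc s. b p \<in> K p (Suc s - p)) \<and> (\<forall>p\<le>s. c p = D1 (b (Suc p)) + D2 (b p))"
proof -
  interpret D1: additive D1 by fact
  interpret D2: additive D2 by fact
  \<comment> \<open>The equation of column p, together with the bidegrees of the two unknowns that
    occur in it.\<close>
  define good where "good b p \<longleftrightarrow> b p \<in> K p (Suc s - p) \<and> b (Suc p) \<in> K (Suc p) (s - p) \<and>
    c p = D1 (b (Suc p)) + D2 (b p)" for b p
  \<comment> \<open>To the right of column d the equation of column p is solved for
    \<open>b (Suc p)\<close>: what remains is a D1-cycle, and d < p makes it a boundary.\<close>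
  have up: "\<exists>b. \<forall>p\<in>{d..d+n}. good b p" if "d + n \<le> s" for n
    using that
  proof (induction n)
    case 0
    have cd: "c d \<in> K d (s - d)" using s by (intro c) auto
    \<comment> \<open>In column d itself D1 need not be exact. The cycle condition makes
      \<open>D2 (c d)\<close> a D1-boundary, which N kills, so \<open>N (c d)\<close> is a D2-cycle
      in row s - d > e.\<close>
    have "D2 (N (c d)) = N (D2 (c d))" using N_D2[OF cd] .
    also have "D2 (c d) = - D1 (c (Suc d))" using cyc[of d] s by (simp add: eq_neg_iff_add_eq_0 add.commute)
    also have "N \<dots> = 0" using N_D1 c[of "Suc d"] s by auto
    finally obtain y where y: "y \<in> K d (Suc (s - d))" "D2 y = N (c d)"
      using ex2[OF _ N_mem[OF cd]] s by (metis less_diff_conv add.commute)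
    obtain z where z: "z \<in> K (Suc d) (s - d)" "D1 z = c d - N (c d)" using N_split[OF cd] by auto
    have "good (\<lambda>p. if p = d then y else z) d"
      using y z s by (auto simp: good_def Suc_diff_le)
    then show ?case by auto
  next
    case (Suc n)
    then obtain b where "\<forall>p\<in>{d..d+n}. good b p" by auto
    then have b: "good b p" if "p \<in> {d..d+n}" for p using that by blast
    let ?p = "Suc (d + n)"
    have gb: "good b (d + n)" using b by auto
    then have bp: "b ?p \<in> K ?p (Suc (s - ?p))" "c (d+n) = D1 (b ?p) + D2 (b (d+n))" "b (d+n) \<in> K (d+n) (Suc s - (d+n))"
      using Suc.prems by (auto simp: good_def Suc_diff_Suc)
    have cp: "c ?p \<in> K ?p (s - ?p)" using Suc.prems by (intro c) auto
    have "D1 (c ?p - D2 (b ?p)) = D1 (c ?p) + D2 (D1 (b ?p))"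
      using D1D2[OF bp(1)] by (simp add: D1.diff)
    also have "D1 (b ?p) = c (d+n) - D2 (b (d+n))" using bp(2) by simp
    also have "D2 \<dots> = D2 (c (d+n))" using D2D2[OF bp(3)] by (simp add: D2.diff)
    also have "D1 (c ?p) + D2 (c (d+n)) = 0" using cyc[of "d+n"] Suc.prems by auto
    finally obtain y where y: "y \<in> K (Suc ?p) (s - ?p)" "D1 y = c ?p - D2 (b ?p)"
      using ex1[of ?p, OF _ K_diff[OF cp D2_mem[OF bp(1)]]] by auto
    have "good (b(Suc ?p := y)) ?p"
      using y bp Suc.prems by (auto simp: good_def Suc_diff_Suc Suc_diff_le)
    moreover have "good (b(Suc ?p := y)) p" if "p \<in> {d..d+n}" for p
      using b[OF that] that by (auto simp: good_def)
    ultimately have "\<forall>p\<in>{d..d + Suc n}. good (b(Suc ?p := y)) p"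
      by (auto simp: le_Suc_eq)
    then show ?case by blast
  qed
  \<comment> \<open>To the left of column d the row index s - p exceeds e, and the equation of
    column p is solved for \<open>b p\<close> by means of D2.\<close>
  have "\<exists>b. \<forall>p\<in>{d-n..s}. good b p" for n
  proof (induction n)
    case 0
    show ?case using up[of "s - d"] s by auto
  next
    case (Suc n)
    then obtain b where "\<forall>p\<in>{d-n..s}. good b p" by auto
    then have b: "good b p" if "p \<in> {d-n..s}" for p using that by blast
    show ?case
    proof (cases "d - n")
      case 0
      \<comment> \<open>Column 0 has been reached; truncated subtraction leaves nothing more to
        solve.\<close>
      then have "d - Suc n = d - n" by auto
      then show ?thesis using b by metis
    next
      case (Suc p)
      then have p: "d - Suc n = p" "p < d" by auto
      have gb: "good b (Suc p)" using b[of "Suc p"] Suc p s by auto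
      have bp: "b (Suc p) \<in> K (Suc p) (s - p)" "c (Suc p) = D1 (b (Suc (Suc p))) + D2 (b (Suc p))"
          "b (Suc (Suc p)) \<in> K (Suc (Suc p)) (s - Suc p)"
        using gb by (auto simp: good_def)
      have cp: "c p \<in> K p (s - p)" using p s by (intro c) auto
      have es: "e < s - p" using p s by linarith
      have "D2 (c p - D1 (b (Suc p))) = D2 (c p) + D1 (D2 (b (Suc p)))"
        using D1D2[OF bp(1)] by (simp add: D2.diff)
      also have "D2 (b (Suc p)) = c (Suc p) - D1 (b (Suc (Suc p)))" using bp(2) by simp
      also have "D1 \<dots> = D1 (c (Suc p))" using D1D1[OF bp(3)] by (simp add: D1.diff)
      also have "D2 (c p) + D1 (c (Suc p)) = 0" using cyc[of p] p s by (simp add: add.commute)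
      finally obtain y where y: "y \<in> K p (Suc (s - p))" "D2 y = c p - D1 (b (Suc p))"
        using ex2[OF es K_diff[OF cp D1_mem[OF bp(1)]]] by blast
      have "good (b(p := y)) p" using y bp p s by (auto simp: good_def Suc_diff_le)
      moreover have "good (b(p := y)) k" if "k \<in> {Suc p..s}" for k
        using b[of k] that Suc by (auto simp: good_def)
      ultimately have "\<forall>k\<in>{p..s}. good (b(p := y)) k"
        by (metis atLeastAtMost_iff not_less_eq_eq order_antisym)
      then show ?thesis using p by auto
    qed
  qed
  from this[of d] obtain b where "\<forall>p\<in>{0..s}. good b p" by auto
  then have b: "\<forall>p\<le>s. good b p" by simp
  have "b p \<in> K p (Suc s - p)" if "p \<le> Suc s" for p
  proof (cases "p = Suc s")
    case True
    then show ?thesis using b[rule_format, of s] by (simp add: good_def)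
  qed (use that b in \<open>auto simp: good_def\<close>)
  then show ?thesis using b by (auto simp: good_def)
qed

section \<open>Functors spanned by cells\<close>

definition fsupp :: "'b set \<Rightarrow> ('b \<Rightarrow> rat) set" where
  "fsupp E = {c. \<forall>x. c x \<noteq> 0 \<longrightarrow> x \<in> E}"

text \<open>The linear extension of f to coefficient functions. Summing over a fixed ambient set U,
  finite in the applications, lets one map act on all supports.\<close>

definition push :: "'b set \<Rightarrow> ('b \<Rightarrow> 'c) \<Rightarrow> ('b \<Rightarrow> rat) \<Rightarrow> 'c \<Rightarrow> rat" where
  "push U f c y = (\<Sum>x\<in>{x\<in>U. f x = y}. c x)"

lemma fsupp_0 [simp]: "0 \<in> fsupp E"
  and fsupp_add: "c \<in> fsupp E \<Longrightarrow> c' \<in> fsupp E \<Longrightarrow> c + c' \<in> fsupp E"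
  and fsupp_minus: "c \<in> fsupp E \<Longrightarrow> - c \<in> fsupp E"
  and fsupp_mono: "E \<subseteq> E' \<Longrightarrow> fsupp E \<subseteq> fsupp E'"
  unfolding fsupp_def by (force, force, force, blast)

lemma fsupp_diff: "c \<in> fsupp E \<Longrightarrow> c' \<in> fsupp E \<Longrightarrow> c - c' \<in> fsupp E"
  using fsupp_add[of c E "- c'"] fsupp_minus[of c' E] by simp

lemma push_additive: "additive (push U f)"
  by (auto simp: additive_def push_def fun_eq_iff sum.distrib)

lemma push_fsupp:
  assumes "c \<in> fsupp E" "\<And>x. x \<in> E \<Longrightarrow> f x \<in> E'"
  shows "push U f c \<in> fsupp E'"
proof -
  have "y \<in> E'" if "push U f c y \<noteq> 0" for y
  proof -
    from that have "\<exists>x\<in>{x\<in>U. f x = y}. c x \<noteq> 0"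
      unfolding push_def by (rule contrapos_np) (auto intro: sum.neutral)
    then obtain x where "f x = y" "c x \<noteq> 0" by auto
    then show ?thesis using assms by (auto simp: fsupp_def)
  qed
  then show ?thesis by (auto simp: fsupp_def)
qed

lemma push_push:
  assumes "finite U" "finite V" "c \<in> fsupp E" "\<And>x. x \<in> E \<Longrightarrow> g x \<in> V"
  shows "push V f (push U g c) = push U (\<lambda>x. f (g x)) c"
proof
  fix z
  have "push V f (push U g c) z = (\<Sum>y\<in>V. \<Sum>x\<in>U. if f y = z \<and> g x = y then c x else 0)"
    using assms(1,2) by (auto simp: push_def sum.inter_filter intro!: sum.cong)
  also have "\<dots> = (\<Sum>x\<in>U. \<Sum>y\<in>V. if f y = z \<and> g x = y then c x else 0)"
    by (rule sum.swap)
  also have "\<dots> = (\<Sum>x\<in>U. if f (g x) = z then c x else 0)"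
  proof (intro sum.cong refl)
    fix x assume "x \<in> U"
    have "(\<Sum>y\<in>V. if f y = z \<and> g x = y then c x else 0) = (\<Sum>y\<in>V. if g x = y then (if f (g x) = z then c x else 0) else 0)"
      by (intro sum.cong) auto
    also have "\<dots> = (if f (g x) = z then c x else 0)"
      using assms(2-4) by (auto simp: fsupp_def)
    finally show "(\<Sum>y\<in>V. if f y = z \<and> g x = y then c x else 0) = (if f (g x) = z then c x else 0)" .
  qed
  finally show "push V f (push U g c) z = push U (\<lambda>x. f (g x)) c z"
    using assms(1) by (simp add: push_def sum.inter_filter)
qed

lemma push_cong:
  assumes "finite U" "c \<in> fsupp E" "\<And>x. x \<in> E \<Longrightarrow> f x = g x"
  shows "push U f c = push U g c"
proof
  fix y show "push U f c y = push U g c y"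
    unfolding push_def by (rule sum.mono_neutral_cong) (use assms in \<open>auto simp: fsupp_def\<close>)
qed

text \<open>Functors of free vector spaces in which a deletion sends basis elements to basis
  elements. With such bases, tensor products are spaces of functions on pairs of cells.\<close>

locale cells =
  fixes I :: "'i set" and U :: "'b set" and E :: "'i set \<Rightarrow> 'b set" and del :: "'i \<Rightarrow> 'b \<Rightarrow> 'b"
  assumes finI: "finite I" and finU: "finite U"
    and E_subset: "\<tau> \<subseteq> I \<Longrightarrow> E \<tau> \<subseteq> U"
    and del_mem: "\<tau> \<subseteq> I \<Longrightarrow> i \<in> I \<Longrightarrow> i \<notin> \<tau> \<Longrightarrow> x \<in> E (insert i \<tau>) \<Longrightarrow> del i x \<in> E \<tau>"
    and del_commute: "\<tau> \<subseteq> I \<Longrightarrow> i \<in> I \<Longrightarrow> j \<in> I \<Longrightarrow> i \<notin> \<tau> \<Longrightarrow> j \<notin> \<tau> \<Longrightarrow> i \<noteq> j \<Longrightarrow>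
      x \<in> E (insert i (insert j \<tau>)) \<Longrightarrow> del i (del j x) = del j (del i x)"
begin

abbreviation "cF \<tau> \<equiv> fsupp (E \<tau>)"
abbreviation "cR i \<equiv> push U (del i)"

lemma cube: "cube I cF cR"
proof (rule cube.intro)
  fix \<tau> i j x assume *: "\<tau> \<subseteq> I" "i \<in> I" "j \<in> I" "i \<notin> \<tau>" "j \<notin> \<tau>" "i \<noteq> j" "x \<in> cF (insert i (insert j \<tau>))"
  have 1: "del j y \<in> U" if "y \<in> E (insert i (insert j \<tau>))" for y
    using * that E_subset[of "insert i \<tau>"] del_mem[of "insert i \<tau>" j y] by (auto simp: insert_commute)
  have 2: "del i y \<in> U" if "y \<in> E (insert i (insert j \<tau>))" for y
    using * that E_subset[of "insert j \<tau>"] del_mem[of "insert j \<tau>" i y] by auto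
  have "push U (del i) (push U (del j) x) = push U (\<lambda>y. del i (del j y)) x"
    by (rule push_push[OF finU finU *(7)]) (rule 1)
  also have "\<dots> = push U (\<lambda>y. del j (del i y)) x"
    using * by (intro push_cong[OF finU *(7)] del_commute[of \<tau>])
  also have "\<dots> = push U (del j) (push U (del i) x)"
    by (rule push_push[OF finU finU *(7), symmetric]) (rule 2)
  finally show "push U (del i) (push U (del j) x) = push U (del j) (push U (del i) x)" .
qed (auto simp: finI push_additive fsupp_add fsupp_minus intro!: push_fsupp del_mem)

end

text \<open>Over a field a subspace V has a linear retraction P onto it; N is the identity minus P.
  Only the additivity of N is kept, which is all that the Kuenneth argument asks for.\<close>

lemma exists_projection:
  fixes V :: "('k \<Rightarrow> 'b \<Rightarrow> rat) set"
  assumes zero: "0 \<in> V" and add: "\<And>f g. f \<in> V \<Longrightarrow> g \<in> V \<Longrightarrow> f + g \<in> V"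
    and scale: "\<And>a f. f \<in> V \<Longrightarrow> (\<lambda>k x. a * f k x) \<in> V"
  obtains N where "additive N" "\<And>f. f \<in> V \<Longrightarrow> N f = 0" "\<And>f. f - N f \<in> V"
proof -
  let ?s = "\<lambda>(a::rat) (f :: 'k \<Rightarrow> 'b \<Rightarrow> rat) k x. a * f k x"
  interpret vector_space_pair ?s ?s
    by unfold_locales (auto simp: fun_eq_iff algebra_simps)
  have id: "Vector_Spaces.linear ?s ?s (\<lambda>x. x)"
    by unfold_locales auto
  have "vs1.subspace V"
    using assms by (auto simp: vs1.subspace_def)
  from linear_exists_left_inverse_on[OF id this]
  obtain P where P: "range P \<subseteq> V" "Vector_Spaces.linear ?s ?s P" "\<And>v. v \<in> V \<Longrightarrow> P v = v"
    by (auto simp: inj_on_def)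
  interpret P: Vector_Spaces.linear ?s ?s P by fact
  show thesis
  proof
    show "additive (\<lambda>f. f - P f)" by (auto simp: additive_def P.add)
  qed (use P in auto)
qed

locale cells_pair = F: cells I U E del + G: cells I U' E' del'
  for I :: "'i set" and U :: "'b set" and E del and U' :: "'c set" and E' del' +
  fixes \<rho> :: "'i \<Rightarrow> nat"
  assumes inj: "inj_on \<rho> I"
begin

text \<open>Colours in A are kept in the first factor and colours in B are absent from the second, so both
  belong to one factor only; the remaining colours are shared by the two factors.\<close>

definition pcell :: "'i set \<Rightarrow> 'i set \<Rightarrow> 'i set \<Rightarrow> ('b \<times> 'c) set" where
  "pcell A B \<tau> = E (\<tau> \<union> A) \<times> E' (\<tau> - B)"

definition pdel :: "'i set \<Rightarrow> 'i set \<Rightarrow> 'i \<Rightarrow> 'b \<times> 'c \<Rightarrow> 'b \<times> 'c" where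
  "pdel A B i = (\<lambda>(x, y). (if i \<in> A then x else del i x, if i \<in> B then y else del' i y))"

lemma cells_pcell:
  assumes "A \<subseteq> I"
  shows "cells I (U \<times> U') (pcell A B) (pdel A B)"
proof
  show "finite I" "finite (U \<times> U')" using F.finI F.finU G.finU by auto
  fix \<tau> assume \<tau>: "\<tau> \<subseteq> I"
  show "pcell A B \<tau> \<subseteq> U \<times> U'"
    using F.E_subset[of "\<tau> \<union> A"] G.E_subset[of "\<tau> - B"] assms \<tau> by (auto simp: pcell_def)
  have memF: "(if i \<in> A then x else del i x) \<in> E (\<tau> \<union> A)" if "i \<in> I" "i \<notin> \<tau>" "x \<in> E (insert i \<tau> \<union> A)" for i x
  proof (cases "i \<in> A")
    case True
    then have "insert i \<tau> \<union> A = \<tau> \<union> A" by auto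
    then show ?thesis using that True by simp
  next
    case False
    then show ?thesis using that assms \<tau> F.del_mem[of "\<tau> \<union> A" i x] by auto
  qed
  have memG: "(if i \<in> B then x else del' i x) \<in> E' (\<tau> - B)" if "i \<in> I" "i \<notin> \<tau>" "x \<in> E' (insert i \<tau> - B)" for i x
  proof (cases "i \<in> B")
    case True
    then show ?thesis using that by simp
  next
    case False
    then have "insert i \<tau> - B = insert i (\<tau> - B)" by auto
    then show ?thesis using that \<tau> False G.del_mem[of "\<tau> - B" i x] by auto
  qed
  show "pdel A B i x \<in> pcell A B \<tau>" if "i \<in> I" "i \<notin> \<tau>" "x \<in> pcell A B (insert i \<tau>)" for i x
    using that memF[of i "fst x"] memG[of i "snd x"] by (cases x) (auto simp: pcell_def pdel_def)
  show "pdel A B i (pdel A B j x) = pdel A B j (pdel A B i x)"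
    if *: "i \<in> I" "j \<in> I" "i \<notin> \<tau>" "j \<notin> \<tau>" "i \<noteq> j" "x \<in> pcell A B (insert i (insert j \<tau>))" for i j x
  proof -
    have "del i (del j (fst x)) = del j (del i (fst x))" if "i \<notin> A" "j \<notin> A"
      using * that \<tau> assms by (intro F.del_commute[of "\<tau> \<union> A"]) (auto simp: pcell_def)
    moreover have "del' i (del' j (snd x)) = del' j (del' i (snd x))" if "i \<notin> B" "j \<notin> B"
      using * that \<tau> by (intro G.del_commute[of "\<tau> - B"]) (auto simp: pcell_def insert_Diff_if)
    ultimately show ?thesis by (cases x) (auto simp: pdel_def)
  qed
qed

subsection \<open>The Kuenneth theorem\<close>

context
  fixes A B :: "'i set" and d e :: nat
  assumes AB: "A \<inter> B = {}" "A \<union> B = I"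
begin

private abbreviation "FA \<tau> \<equiv> fsupp (E (\<tau> \<union> A))"

text \<open>Fixing the colours \<alpha> in A and the second cell y leaves a chain of the first
  factor in the colours of B. So the complex consists of copies of the complex of the first factor
  in one direction and, by \<open>slice2\<close>, of the second in the other.\<close>

private definition slice1 :: "'i set \<Rightarrow> 'c \<Rightarrow> ('i set \<Rightarrow> 'b \<times> 'c \<Rightarrow> rat) \<Rightarrow> 'i set \<Rightarrow> 'b \<Rightarrow> rat" where
  "slice1 \<alpha> y c \<beta> x = (if \<beta> \<subseteq> B then c (\<beta> \<union> \<alpha>) (x, y) else 0)"

private definition slice2 :: "'i set \<Rightarrow> 'b \<Rightarrow> ('i set \<Rightarrow> 'b \<times> 'c \<Rightarrow> rat) \<Rightarrow> 'i set \<Rightarrow> 'c \<Rightarrow> rat" where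
  "slice2 \<beta> x c \<alpha> y = (if \<alpha> \<subseteq> A then c (\<beta> \<union> \<alpha>) (x, y) else 0)"

private definition glue1 :: "('i set \<Rightarrow> 'c \<Rightarrow> 'i set \<Rightarrow> 'b \<Rightarrow> rat) \<Rightarrow> 'i set \<Rightarrow> 'b \<times> 'c \<Rightarrow> rat" where
  "glue1 g \<tau> z = (if \<tau> \<subseteq> I then g (\<tau> \<inter> A) (snd z) (\<tau> \<inter> B) (fst z) else 0)"

private definition glue2 :: "('i set \<Rightarrow> 'b \<Rightarrow> 'i set \<Rightarrow> 'c \<Rightarrow> rat) \<Rightarrow> 'i set \<Rightarrow> 'b \<times> 'c \<Rightarrow> rat" where
  "glue2 g \<tau> z = (if \<tau> \<subseteq> I then g (\<tau> \<inter> B) (fst z) (\<tau> \<inter> A) (snd z) else 0)"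

text \<open>Because A and B partition I, the first cell depends on \<tau> only through \<tau>
  \<inter> B and the second only through \<tau> \<inter> A. This is the tensor product of two
  complexes, with bidegree the numbers of colours from B and from A.\<close>

private definition bigraded :: "nat \<Rightarrow> nat \<Rightarrow> ('i set \<Rightarrow> 'b \<times> 'c \<Rightarrow> rat) set" where
  "bigraded p q = {c. \<forall>\<tau> x y. c \<tau> (x, y) \<noteq> 0 \<longrightarrow> \<tau> \<subseteq> I \<and> card (\<tau> \<inter> B) = p \<and> card (\<tau> \<inter> A) = q \<and>
     x \<in> E (\<tau> \<union> A) \<and> y \<in> E' (\<tau> - B)}"

private lemma split_eqs:
  "\<tau> \<subseteq> I \<Longrightarrow> \<tau> \<inter> B \<union> \<tau> \<inter> A = \<tau>"
  "\<tau> \<subseteq> I \<Longrightarrow> \<tau> \<inter> B \<union> A = \<tau> \<union> A"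
  "\<tau> \<subseteq> I \<Longrightarrow> \<tau> \<inter> A = \<tau> - B"
  "\<beta> \<subseteq> B \<Longrightarrow> \<alpha> \<subseteq> A \<Longrightarrow> (\<beta> \<union> \<alpha>) \<inter> B = \<beta>"
  "\<beta> \<subseteq> B \<Longrightarrow> \<alpha> \<subseteq> A \<Longrightarrow> (\<beta> \<union> \<alpha>) \<inter> A = \<alpha>"
  "\<beta> \<subseteq> B \<Longrightarrow> \<alpha> \<subseteq> A \<Longrightarrow> (\<beta> \<union> \<alpha>) \<union> A = \<beta> \<union> A"
  "\<beta> \<subseteq> B \<Longrightarrow> \<alpha> \<subseteq> A \<Longrightarrow> (\<beta> \<union> \<alpha>) - B = \<alpha>"
  "\<beta> \<subseteq> B \<Longrightarrow> \<alpha> \<subseteq> A \<Longrightarrow> \<beta> \<union> \<alpha> \<subseteq> I"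
  using AB by auto

private lemma bigradedD:
  assumes "c \<in> bigraded p q" "c \<tau> (x, y) \<noteq> 0"
  shows "\<tau> \<subseteq> I" "card (\<tau> \<inter> B) = p" "card (\<tau> \<inter> A) = q" "x \<in> E (\<tau> \<union> A)" "y \<in> E' (\<tau> - B)"
  using assms unfolding bigraded_def by blast+

private lemma slice1_glue1:
  assumes "\<alpha> \<subseteq> A" "\<And>\<beta>. \<not> \<beta> \<subseteq> B \<Longrightarrow> g \<alpha> y \<beta> = 0"
  shows "slice1 \<alpha> y (glue1 g) = g \<alpha> y"
proof (intro ext)
  fix \<beta> x show "slice1 \<alpha> y (glue1 g) \<beta> x = g \<alpha> y \<beta> x"
    using assms split_eqs(4,5,8)[of \<beta> \<alpha>] by (cases "\<beta> \<subseteq> B") (simp_all add: slice1_def glue1_def)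
qed

private lemma slice2_glue2:
  assumes "\<beta> \<subseteq> B" "\<And>\<alpha>. \<not> \<alpha> \<subseteq> A \<Longrightarrow> g \<beta> x \<alpha> = 0"
  shows "slice2 \<beta> x (glue2 g) = g \<beta> x"
proof (intro ext)
  fix \<alpha> y show "slice2 \<beta> x (glue2 g) \<alpha> y = g \<beta> x \<alpha> y"
    using assms split_eqs(4,5,8)[of \<beta> \<alpha>] by (cases "\<alpha> \<subseteq> A") (simp_all add: slice2_def glue2_def)
qed

private lemma glue1_slice1:
  assumes "c \<in> bigraded p q"
  shows "glue1 (\<lambda>\<alpha> y. slice1 \<alpha> y c) = c"
proof (intro ext)
  fix \<tau> z show "glue1 (\<lambda>\<alpha> y. slice1 \<alpha> y c) \<tau> z = c \<tau> z"
    using bigradedD(1)[OF assms, of \<tau> "fst z" "snd z"] split_eqs(1)[of \<tau>] by (auto simp: slice1_def glue1_def)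
qed

private lemma glue2_slice2:
  assumes "c \<in> bigraded p q"
  shows "glue2 (\<lambda>\<beta> x. slice2 \<beta> x c) = c"
proof (intro ext)
  fix \<tau> z show "glue2 (\<lambda>\<beta> x. slice2 \<beta> x c) \<tau> z = c \<tau> z"
    using bigradedD(1)[OF assms, of \<tau> "fst z" "snd z"] split_eqs(1)[of \<tau>] by (auto simp: slice2_def glue2_def)
qed

private lemma slice1_chains:
  assumes "c \<in> bigraded p q" "\<alpha> \<subseteq> A"
  shows "slice1 \<alpha> y c \<in> cube_chains B FA p"
    and "\<not> (card \<alpha> = q \<and> y \<in> E' \<alpha>) \<Longrightarrow> slice1 \<alpha> y c = 0"
proof -
  have *: "card \<beta> = p \<and> card \<alpha> = q \<and> x \<in> E (\<beta> \<union> A) \<and> y \<in> E' \<alpha> \<and> \<beta> \<subseteq> B" if "slice1 \<alpha> y c \<beta> x \<noteq> 0" for \<beta> x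
  proof -
    have "\<beta> \<subseteq> B" "c (\<beta> \<union> \<alpha>) (x, y) \<noteq> 0" using that by (auto simp: slice1_def split: if_splits)
    then show ?thesis using bigradedD[OF assms(1)] split_eqs(4-7)[OF _ assms(2)] by metis
  qed
  show "slice1 \<alpha> y c \<in> cube_chains B FA p"
  proof (rule cube_chainsI)
    fix \<beta> show "slice1 \<alpha> y c \<beta> \<in> FA \<beta>" using * by (auto simp: fsupp_def)
    show "slice1 \<alpha> y c \<beta> = 0" if "\<not> (\<beta> \<subseteq> B \<and> card \<beta> = p)" using * that by (fastforce simp: fun_eq_iff)
  qed
  show "slice1 \<alpha> y c = 0" if "\<not> (card \<alpha> = q \<and> y \<in> E' \<alpha>)"
    using * that by (fastforce simp: fun_eq_iff)
qed

private lemma slice2_chains: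
  assumes "c \<in> bigraded p q" "\<beta> \<subseteq> B"
  shows "slice2 \<beta> x c \<in> cube_chains A G.cF q"
    and "\<not> (card \<beta> = p \<and> x \<in> E (\<beta> \<union> A)) \<Longrightarrow> slice2 \<beta> x c = 0"
proof -
  have *: "card \<beta> = p \<and> card \<alpha> = q \<and> x \<in> E (\<beta> \<union> A) \<and> y \<in> E' \<alpha> \<and> \<alpha> \<subseteq> A" if "slice2 \<beta> x c \<alpha> y \<noteq> 0" for \<alpha> y
  proof -
    have "\<alpha> \<subseteq> A" "c (\<beta> \<union> \<alpha>) (x, y) \<noteq> 0" using that by (auto simp: slice2_def split: if_splits)
    then show ?thesis using bigradedD[OF assms(1)] split_eqs(4-7)[OF assms(2)] by metis
  qed
  show "slice2 \<beta> x c \<in> cube_chains A G.cF q"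
  proof (rule cube_chainsI)
    fix \<alpha> show "slice2 \<beta> x c \<alpha> \<in> G.cF \<alpha>" using * by (auto simp: fsupp_def)
    show "slice2 \<beta> x c \<alpha> = 0" if "\<not> (\<alpha> \<subseteq> A \<and> card \<alpha> = q)" using * that by (fastforce simp: fun_eq_iff)
  qed
  show "slice2 \<beta> x c = 0" if "\<not> (card \<beta> = p \<and> x \<in> E (\<beta> \<union> A))"
    using * that by (fastforce simp: fun_eq_iff)
qed

private lemma glue1_cong: "(\<And>\<alpha> y. \<alpha> \<subseteq> A \<Longrightarrow> g \<alpha> y = h \<alpha> y) \<Longrightarrow> glue1 g = glue1 h"
  by (simp add: glue1_def fun_eq_iff)

private lemma glue2_cong: "(\<And>\<beta> x. \<beta> \<subseteq> B \<Longrightarrow> g \<beta> x = h \<beta> x) \<Longrightarrow> glue2 g = glue2 h"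
  by (simp add: glue2_def fun_eq_iff)

private lemma glue1_bigraded:
  assumes "\<And>\<alpha> y. \<alpha> \<subseteq> A \<Longrightarrow> g \<alpha> y \<in> cube_chains B FA p"
    and "\<And>\<alpha> y. \<alpha> \<subseteq> A \<Longrightarrow> \<not> (card \<alpha> = q \<and> y \<in> E' \<alpha>) \<Longrightarrow> g \<alpha> y = 0"
  shows "glue1 g \<in> bigraded p q"
  unfolding bigraded_def
proof (intro CollectI allI impI)
  fix \<tau> x y assume nz: "glue1 g \<tau> (x, y) \<noteq> 0"
  then have \<tau>: "\<tau> \<subseteq> I" and g: "g (\<tau> \<inter> A) y (\<tau> \<inter> B) x \<noteq> 0" by (auto simp: glue1_def split: if_splits)
  then have q: "card (\<tau> \<inter> A) = q" "y \<in> E' (\<tau> \<inter> A)" using assms(2)[of "\<tau> \<inter> A" y] by (auto simp: fun_eq_iff)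
  have ch: "g (\<tau> \<inter> A) y \<in> cube_chains B FA p" using assms(1) by auto
  have p: "card (\<tau> \<inter> B) = p" using cube_chains_zero[OF ch, of "\<tau> \<inter> B"] g by (metis zero_fun_def)
  then have "x \<in> E (\<tau> \<inter> B \<union> A)" using cube_chains_mem[OF ch, of "\<tau> \<inter> B"] g by (auto simp: fsupp_def)
  then show "\<tau> \<subseteq> I \<and> card (\<tau> \<inter> B) = p \<and> card (\<tau> \<inter> A) = q \<and> x \<in> E (\<tau> \<union> A) \<and> y \<in> E' (\<tau> - B)"
    using \<tau> p q split_eqs[of \<tau>] by auto
qed

private lemma glue2_bigraded:
  assumes "\<And>\<beta> x. \<beta> \<subseteq> B \<Longrightarrow> g \<beta> x \<in> cube_chains A G.cF q"
    and "\<And>\<beta> x. \<beta> \<subseteq> B \<Longrightarrow> \<not> (card \<beta> = p \<and> x \<in> E (\<beta> \<union> A)) \<Longrightarrow> g \<beta> x = 0"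
  shows "glue2 g \<in> bigraded p q"
  unfolding bigraded_def
proof (intro CollectI allI impI)
  fix \<tau> x y assume nz: "glue2 g \<tau> (x, y) \<noteq> 0"
  then have \<tau>: "\<tau> \<subseteq> I" and g: "g (\<tau> \<inter> B) x (\<tau> \<inter> A) y \<noteq> 0" by (auto simp: glue2_def split: if_splits)
  then have p: "card (\<tau> \<inter> B) = p" "x \<in> E (\<tau> \<inter> B \<union> A)" using assms(2)[of "\<tau> \<inter> B" x] by (auto simp: fun_eq_iff)
  have ch: "g (\<tau> \<inter> B) x \<in> cube_chains A G.cF q" using assms(1) by auto
  have q: "card (\<tau> \<inter> A) = q" using cube_chains_zero[OF ch, of "\<tau> \<inter> A"] g by (metis zero_fun_def)
  then have "y \<in> E' (\<tau> \<inter> A)" using cube_chains_mem[OF ch, of "\<tau> \<inter> A"] g by (auto simp: fsupp_def)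
  then show "\<tau> \<subseteq> I \<and> card (\<tau> \<inter> B) = p \<and> card (\<tau> \<inter> A) = q \<and> x \<in> E (\<tau> \<union> A) \<and> y \<in> E' (\<tau> - B)"
    using \<tau> p q split_eqs[of \<tau>] by auto
qed

private abbreviation "bdF \<equiv> cube_bd B \<rho> F.cR"
private abbreviation "bdG \<equiv> cube_bd A \<rho> G.cR"

private definition D1 where "D1 c = glue1 (\<lambda>\<alpha> y. bdF (slice1 \<alpha> y c))"
text \<open>The factor \<open>signed (card \<beta>)\<close> is the Koszul sign for moving the second
  differential past the first factor.\<close>

private definition D2 where "D2 c = glue2 (\<lambda>\<beta> x. signed (card \<beta>) (bdG (slice2 \<beta> x c)))"

private lemma cubeF: "cube B FA F.cR"
  using AB by (intro cube_link[OF F.cube]) auto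

private lemma cubeG: "cube A G.cF G.cR"
  using AB by (intro cube.subcube[OF G.cube]) auto

interpretation cF: cube B FA F.cR by (rule cubeF)
interpretation cG: cube A G.cF G.cR by (rule cubeG)

private lemma slice1_D1: "\<alpha> \<subseteq> A \<Longrightarrow> slice1 \<alpha> y (D1 c) = bdF (slice1 \<alpha> y c)"
  unfolding D1_def by (rule slice1_glue1) (auto simp: cube_bd_def)

private lemma slice2_D2: "\<beta> \<subseteq> B \<Longrightarrow> slice2 \<beta> x (D2 c) = signed (card \<beta>) (bdG (slice2 \<beta> x c))"
  unfolding D2_def by (rule slice2_glue2) (auto simp: cube_bd_def signed_fun)

private lemma slice1_add: "slice1 \<alpha> y (c + c') = slice1 \<alpha> y c + slice1 \<alpha> y c'"
  by (auto simp: slice1_def fun_eq_iff)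

private lemma slice1_minus: "slice1 \<alpha> y (- c) = - slice1 \<alpha> y c"
  by (auto simp: slice1_def fun_eq_iff)

private lemma slice1_zero: "slice1 \<alpha> y 0 = 0" and slice2_zero: "slice2 \<beta> x 0 = 0"
  by (auto simp: slice1_def slice2_def fun_eq_iff)

private lemma slice2_add: "slice2 \<beta> x (c + c') = slice2 \<beta> x c + slice2 \<beta> x c'"
  by (auto simp: slice2_def fun_eq_iff)

private lemma D1_additive: "additive D1"
  by (auto simp: additive_def D1_def slice1_add cF.bd_add glue1_def fun_eq_iff)

private lemma D2_additive: "additive D2"
  by (auto simp: additive_def D2_def slice2_add cG.bd_add glue2_def fun_eq_iff signed_add)

private lemma D1_mem: "c \<in> bigraded (Suc p) q \<Longrightarrow> D1 c \<in> bigraded p q"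
  unfolding D1_def
  by (rule glue1_bigraded) (auto intro!: cF.bd_chains slice1_chains simp: slice1_chains(2) additive.zero[OF cF.bd_additive])

private lemma D2_mem: "c \<in> bigraded p (Suc q) \<Longrightarrow> D2 c \<in> bigraded p q"
  unfolding D2_def
proof (rule glue2_bigraded)
  fix \<beta> x assume "c \<in> bigraded p (Suc q)" "\<beta> \<subseteq> B"
  then show "signed (card \<beta>) (bdG (slice2 \<beta> x c)) \<in> cube_chains A G.cF q"
    using cG.bd_chains[OF slice2_chains(1)] cG.chains_minus by (auto simp: signed_def)
qed (auto simp: slice2_chains(2) additive.zero[OF cG.bd_additive])

private lemma D1_D1:
  assumes "c \<in> bigraded p q"
  shows "D1 (D1 c) = 0"
proof -
  have "inj_on \<rho> B" by (rule inj_on_subset[OF inj]) (use AB in auto)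
  then have "bdF (slice1 \<alpha> y (D1 c)) = 0" if "\<alpha> \<subseteq> A" for \<alpha> y
    using that slice1_D1 cF.bd_bd[OF slice1_chains(1)[OF assms]] by simp
  then show ?thesis unfolding D1_def[of "D1 c"] by (auto simp: glue1_def fun_eq_iff)
qed

private lemma D2_D2:
  assumes "c \<in> bigraded p q"
  shows "D2 (D2 c) = 0"
proof -
  have "inj_on \<rho> A" by (rule inj_on_subset[OF inj]) (use AB in auto)
  then have "bdG (slice2 \<beta> x (D2 c)) = 0" if "\<beta> \<subseteq> B" for \<beta> x
    using that slice2_D2 cG.bd_bd[OF slice2_chains(1)[OF assms]] additive.signed[OF cG.bd_additive] by simp
  then show ?thesis unfolding D2_def[of "D2 c"] by (auto simp: glue2_def fun_eq_iff signed_fun)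
qed

text \<open>The order in which B precedes A yields the usual signs of a tensor product.\<close>

private definition \<rho>' :: "'i \<Rightarrow> nat" where
  "\<rho>' i = (if i \<in> B then \<rho> i else \<rho> i + Suc (sum \<rho> I))"

private lemma \<rho>'_less: "i \<in> B \<Longrightarrow> j \<notin> B \<Longrightarrow> \<rho>' i < \<rho>' j"
  using member_le_sum[of i I \<rho>] AB F.finI by (auto simp: \<rho>'_def)

private lemma inj_\<rho>': "inj_on \<rho>' I"
proof (rule inj_onI)
  fix i j assume ij: "i \<in> I" "j \<in> I" "\<rho>' i = \<rho>' j"
  then have "i \<in> B \<longleftrightarrow> j \<in> B" using \<rho>'_less by (metis less_irrefl)
  then have "\<rho> i = \<rho> j" using ij(3) by (auto simp: \<rho>'_def split: if_splits)
  then show "i = j" using inj ij by (auto dest: inj_onD)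
qed

private lemma pos_\<rho>':
  assumes "\<tau> \<subseteq> I"
  shows "i \<in> B \<Longrightarrow> pos \<rho>' i \<tau> = pos \<rho> i (\<tau> \<inter> B)"
    and "i \<in> A \<Longrightarrow> pos \<rho>' i \<tau> = card (\<tau> \<inter> B) + pos \<rho> i (\<tau> \<inter> A)"
proof -
  assume i: "i \<in> B"
  have "\<rho>' j < \<rho>' i \<longleftrightarrow> j \<in> B \<and> \<rho> j < \<rho> i" for j
    using i \<rho>'_less[of i j] by (cases "j \<in> B") (auto simp: \<rho>'_def)
  then have "{j\<in>\<tau>. \<rho>' j < \<rho>' i} = {j\<in>\<tau> \<inter> B. \<rho> j < \<rho> i}" by auto
  then show "pos \<rho>' i \<tau> = pos \<rho> i (\<tau> \<inter> B)" by (simp add: pos_def)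
next
  assume i: "i \<in> A"
  have "finite \<tau>" using assms F.finI finite_subset by blast
  have "i \<notin> B" using i AB by auto
  then have "\<rho>' j < \<rho>' i \<longleftrightarrow> j \<in> B \<or> \<rho> j < \<rho> i" for j
    using \<rho>'_less[of j i] by (cases "j \<in> B") (auto simp: \<rho>'_def)
  then have "{j\<in>\<tau>. \<rho>' j < \<rho>' i} = \<tau> \<inter> B \<union> {j\<in>\<tau> \<inter> A. \<rho> j < \<rho> i}"
    using AB assms by auto
  then show "pos \<rho>' i \<tau> = card (\<tau> \<inter> B) + pos \<rho> i (\<tau> \<inter> A)"
    using \<open>finite \<tau>\<close> AB by (auto simp: pos_def intro!: card_Un_disjoint)
qed

private abbreviation "pR i \<equiv> push (U \<times> U') (pdel A B i)"

private lemma pR_B: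
  assumes "i \<in> B" "c \<in> fsupp (U \<times> U')"
  shows "pR i c (x, y) = push U (del i) (\<lambda>x'. c (x', y)) x"
proof (cases "y \<in> U'")
  case True
  have "i \<notin> A" using assms AB by auto
  then have "{z \<in> U \<times> U'. pdel A B i z = (x, y)} = (\<lambda>x'. (x', y)) ` {x'\<in>U. del i x' = x}"
    using True assms(1) by (auto simp: pdel_def)
  then show ?thesis by (simp add: push_def sum.reindex inj_on_def)
next
  case False
  then have "c (x', y) = 0" for x' using assms(2) by (auto simp: fsupp_def)
  moreover have "{z \<in> U \<times> U'. pdel A B i z = (x, y)} = {}"
    using False assms(1) by (auto simp: pdel_def)
  ultimately show ?thesis unfolding push_def by (simp only: sum.empty sum.neutral_const)
qed

private lemma pR_A:
  assumes "i \<in> A" "c \<in> fsupp (U \<times> U')"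
  shows "pR i c (x, y) = push U' (del' i) (\<lambda>y'. c (x, y')) y"
proof (cases "x \<in> U")
  case True
  have "i \<notin> B" using assms AB by auto
  then have "{z \<in> U \<times> U'. pdel A B i z = (x, y)} = (\<lambda>y'. (x, y')) ` {y'\<in>U'. del' i y' = y}"
    using True assms(1) by (auto simp: pdel_def)
  then show ?thesis by (simp add: push_def sum.reindex inj_on_def)
next
  case False
  then have "c (x, y') = 0" for y' using assms(2) by (auto simp: fsupp_def)
  moreover have "{z \<in> U \<times> U'. pdel A B i z = (x, y)} = {}"
    using False assms(1) by (auto simp: pdel_def)
  ultimately show ?thesis unfolding push_def by (simp only: sum.empty sum.neutral_const)
qed

private lemma D1_eq:
  assumes "\<tau> \<subseteq> I"
  shows "D1 c \<tau> (x, y) = (\<Sum>i\<in>B-\<tau>. signed (pos \<rho> i (\<tau> \<inter> B)) (push U (del i) (\<lambda>x'. c (insert i \<tau>) (x', y)) x))"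
proof -
  have "B - \<tau> \<inter> B = B - \<tau>" by auto
  moreover have "slice1 (\<tau> \<inter> A) y c (insert i (\<tau> \<inter> B)) = (\<lambda>x'. c (insert i \<tau>) (x', y))" if "i \<in> B" for i
    using that split_eqs(1)[OF assms] by (auto simp: slice1_def)
  ultimately show ?thesis
    using assms by (auto simp: D1_def glue1_def cube_bd_def sum_fun_apply signed_fun intro!: sum.cong)
qed

private lemma D2_eq:
  assumes "\<tau> \<subseteq> I"
  shows "D2 c \<tau> (x, y) = (\<Sum>i\<in>A-\<tau>. signed (card (\<tau> \<inter> B) + pos \<rho> i (\<tau> \<inter> A)) (push U' (del' i) (\<lambda>y'. c (insert i \<tau>) (x, y')) y))"
proof -
  have "A - \<tau> \<inter> A = A - \<tau>" by auto
  moreover have "slice2 (\<tau> \<inter> B) x c (insert i (\<tau> \<inter> A)) = (\<lambda>y'. c (insert i \<tau>) (x, y'))" if "i \<in> A" for i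
  proof -
    have "\<tau> \<inter> B \<union> insert i (\<tau> \<inter> A) = insert i \<tau>" using split_eqs(1)[OF assms] by auto
    then show ?thesis using that by (auto simp: slice2_def)
  qed
  ultimately show ?thesis
    using assms by (auto simp: D2_def glue2_def cube_bd_def sum_fun_apply signed_fun signed_sum signed_signed intro!: sum.cong)
qed

text \<open>In the order \<open>\<rho>'\<close> a colour of A comes after all of \<tau> \<inter> B,
  which produces the Koszul sign. The support hypothesis reconciles \<open>push\<close> over U
  \<times> U', which sees only pairs from that set, with the slices, in which the untouched
  coordinate is arbitrary.\<close>

private lemma bd_eq_D1_D2:
  fixes c :: "'i set \<Rightarrow> 'b \<times> 'c \<Rightarrow> rat"
  assumes "\<And>\<tau>. c \<tau> \<in> fsupp (U \<times> U')"
  shows "cube_bd I \<rho>' pR c = D1 c + D2 c"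
proof (intro ext)
  fix \<tau> and z :: "'b \<times> 'c"
  obtain x y where z: "z = (x, y)" by (cases z)
  show "cube_bd I \<rho>' pR c \<tau> z = (D1 c + D2 c) \<tau> z"
  proof (cases "\<tau> \<subseteq> I")
    case True
    have fin: "finite (B - \<tau>)" "finite (A - \<tau>)" using F.finI AB by auto
    have "I - \<tau> = (B - \<tau>) \<union> (A - \<tau>)" "(B - \<tau>) \<inter> (A - \<tau>) = {}" using AB by auto
    then have "cube_bd I \<rho>' pR c \<tau> z = (\<Sum>i\<in>B-\<tau>. signed (pos \<rho>' i \<tau>) (pR i (c (insert i \<tau>))) z)
       + (\<Sum>i\<in>A-\<tau>. signed (pos \<rho>' i \<tau>) (pR i (c (insert i \<tau>))) z)"
      using True fin by (simp add: cube_bd_def sum.union_disjoint sum_fun_apply)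
    then show ?thesis
      using True pos_\<rho>'[OF True] by (simp add: z D1_eq D2_eq signed_fun pR_A pR_B assms)
  qed (simp add: cube_bd_def D1_def D2_def glue1_def glue2_def)
qed

private lemma bigraded_pcell:
  assumes "c \<in> bigraded p q"
  shows "c \<tau> \<in> fsupp (pcell A B \<tau>)"
  unfolding fsupp_def pcell_def
proof (intro CollectI allI impI)
  fix z assume "c \<tau> z \<noteq> 0"
  then show "z \<in> E (\<tau> \<union> A) \<times> E' (\<tau> - B)" using bigradedD(4,5)[OF assms, of \<tau> "fst z" "snd z"] by (simp add: mem_Times_iff)
qed

private lemma bigraded_fsupp:
  assumes "c \<in> bigraded p q"
  shows "c \<tau> \<in> fsupp (U \<times> U')"
proof (cases "\<tau> \<subseteq> I")
  case True
  have "A \<subseteq> I" using AB by auto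
  then have "fsupp (pcell A B \<tau>) \<subseteq> fsupp (U \<times> U')"
    by (intro fsupp_mono cells.E_subset[OF cells_pcell True])
  then show ?thesis using bigraded_pcell[OF assms] by blast
next
  case False
  then have "c \<tau> z = 0" for z using bigradedD(1)[OF assms, of \<tau> "fst z" "snd z"] by auto
  then show ?thesis by (simp add: fsupp_def)
qed

private lemma bigraded_chains: "c \<in> bigraded p q \<Longrightarrow> c \<in> cube_chains I (\<lambda>\<tau>. fsupp (pcell A B \<tau>)) (p + q)"
proof (rule cube_chainsI)
  fix \<tau> assume c: "c \<in> bigraded p q"
  show "c \<tau> \<in> fsupp (pcell A B \<tau>)" using c by (rule bigraded_pcell)
  assume \<tau>: "\<not> (\<tau> \<subseteq> I \<and> card \<tau> = p + q)"
  have "card \<tau> = card (\<tau> \<inter> B) + card (\<tau> \<inter> A)" if "\<tau> \<subseteq> I"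
    using split_eqs(1)[OF that] card_Un_disjoint[of "\<tau> \<inter> B" "\<tau> \<inter> A"] AB F.finI finite_subset[OF that]
    by (metis (no_types, lifting) Int_assoc Int_commute Int_empty_right finite_Int)
  then have "c \<tau> (x, y) = 0" for x y using bigradedD(1-3)[OF c] \<tau> by metis
  then show "c \<tau> = 0" by (auto simp: fun_eq_iff)
qed

text \<open>Instead of comparing signs, the total boundary is squared: it vanishes, and so do the
  squares of D1 and D2, which leaves the sum of the mixed terms.\<close>

private lemma D1_D2:
  assumes c: "c \<in> bigraded p q"
  shows "D1 (D2 c) = - D2 (D1 c)"
proof -
  interpret cube I "\<lambda>\<tau>. fsupp (pcell A B \<tau>)" pR
    using AB by (intro cells.cube cells_pcell) auto
  have D1c: "D1 c \<tau> \<in> fsupp (U \<times> U')" for \<tau>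
  proof (cases p)
    case 0
    \<comment> \<open>\<open>D1_mem\<close> speaks of positive p only; for p = 0 there is no colour
      of B to delete.\<close>
    have "D1 c = 0"
    proof -
      have "bdF (slice1 \<alpha> y c) \<beta> = 0" if "\<alpha> \<subseteq> A" for \<alpha> y \<beta>
      proof -
        have "slice1 \<alpha> y c (insert i \<beta>) = 0" if "\<beta> \<subseteq> B" for i
          using cube_chains_zero[OF slice1_chains(1)[OF c \<open>\<alpha> \<subseteq> A\<close>]] 0 cF.fin finite_subset[OF that cF.fin]
          by (simp add: card_insert_if card_eq_0_iff)
        then show ?thesis by (simp add: cube_bd_def additive.zero[OF push_additive])
      qed
      then show ?thesis by (auto simp: D1_def glue1_def fun_eq_iff)
    qed
    then show ?thesis by simp
  qed (use bigraded_fsupp[OF D1_mem] c in auto)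
  have D2c: "D2 c \<tau> \<in> fsupp (U \<times> U')" for \<tau>
  proof -
    have "D2 c = cube_bd I \<rho>' pR c - D1 c"
      using bd_eq_D1_D2[of c] bigraded_fsupp[OF c] by simp
    moreover have "cube_bd I \<rho>' pR c \<tau> \<in> fsupp (U \<times> U')"
    proof (cases "\<tau> \<subseteq> I")
      case True
      have "pR i (c (insert i \<tau>)) \<in> fsupp (pcell A B \<tau>)" if "i \<in> I - \<tau>" for i
      proof (intro R_mem)
        show "c (insert i \<tau>) \<in> fsupp (pcell A B (insert i \<tau>))"
          using c by (rule bigraded_pcell)
      qed (use that True in auto)
      then have "cube_bd I \<rho>' pR c \<tau> \<in> fsupp (pcell A B \<tau>)"
        using True by (auto simp: cube_bd_def intro!: F_sum F_signed)
      then show ?thesis using fsupp_mono[OF cells.E_subset[OF cells_pcell True]] AB by auto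
    qed (simp add: cube_bd_def)
    ultimately show ?thesis using D1c[of \<tau>] by (simp add: fsupp_diff)
  qed
  have "0 = cube_bd I \<rho>' pR (cube_bd I \<rho>' pR c)"
    using bd_bd[OF bigraded_chains[OF c] inj_\<rho>'] by simp
  also have "\<dots> = cube_bd I \<rho>' pR (D1 c) + cube_bd I \<rho>' pR (D2 c)"
    using bigraded_fsupp[OF c] by (simp add: bd_eq_D1_D2[of c] bd_add)
  also have "\<dots> = (D1 (D1 c) + D2 (D1 c)) + (D1 (D2 c) + D2 (D2 c))"
    using D1c D2c by (simp add: bd_eq_D1_D2)
  finally show ?thesis using D1_D1[OF c] D2_D2[OF c] by (simp add: eq_neg_iff_add_eq_0 add.commute)
qed

text \<open>D1 at \<tau> sees a chain only on cells with one more colour of B. Near \<tau> a chain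
  can therefore be replaced by one of its bigraded components.\<close>

private lemma D1_local:
  assumes "\<And>i. i \<in> B - \<tau> \<Longrightarrow> c (insert i \<tau>) = c' (insert i \<tau>)"
  shows "D1 c \<tau> = D1 c' \<tau>"
proof (cases "\<tau> \<subseteq> I")
  case True
  then show ?thesis using assms by (auto simp: fun_eq_iff D1_eq intro!: sum.cong)
qed (simp add: D1_def glue1_def fun_eq_iff)

private lemma D2_local:
  assumes "\<And>i. i \<in> A - \<tau> \<Longrightarrow> c (insert i \<tau>) = c' (insert i \<tau>)"
  shows "D2 c \<tau> = D2 c' \<tau>"
proof (cases "\<tau> \<subseteq> I")
  case True
  then show ?thesis using assms by (auto simp: fun_eq_iff D2_eq intro!: sum.cong)
qed (simp add: D2_def glue2_def fun_eq_iff)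

private lemma D1_exact:
  assumes ex: "exact_at B \<rho> FA F.cR p" and c: "c \<in> bigraded p q" "D1 c = 0"
  shows "\<exists>b\<in>bigraded (Suc p) q. D1 b = c"
proof -
  \<comment> \<open>Each slice is bounded separately. Choosing 0 for the zero slices keeps the glued
    chain within its bidegree.\<close>
  have "\<exists>b. b \<in> cube_chains B FA (Suc p) \<and> bdF b = slice1 \<alpha> y c \<and> (slice1 \<alpha> y c = 0 \<longrightarrow> b = 0)" if "\<alpha> \<subseteq> A" for \<alpha> y
  proof (cases "slice1 \<alpha> y c = 0")
    case True
    then show ?thesis using cF.chains_zero additive.zero[OF cF.bd_additive] by auto
  next
    case False
    have "bdF (slice1 \<alpha> y c) = 0"
      using slice1_D1[OF that, of y c] c(2) slice1_zero by simp
    then show ?thesis using ex slice1_chains(1)[OF c(1) that] False by (auto simp: exact_at_def)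
  qed
  then obtain b where b: "\<And>\<alpha> y. \<alpha> \<subseteq> A \<Longrightarrow> b \<alpha> y \<in> cube_chains B FA (Suc p)"
      "\<And>\<alpha> y. \<alpha> \<subseteq> A \<Longrightarrow> bdF (b \<alpha> y) = slice1 \<alpha> y c" "\<And>\<alpha> y. \<alpha> \<subseteq> A \<Longrightarrow> slice1 \<alpha> y c = 0 \<Longrightarrow> b \<alpha> y = 0"
    by metis
  have "slice1 \<alpha> y (glue1 b) = b \<alpha> y" if "\<alpha> \<subseteq> A" for \<alpha> y
    using that cube_chains_zero[OF b(1)[OF that]] by (intro slice1_glue1) auto
  then have "D1 (glue1 b) = glue1 (\<lambda>\<alpha> y. slice1 \<alpha> y c)"
    unfolding D1_def by (intro glue1_cong) (simp add: b(2))
  then have "D1 (glue1 b) = c" using glue1_slice1[OF c(1)] by simp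
  moreover have "glue1 b \<in> bigraded (Suc p) q"
    using b slice1_chains(2)[OF c(1)] by (intro glue1_bigraded) auto
  ultimately show ?thesis by blast
qed

private lemma D2_exact:
  assumes ex: "exact_at A \<rho> G.cF G.cR q" and c: "c \<in> bigraded p q" "D2 c = 0"
  shows "\<exists>b\<in>bigraded p (Suc q). D2 b = c"
proof -
  have "\<exists>b. b \<in> cube_chains A G.cF (Suc q) \<and> bdG b = slice2 \<beta> x c \<and> (slice2 \<beta> x c = 0 \<longrightarrow> b = 0)" if "\<beta> \<subseteq> B" for \<beta> x
  proof (cases "slice2 \<beta> x c = 0")
    case True
    then show ?thesis using cG.chains_zero additive.zero[OF cG.bd_additive] by auto
  next
    case False
    have "signed (card \<beta>) (bdG (slice2 \<beta> x c)) = 0"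
      using slice2_D2[OF that, of x c] c(2) slice2_zero by simp
    then show ?thesis using ex slice2_chains(1)[OF c(1) that] False by (auto simp: exact_at_def)
  qed
  then obtain b where b: "\<And>\<beta> x. \<beta> \<subseteq> B \<Longrightarrow> b \<beta> x \<in> cube_chains A G.cF (Suc q)"
      "\<And>\<beta> x. \<beta> \<subseteq> B \<Longrightarrow> bdG (b \<beta> x) = slice2 \<beta> x c" "\<And>\<beta> x. \<beta> \<subseteq> B \<Longrightarrow> slice2 \<beta> x c = 0 \<Longrightarrow> b \<beta> x = 0"
    by metis
  \<comment> \<open>The extra sign cancels the Koszul sign in D2.\<close>
  define b' where "b' \<beta> x = signed (card \<beta>) (b \<beta> x)" for \<beta> x
  have b': "b' \<beta> x \<in> cube_chains A G.cF (Suc q)" if "\<beta> \<subseteq> B" for \<beta> x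
    using b(1)[OF that] cG.chains_minus by (auto simp: b'_def signed_def)
  have "slice2 \<beta> x (glue2 b') = b' \<beta> x" if "\<beta> \<subseteq> B" for \<beta> x
    using that cube_chains_zero[OF b'[OF that]] by (intro slice2_glue2) auto
  moreover have "signed (card \<beta>) (bdG (b' \<beta> x)) = slice2 \<beta> x c" if "\<beta> \<subseteq> B" for \<beta> x
    using b(2)[OF that] by (simp add: b'_def additive.signed[OF cG.bd_additive] signed_signed) (simp add: signed_def)
  ultimately have "D2 (glue2 b') = glue2 (\<lambda>\<beta> x. slice2 \<beta> x c)"
    unfolding D2_def by (intro glue2_cong) simp
  then have "D2 (glue2 b') = c" using glue2_slice2[OF c(1)] by simp
  moreover have "glue2 b' \<in> bigraded p (Suc q)"
    using b' b(3) slice2_chains(2)[OF c(1)] by (intro glue2_bigraded) (auto simp: b'_def)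
  ultimately show ?thesis by blast
qed

text \<open>The boundaries of the first factor form a rational subspace. Size d is the last one
  where they may fail to be all cycles, hence the one where a complement is wanted.\<close>

private lemma exists_boundary_projection:
  obtains N where "additive N" "\<And>b. b \<in> cube_chains B FA (Suc d) \<Longrightarrow> N (bdF b) = 0"
    "\<And>f. \<exists>b\<in>cube_chains B FA (Suc d). bdF b = f - N f"
proof -
  let ?V = "bdF ` cube_chains B FA (Suc d)"
  have z: "0 \<in> ?V" using cF.chains_zero additive.zero[OF cF.bd_additive] by (metis image_eqI)
  have a: "f + g \<in> ?V" if "f \<in> ?V" "g \<in> ?V" for f g
  proof -
    from that obtain b b' where "b \<in> cube_chains B FA (Suc d)" "b' \<in> cube_chains B FA (Suc d)" "f = bdF b" "g = bdF b'"
      by auto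
    then show ?thesis using cF.chains_add cF.bd_add[of \<rho> b b'] by (metis image_eqI)
  qed
  have sc: "(\<lambda>k x. a * f k x) \<in> ?V" if "f \<in> ?V" for a f
  proof -
    from that obtain b where b: "b \<in> cube_chains B FA (Suc d)" "f = bdF b" by auto
    have "(\<lambda>k x. a * b k x) \<in> cube_chains B FA (Suc d)"
    proof (rule cube_chainsI)
      fix \<tau> show "(\<lambda>x. a * b \<tau> x) \<in> FA \<tau>" if "\<tau> \<subseteq> B" "card \<tau> = Suc d"
        using cube_chains_mem[OF b(1) that] by (auto simp: fsupp_def)
      show "(\<lambda>x. a * b \<tau> x) = 0" if "\<not> (\<tau> \<subseteq> B \<and> card \<tau> = Suc d)"
        using cube_chains_zero[OF b(1) that] by (auto simp: fun_eq_iff)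
    qed
    moreover have "bdF (\<lambda>k x. a * b k x) = (\<lambda>k x. a * f k x)"
    proof (intro ext)
      fix \<tau> and x :: 'b
      have "signed n (push U g (\<lambda>x. a * h x)) x = a * signed n (push U g h) x" for n g h
        by (simp add: signed_def push_def sum_distrib_left)
      then show "bdF (\<lambda>k x. a * b k x) \<tau> x = a * f \<tau> x"
        using b(2) by (simp add: cube_bd_def sum_fun_apply sum_distrib_left)
    qed
    ultimately show ?thesis by (metis image_eqI)
  qed
  show thesis
  proof (rule exists_projection[OF z a sc])
    fix N assume N: "additive N" "\<And>f. f \<in> ?V \<Longrightarrow> N f = 0" "\<And>f. f - N f \<in> ?V"
    show thesis
    proof (rule that)
      show "additive N" by fact
      show "N (bdF b) = 0" if "b \<in> cube_chains B FA (Suc d)" for b using N(2) that by blast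
      show "\<exists>b\<in>cube_chains B FA (Suc d). bdF b = f - N f" for f
      proof -
        from N(3)[of f] obtain b where "f - N f = bdF b" "b \<in> cube_chains B FA (Suc d)" by (rule imageE)
        then show ?thesis by (intro bexI[of _ b]) (rule sym)
      qed
    qed
  qed
qed

text \<open>A slice of \<open>D2 c\<close> is a sum of slices of c with signs, so every additive map
  applied slice by slice commutes with D2. The sign contains p in place of card \<beta> because c is
  concentrated in bidegree (p, q).\<close>

private lemma slice1_D2:
  assumes c: "c \<in> bigraded p q" and \<alpha>: "\<alpha> \<subseteq> A"
  shows "slice1 \<alpha> y (D2 c) = (\<Sum>i\<in>A-\<alpha>. \<Sum>y'\<in>{y'\<in>U'. del' i y' = y}. signed (p + pos \<rho> i \<alpha>) (slice1 (insert i \<alpha>) y' c))"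
proof (intro ext)
  fix \<beta> x
  show "slice1 \<alpha> y (D2 c) \<beta> x =
    (\<Sum>i\<in>A-\<alpha>. \<Sum>y'\<in>{y'\<in>U'. del' i y' = y}. signed (p + pos \<rho> i \<alpha>) (slice1 (insert i \<alpha>) y' c)) \<beta> x"
  proof (cases "\<beta> \<subseteq> B")
    case True
    have eqs: "A - (\<beta> \<union> \<alpha>) = A - \<alpha>" "\<beta> \<union> \<alpha> \<subseteq> I" "(\<beta> \<union> \<alpha>) \<inter> B = \<beta>" "(\<beta> \<union> \<alpha>) \<inter> A = \<alpha>" using True \<alpha> AB by auto
    have sg: "signed (card \<beta> + n) (c (insert i (\<beta> \<union> \<alpha>)) (x, y')) = signed (p + n) (c (insert i (\<beta> \<union> \<alpha>)) (x, y'))"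
      if "i \<in> A" for n i y'
    proof (cases "c (insert i (\<beta> \<union> \<alpha>)) (x, y') = 0")
      case False
      have "insert i (\<beta> \<union> \<alpha>) \<inter> B = \<beta>" using True \<alpha> AB that by auto
      then show ?thesis using bigradedD(2)[OF c False] by simp
    qed simp
    show ?thesis
      using True unfolding slice1_def D2_eq[OF eqs(2)] eqs
      by (auto simp: sum_fun_apply signed_fun slice1_def push_def signed_sum intro!: sum.cong sg)
  qed (simp add: slice1_def sum_fun_apply signed_fun)
qed

text \<open>The bicomplex with differentials D1 and D2 is exact in the first direction above d and
  in the second above e, so \<open>bicomplex_total_exact\<close> gives exactness of the total
  complex above d + e.\<close>

lemma exact_at_kuenneth:
  assumes exF: "\<And>s. d < s \<Longrightarrow> exact_at B \<rho> (\<lambda>\<tau>. fsupp (E (\<tau> \<union> A))) (\<lambda>i. push U (del i)) s"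
    and exG: "\<And>s. e < s \<Longrightarrow> exact_at A \<rho> (\<lambda>\<tau>. fsupp (E' \<tau>)) (\<lambda>i. push U' (del' i)) s"
    and s: "d + e < s"
  shows "exact_at I \<rho> (\<lambda>\<tau>. fsupp (pcell A B \<tau>)) (\<lambda>i. push (U \<times> U') (pdel A B i)) s"
proof -
  have cI: "cells I (U \<times> U') (pcell A B) (pdel A B)" using AB by (intro cells_pcell) auto
  interpret cI: cube I "\<lambda>\<tau>. fsupp (pcell A B \<tau>)" pR by (rule cells.cube[OF cI])
  obtain N where N: "additive N" "\<And>b. b \<in> cube_chains B FA (Suc d) \<Longrightarrow> N (bdF b) = 0"
      "\<And>f. \<exists>b\<in>cube_chains B FA (Suc d). bdF b = f - N f"
    using exists_boundary_projection by blast
  interpret N: additive N by fact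
  \<comment> \<open>N on the first tensor factor, tensored with the identity of the second.\<close>
  define M where "M c = glue1 (\<lambda>\<alpha> y. N (slice1 \<alpha> y c))" for c
  \<comment> \<open>N is defined on the whole ambient function space; it preserves chains of size d
    because f - N f is a boundary and hence such a chain.\<close>
  have N_ch: "N f \<in> cube_chains B FA d" if "f \<in> cube_chains B FA d" for f
  proof -
    obtain b where "b \<in> cube_chains B FA (Suc d)" "bdF b = f - N f" using N(3) by blast
    then have "f - N f \<in> cube_chains B FA d" using cF.bd_chains by metis
    from cF.chains_diff[OF that this] show ?thesis by simp
  qed
  have slice_M: "slice1 \<alpha> y (M c) = N (slice1 \<alpha> y c)" if "c \<in> bigraded d q" "\<alpha> \<subseteq> A" for \<alpha> y c q
    unfolding M_def using that cube_chains_zero[OF N_ch[OF slice1_chains(1)[OF that]]]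
    by (intro slice1_glue1) auto
  have M_mem: "M c \<in> bigraded d q" if "c \<in> bigraded d q" for c q
    unfolding M_def using that
    by (intro glue1_bigraded N_ch slice1_chains) (auto simp: slice1_chains(2)[OF that] N.zero)
  have M_D2: "D2 (M c) = M (D2 c)" if c: "c \<in> bigraded d q" for c q
  proof (intro ext)
    fix \<tau> z
    show "D2 (M c) \<tau> z = M (D2 c) \<tau> z"
    proof (cases "\<tau> \<subseteq> I")
      case True
      have "D2 (M c) \<tau> z = slice1 (\<tau> \<inter> A) (snd z) (D2 (M c)) (\<tau> \<inter> B) (fst z)"
        using split_eqs(1)[OF True] by (simp add: slice1_def)
      also have "slice1 (\<tau> \<inter> A) (snd z) (D2 (M c)) = N (slice1 (\<tau> \<inter> A) (snd z) (D2 c))"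
        using slice_M[OF c] by (simp add: slice1_D2[OF M_mem[OF c]] slice1_D2[OF c] N.sum N.signed)
      also have "N (slice1 (\<tau> \<inter> A) (snd z) (D2 c)) (\<tau> \<inter> B) (fst z) = M (D2 c) \<tau> z"
        using True by (simp add: M_def glue1_def)
      finally show ?thesis .
    qed (simp add: D2_def M_def glue1_def glue2_def)
  qed
  have M_D1: "M (- D1 c) = 0" if c: "c \<in> bigraded (Suc d) q" for c q
  proof -
    have "slice1 \<alpha> y (- D1 c) = - bdF (slice1 \<alpha> y c)" if "\<alpha> \<subseteq> A" for \<alpha> y
      using slice1_D1[OF that, of y c] by (simp add: slice1_minus)
    then have "N (slice1 \<alpha> y (- D1 c)) = 0" if "\<alpha> \<subseteq> A" for \<alpha> y
      using that N(2)[OF slice1_chains(1)[OF c that]] by (simp add: N.minus)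
    then show ?thesis by (auto simp: M_def glue1_def fun_eq_iff)
  qed
  have M_split: "\<exists>b\<in>bigraded (Suc d) q. D1 b = c - M c" if c: "c \<in> bigraded d q" for c q
  proof -
    have "\<exists>b. b \<in> cube_chains B FA (Suc d) \<and> bdF b = slice1 \<alpha> y c - N (slice1 \<alpha> y c) \<and> (slice1 \<alpha> y c = 0 \<longrightarrow> b = 0)" for \<alpha> y
    proof (cases "slice1 \<alpha> y c = 0")
      case True
      then show ?thesis using cF.chains_zero additive.zero[OF cF.bd_additive] N.zero by auto
    qed (use N(3) in auto)
    then obtain b where b: "\<And>\<alpha> y. b \<alpha> y \<in> cube_chains B FA (Suc d)"
        "\<And>\<alpha> y. bdF (b \<alpha> y) = slice1 \<alpha> y c - N (slice1 \<alpha> y c)" "\<And>\<alpha> y. slice1 \<alpha> y c = 0 \<Longrightarrow> b \<alpha> y = 0"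
      by metis
    have "slice1 \<alpha> y (glue1 b) = b \<alpha> y" if "\<alpha> \<subseteq> A" for \<alpha> y
      using that cube_chains_zero[OF b(1)] by (intro slice1_glue1) auto
    then have "D1 (glue1 b) = glue1 (\<lambda>\<alpha> y. slice1 \<alpha> y c - N (slice1 \<alpha> y c))"
      unfolding D1_def by (intro glue1_cong) (simp add: b(2))
    also have "\<dots> = glue1 (\<lambda>\<alpha> y. slice1 \<alpha> y c) - M c"
      by (simp add: M_def glue1_def fun_eq_iff)
    finally have "D1 (glue1 b) = glue1 (\<lambda>\<alpha> y. slice1 \<alpha> y c) - M c" .
    then have "D1 (glue1 b) = c - M c" using glue1_slice1[OF c] by simp
    moreover have "glue1 b \<in> bigraded (Suc d) q"
      using b slice1_chains(2)[OF c] by (intro glue1_bigraded) auto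
    ultimately show ?thesis by blast
  qed
  have bg_diff: "x - y \<in> bigraded p q" if "x \<in> bigraded p q" "y \<in> bigraded p q" for x y p q
    unfolding bigraded_def
  proof (intro CollectI allI impI)
    fix \<tau> u v assume "(x - y) \<tau> (u, v) \<noteq> 0"
    then have "x \<tau> (u, v) \<noteq> 0 \<or> y \<tau> (u, v) \<noteq> 0" by auto
    then show "\<tau> \<subseteq> I \<and> card (\<tau> \<inter> B) = p \<and> card (\<tau> \<inter> A) = q \<and> u \<in> E (\<tau> \<union> A) \<and> v \<in> E' (\<tau> - B)"
      using bigradedD[OF that(1), of \<tau> u v] bigradedD[OF that(2), of \<tau> u v] by blast
  qed
  have card_split: "card \<tau> = card (\<tau> \<inter> B) + card (\<tau> \<inter> A)" if "\<tau> \<subseteq> I" for \<tau>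
    using split_eqs(1)[OF that] card_Un_disjoint[of "\<tau> \<inter> B" "\<tau> \<inter> A"] AB F.finI finite_subset[OF that]
    by (metis (no_types, lifting) Int_assoc Int_commute Int_empty_right finite_Int)
  have "exact_at I \<rho>' (\<lambda>\<tau>. fsupp (pcell A B \<tau>)) pR s"
    unfolding exact_at_def
  proof (intro ballI impI)
    fix c assume c: "c \<in> cube_chains I (\<lambda>\<tau>. fsupp (pcell A B \<tau>)) s" "cube_bd I \<rho>' pR c = 0"
    have pU: "fsupp (pcell A B \<tau>) \<subseteq> fsupp (U \<times> U')" if "\<tau> \<subseteq> I" for \<tau>
      using cells.E_subset[OF cI that] by (rule fsupp_mono)
    have ch_U: "f \<tau> \<in> fsupp (U \<times> U')" if "f \<in> cube_chains I (\<lambda>\<tau>. fsupp (pcell A B \<tau>)) k" for f k \<tau>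
      using cube_chains_mem[OF that, of \<tau>] cube_chains_zero[OF that, of \<tau>] pU[of \<tau>] by (metis fsupp_0 subsetD)
    \<comment> \<open>The component of the cycle with p colours of B, in bidegree (p, s -
      p).\<close>
    define comp where "comp p \<tau> = (if card (\<tau> \<inter> B) = p then c \<tau> else 0)" for p \<tau>
    have comp_mem: "comp p \<in> bigraded p (s - p)" if "p \<le> s" for p
      unfolding bigraded_def
    proof (intro CollectI allI impI)
      fix \<tau> x y assume nz: "comp p \<tau> (x, y) \<noteq> 0"
      then have p: "card (\<tau> \<inter> B) = p" and cnz: "c \<tau> (x, y) \<noteq> 0" by (auto simp: comp_def split: if_splits)
      then have \<tau>: "\<tau> \<subseteq> I" "card \<tau> = s" using cube_chains_zero[OF c(1), of \<tau>] by (metis zero_fun_def)+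
      moreover have "(x, y) \<in> pcell A B \<tau>" using cube_chains_mem[OF c(1) \<tau>] cnz by (auto simp: fsupp_def)
      ultimately show "\<tau> \<subseteq> I \<and> card (\<tau> \<inter> B) = p \<and> card (\<tau> \<inter> A) = s - p \<and> x \<in> E (\<tau> \<union> A) \<and> y \<in> E' (\<tau> - B)"
        using p card_split[of \<tau>] by (auto simp: pcell_def)
    qed
    have ins_B: "card (insert i \<tau> \<inter> B) = Suc (card (\<tau> \<inter> B))" if "i \<in> B - \<tau>" "\<tau> \<subseteq> I" for i \<tau>
      using that finite_subset[OF that(2) F.finI] by simp
    have ins_A: "insert i \<tau> \<inter> B = \<tau> \<inter> B" if "i \<in> A - \<tau>" for i \<tau>
      using that AB by auto
    have D1_loc: "D1 (\<lambda>\<tau>. h (card (\<tau> \<inter> B)) \<tau>) \<tau> = D1 (h (Suc (card (\<tau> \<inter> B)))) \<tau>" for h \<tau>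
    proof (cases "\<tau> \<subseteq> I")
      case True
      then show ?thesis using ins_B by (intro D1_local) auto
    qed (simp add: D1_def glue1_def fun_eq_iff)
    have D2_loc: "D2 (\<lambda>\<tau>. h (card (\<tau> \<inter> B)) \<tau>) \<tau> = D2 (h (card (\<tau> \<inter> B))) \<tau>" for h \<tau>
      using ins_A by (intro D2_local) auto
    have c_comp: "c = (\<lambda>\<tau>. comp (card (\<tau> \<inter> B)) \<tau>)" by (auto simp: comp_def)
    have cyc: "D1 (comp (Suc p)) + D2 (comp p) = 0" if "p < s" for p
    proof
      fix \<tau>
      show "(D1 (comp (Suc p)) + D2 (comp p)) \<tau> = 0 \<tau>"
      proof (cases "card (\<tau> \<inter> B) = p")
        case True
        have "D1 c + D2 c = 0" using bd_eq_D1_D2[of c] ch_U[OF c(1)] c(2) by simp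
        then have "D1 c \<tau> + D2 c \<tau> = 0" by (auto simp: fun_eq_iff)
        then show ?thesis using D1_loc[of comp \<tau>] D2_loc[of comp \<tau>] True c_comp by simp
      next
        case False
        have "D1 (comp (Suc p)) \<in> bigraded p (s - Suc p)" "D2 (comp p) \<in> bigraded p (s - Suc p)"
          using that by (auto intro!: D1_mem D2_mem comp_mem simp: Suc_diff_Suc)
        from this[THEN bigradedD(2)] False
        have "D1 (comp (Suc p)) \<tau> (x, y) = 0" "D2 (comp p) \<tau> (x, y) = 0" for x y by metis+
        then show ?thesis by (auto simp: fun_eq_iff)
      qed
    qed
    have "\<exists>b. (\<forall>p\<le>Suc s. b p \<in> bigraded p (Suc s - p)) \<and> (\<forall>p\<le>s. comp p = D1 (b (Suc p)) + D2 (b p))"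
    proof (rule bicomplex_total_exact[of D1 D2 bigraded d e M s comp])
      show "\<exists>y\<in>bigraded (Suc p) q. D1 y = x" if "d < p" "x \<in> bigraded p q" "D1 x = 0" for p q x
        using exF that by (intro D1_exact)
      show "\<exists>y\<in>bigraded p (Suc q). D2 y = x" if "e < q" "x \<in> bigraded p q" "D2 x = 0" for p q x
        using exG that by (intro D2_exact)
    qed (fact D1_additive D2_additive s | rule bg_diff D1_mem D2_mem M_mem M_D2 M_D1 M_split comp_mem cyc; assumption
         | erule D1_D1 D2_D2 D1_D2)+
    then obtain b where b: "\<And>p. p \<le> Suc s \<Longrightarrow> b p \<in> bigraded p (Suc s - p)"
        "\<And>p. p \<le> s \<Longrightarrow> comp p = D1 (b (Suc p)) + D2 (b p)" by blast
    \<comment> \<open>Nothing is known of \<open>b p\<close> for p > s + 1, so it is replaced by 0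
      there.\<close>
    define b' where "b' p = (if p \<le> Suc s then b p else 0)" for p
    define t where "t = (\<lambda>\<tau>. b' (card (\<tau> \<inter> B)) \<tau>)"
    have t: "t \<in> cube_chains I (\<lambda>\<tau>. fsupp (pcell A B \<tau>)) (Suc s)"
    proof (rule cube_chainsI)
      fix \<tau>
      show "t \<tau> \<in> fsupp (pcell A B \<tau>)"
        using bigraded_pcell[OF b(1)] by (auto simp: t_def b'_def)
      assume \<tau>: "\<not> (\<tau> \<subseteq> I \<and> card \<tau> = Suc s)"
      show "t \<tau> = 0"
      proof (cases "card (\<tau> \<inter> B) \<le> Suc s")
        case True
        have "b (card (\<tau> \<inter> B)) \<tau> = 0"
          using cube_chains_zero[OF bigraded_chains[OF b(1)[OF True]], of \<tau>] \<tau> True by simp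
        then show ?thesis by (simp add: t_def b'_def)
      qed (simp add: t_def b'_def)
    qed
    have "cube_bd I \<rho>' pR t \<tau> = c \<tau>" for \<tau>
    proof (cases "\<tau> \<subseteq> I \<and> card \<tau> = s")
      case True
      then have p: "card (\<tau> \<inter> B) \<le> s" using card_split[of \<tau>] by simp
      have "cube_bd I \<rho>' pR t \<tau> = D1 t \<tau> + D2 t \<tau>" using bd_eq_D1_D2[of t] ch_U[OF t] by simp
      also have "\<dots> = (D1 (b (Suc (card (\<tau> \<inter> B)))) + D2 (b (card (\<tau> \<inter> B)))) \<tau>"
        using D1_loc[of b' \<tau>] D2_loc[of b' \<tau>] p by (simp add: t_def b'_def)
      also have "\<dots> = c \<tau>" using b(2)[OF p] by (metis c_comp)
      finally show ?thesis .
    next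
      case False
      then show ?thesis using cube_chains_zero[OF cI.bd_chains[OF t] False] cube_chains_zero[OF c(1) False] by simp
    qed
    then show "\<exists>b\<in>cube_chains I (\<lambda>\<tau>. fsupp (pcell A B \<tau>)) (Suc s). cube_bd I \<rho>' pR b = c"
      using t by (auto simp: fun_eq_iff)
  qed
  then show ?thesis using exact_at_reorder[OF cells.cube[OF cI] inj_\<rho>' inj] by blast
qed

end

end

subsection \<open>The fibrewise product\<close>

lemma cube_cong:
  assumes "cube J F R" "\<And>\<tau>. \<tau> \<subseteq> J \<Longrightarrow> F \<tau> = F' \<tau>" "\<And>j. j \<in> J \<Longrightarrow> R j = R' j" "\<And>j. additive (R' j)"
  shows "cube J F' R'"
proof (rule cube.intro)
  interpret cube J F R by fact
  show "finite J" by (rule fin)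
  show "additive (R' j)" for j by fact
  fix \<tau> assume \<tau>: "\<tau> \<subseteq> J"
  show "0 \<in> F' \<tau>" using F_0[OF \<tau>] assms(2)[OF \<tau>] by simp
  show "x + y \<in> F' \<tau>" if "x \<in> F' \<tau>" "y \<in> F' \<tau>" for x y using F_add[OF \<tau>] assms(2)[OF \<tau>] that by simp
  show "- x \<in> F' \<tau>" if "x \<in> F' \<tau>" for x using F_minus[OF \<tau>] assms(2)[OF \<tau>] that by simp
  show "R' i x \<in> F' \<tau>" if "i \<in> J" "i \<notin> \<tau>" "x \<in> F' (insert i \<tau>)" for i x
    using R_mem[OF \<tau> that(1,2)] assms(2)[OF \<tau>] assms(2)[of "insert i \<tau>"] assms(3)[of i] that \<tau> by simp
  show "R' i (R' j x) = R' j (R' i x)"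
    if "i \<in> J" "j \<in> J" "i \<notin> \<tau>" "j \<notin> \<tau>" "i \<noteq> j" "x \<in> F' (insert i (insert j \<tau>))" for i j x
    using R_commute[OF \<tau> that(1-5)] assms(2)[of "insert i (insert j \<tau>)"] assms(3)[of i] assms(3)[of j] that \<tau> by simp
qed

lemma cube_map_cong:
  assumes "cube_map J F R G Q f" "\<And>\<tau>. \<tau> \<subseteq> J \<Longrightarrow> F \<tau> = F' \<tau>" "\<And>\<tau>. \<tau> \<subseteq> J \<Longrightarrow> G \<tau> = G' \<tau>"
    and "\<And>j. j \<in> J \<Longrightarrow> R j = R' j" "\<And>j. j \<in> J \<Longrightarrow> Q j = Q' j"
  shows "cube_map J F' R' G' Q' f"
  using assms unfolding cube_map_def by simp

lemma cone_exact_cong: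
  assumes "cone_exact J \<rho> P Q R g s" "\<And>\<tau>. \<tau> \<subseteq> J \<Longrightarrow> P \<tau> = P' \<tau>" "\<And>\<tau>. \<tau> \<subseteq> J \<Longrightarrow> Q \<tau> = Q' \<tau>"
    and "\<And>j. j \<in> J \<Longrightarrow> R j = R' j"
  shows "cone_exact J \<rho> P' Q' R' g s"
proof -
  have "cube_chains J P k = cube_chains J P' k" "cube_chains J Q k = cube_chains J Q' k" for k
    using assms(2,3) by (auto simp: cube_chains_def)
  then show ?thesis
    using assms(1) cube_bd_cong[of J R R', OF assms(4)] by (simp add: cone_exact_def)
qed

context cells_pair
begin

text \<open>Induction on the number of shared colours. For a shared colour i, simultaneous deletion
  is deletion from the second cell followed by deletion from the first. The cones of the two steps
  are the complexes with i moved to A and with i moved to B, and each has one shared colour less.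
  Without shared colours, Kuenneth applies to the link of A in the first factor, restricted to B,
  and the restriction of the second factor to A.\<close>

lemma exact_at_merge:
  assumes exF: "\<And>S s. S \<subseteq> I \<Longrightarrow> d < s \<Longrightarrow> exact_at S \<rho> F.cF F.cR s"
    and exG: "\<And>S s. S \<subseteq> I \<Longrightarrow> e < s \<Longrightarrow> exact_at S \<rho> G.cF G.cR s"
    and "A \<subseteq> I" "B \<subseteq> I" "A \<inter> B = {}" and s: "d + e < s"
  shows "exact_at I \<rho> (\<lambda>\<tau>. fsupp (pcell A B \<tau>)) (\<lambda>i. push (U \<times> U') (pdel A B i)) s"
  using assms(3-5)
proof (induction "card (I - A - B)" arbitrary: A B)
  case 0
  then have AB: "A \<union> B = I" using F.finI by auto
  show ?case
  proof (rule exact_at_kuenneth[OF \<open>A \<inter> B = {}\<close> AB _ _ s])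
    show "exact_at B \<rho> (\<lambda>\<tau>. F.cF (\<tau> \<union> A)) F.cR k" if "d < k" for k
      using 0 that by (intro exact_at_link[OF F.cube inj exF]) auto
    show "exact_at A \<rho> G.cF G.cR k" if "e < k" for k
      using 0 that by (intro exG)
  qed
next
  case (Suc n)
  then have "I - A - B \<noteq> {}" by (metis card.empty nat.distinct(1))
  then obtain i where i: "i \<in> I" "i \<notin> A" "i \<notin> B" by auto
  have n: "n = card (I - insert i A - B)" "n = card (I - A - insert i B)"
  proof -
    have "I - insert i A - B = (I - A - B) - {i}" "I - A - insert i B = (I - A - B) - {i}" by auto
    then show "n = card (I - insert i A - B)" "n = card (I - A - insert i B)"
      using Suc(2) i by auto
  qed
  define J where "J = I - {i}"
  have J: "I = insert i J" "i \<notin> J" using i by (auto simp: J_def)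
  obtain k where k: "s = Suc k" using s by (cases s) auto
  let ?\<rho> = "first_order i \<rho>"
  have min: "?\<rho> i < ?\<rho> j" if "j \<in> J" for j using that J by (intro first_order_less) auto
  have inj': "inj_on ?\<rho> I" by (rule inj_on_first_order[OF inj])
  let ?R = "\<lambda>A B i. push (U \<times> U') (pdel A B i)" and ?H = "\<lambda>A B \<tau>. fsupp (pcell A B \<tau>)"
  have cAB: "cube I (?H A B) (?R A B)"
    using Suc.prems by (intro cells.cube cells_pcell)
  have cA: "cube I (?H (insert i A) B) (?R (insert i A) B)"
    using Suc.prems i by (intro cells.cube cells_pcell) auto
  have cB: "cube I (?H A (insert i B)) (?R A (insert i B))"
    using Suc.prems by (intro cells.cube cells_pcell)
  have eA: "exact_at I \<rho> (?H (insert i A) B) (?R (insert i A) B) s"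
    using Suc.prems i by (intro Suc.hyps(1)[OF n(1)]) auto
  have eB: "exact_at I \<rho> (?H A (insert i B)) (?R A (insert i B)) s"
    using Suc.prems i by (intro Suc.hyps(1)[OF n(2)]) auto
  have coneA: "cone_exact J ?\<rho> (\<lambda>\<tau>. ?H (insert i A) B (insert i \<tau>)) (?H (insert i A) B) (?R (insert i A) B) (?R (insert i A) B i) k"
    using exact_at_iff_cone[where \<rho>="first_order i \<rho>", OF cA J min] exact_at_reorder[OF cA inj inj' eA] k by simp
  have coneB: "cone_exact J ?\<rho> (\<lambda>\<tau>. ?H A (insert i B) (insert i \<tau>)) (?H A (insert i B)) (?R A (insert i B)) (?R A (insert i B) i) k"
    using exact_at_iff_cone[where \<rho>="first_order i \<rho>", OF cB J min] exact_at_reorder[OF cB inj inj' eB] k by simp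
  have RA: "?R (insert i A) B j = ?R A B j" and RB: "?R A (insert i B) j = ?R A B j" if "j \<in> J" for j
  proof -
    have "j \<noteq> i" using that J by auto
    then show "?R (insert i A) B j = ?R A B j" "?R A (insert i B) j = ?R A B j" by (simp_all add: pdel_def)
  qed
  have PA: "?H (insert i A) B (insert i \<tau>) = ?H A B (insert i \<tau>)" for \<tau>
    by (simp add: pcell_def)
  \<comment> \<open>The common middle term, with i present in the first factor and absent from the
    second: it is the target of the first cone and the source of the second.\<close>
  have QB: "?H A (insert i B) (insert i \<tau>) = ?H (insert i A) B \<tau>" if "\<tau> \<subseteq> J" for \<tau>
  proof -
    have "insert i \<tau> - insert i B = \<tau> - B" using that J by auto
    then show ?thesis by (simp add: pcell_def)
  qed
  have TB: "?H A (insert i B) \<tau> = ?H A B \<tau>" if "\<tau> \<subseteq> J" for \<tau>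
  proof -
    have "\<tau> - insert i B = \<tau> - B" using that J by auto
    then show ?thesis by (simp add: pcell_def)
  qed
  have JI: "J \<subseteq> I" using J by auto
  have "cone_exact J ?\<rho> (\<lambda>\<tau>. ?H A B (insert i \<tau>)) (?H A B) (?R A B) (?R A B i) k"
  proof (rule cone_exact_comp)
    show "cube J (\<lambda>\<tau>. ?H A B (insert i \<tau>)) (?R A B)" by (rule cube_top[where \<rho>="first_order i \<rho>", OF cAB J min])
    show "cube J (?H (insert i A) B) (?R A B)"
      by (rule cube_cong[OF cube.subcube[OF cA JI]]) (auto simp: RA push_additive)
    show "cube J (?H A B) (?R A B)" by (rule cube.subcube[OF cAB JI])
    show "cube_map J (\<lambda>\<tau>. ?H A B (insert i \<tau>)) (?R A B) (?H (insert i A) B) (?R A B) (?R (insert i A) B i)"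
      by (rule cube_map_cong[OF cube_map_top[where \<rho>="first_order i \<rho>", OF cA J min]]) (auto simp: RA PA)
    show "cube_map J (?H (insert i A) B) (?R A B) (?H A B) (?R A B) (?R A (insert i B) i)"
      by (rule cube_map_cong[OF cube_map_top[where \<rho>="first_order i \<rho>", OF cB J min]]) (auto simp: RB QB TB)
    show "cone_exact J ?\<rho> (\<lambda>\<tau>. ?H A B (insert i \<tau>)) (?H (insert i A) B) (?R A B) (?R (insert i A) B i) k"
      by (rule cone_exact_cong[OF coneA]) (auto simp: RA PA)
    show "cone_exact J ?\<rho> (?H (insert i A) B) (?H A B) (?R A B) (?R A (insert i B) i) k"
      by (rule cone_exact_cong[OF coneB]) (auto simp: RB QB TB)
    show "?R A B i 0 = 0" by (rule additive.zero[OF push_additive])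
    fix \<tau> x assume \<tau>: "\<tau> \<subseteq> J" and x: "x \<in> ?H A B (insert i \<tau>)"
    have "?R A (insert i B) i (?R (insert i A) B i x) = push (U \<times> U') (\<lambda>z. pdel A (insert i B) i (pdel (insert i A) B i z)) x"
    proof (rule push_push[OF _ _ x])
      fix z assume "z \<in> pcell A B (insert i \<tau>)"
      then have "z \<in> pcell (insert i A) B (insert i \<tau>)" by (simp add: pcell_def)
      then have "pdel (insert i A) B i z \<in> pcell (insert i A) B \<tau>"
        using \<tau> J Suc.prems i by (intro cells.del_mem[OF cells_pcell]) auto
      moreover have "pcell (insert i A) B \<tau> \<subseteq> U \<times> U'"
        using \<tau> J Suc.prems i by (intro cells.E_subset[OF cells_pcell]) auto
      ultimately show "pdel (insert i A) B i z \<in> U \<times> U'" by blast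
    qed (use F.finU G.finU in auto)
    also have "(\<lambda>z. pdel A (insert i B) i (pdel (insert i A) B i z)) = pdel A B i"
      using i by (auto simp: pdel_def)
    finally show "?R A B i x = ?R A (insert i B) i (?R (insert i A) B i x)" by simp
  qed
  then have "exact_at I ?\<rho> (?H A B) (?R A B) s"
    using exact_at_iff_cone[where \<rho>="first_order i \<rho>", OF cAB J min] k by simp
  then show ?case using exact_at_reorder[OF cAB inj' inj] by blast
qed

lemma exact_at_product:
  assumes "\<And>S s. S \<subseteq> I \<Longrightarrow> d < s \<Longrightarrow> exact_at S \<rho> F.cF F.cR s"
    and "\<And>S s. S \<subseteq> I \<Longrightarrow> e < s \<Longrightarrow> exact_at S \<rho> G.cF G.cR s"
    and "d + e < s"
  shows "exact_at I \<rho> (\<lambda>\<tau>. fsupp (E \<tau> \<times> E' \<tau>)) (\<lambda>i. push (U \<times> U') (\<lambda>(x, y). (del i x, del' i y))) s"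
  using exact_at_merge[OF assms(1,2) _ _ _ assms(3), of "{}" "{}"]
  by (simp add: pcell_def pdel_def)

end

section \<open>Alternating functions on tuples\<close>

definition list_cells :: "'b set \<Rightarrow> nat \<Rightarrow> 'b list set" where
  "list_cells E k = {xs. set xs \<subseteq> E \<and> length xs = k}"

lemma finite_list_cells: "finite U \<Longrightarrow> finite (list_cells U k)"
  by (simp add: list_cells_def finite_lists_length_eq)

lemma push_list_Cons:
  assumes "finite U"
  shows "push (list_cells U (Suc k)) (map f) c (y # ys) =
    (\<Sum>x\<in>{x\<in>U. f x = y}. push (list_cells U k) (map f) (\<lambda>zs. c (x # zs)) ys)"
proof -
  have "{xs \<in> list_cells U (Suc k). map f xs = y # ys} =
      (\<lambda>(x, zs). x # zs) ` (SIGMA x:{x\<in>U. f x = y}. {zs \<in> list_cells U k. map f zs = ys})"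
    by (force simp: list_cells_def length_Suc_conv map_eq_Cons_conv)
  moreover have "inj_on (\<lambda>(x, zs). x # zs) S" for S :: "('a \<times> 'a list) set"
    by (auto simp: inj_on_def)
  ultimately show ?thesis
    using assms by (simp add: push_def sum.reindex finite_list_cells sum.Sigma case_prod_unfold)
qed

lemma push_list_Nil: "push (list_cells U (Suc k)) (map f) c [] = 0"
proof -
  have "{x \<in> list_cells U (Suc k). map f x = []} = {}" by (auto simp: list_cells_def)
  then show ?thesis unfolding push_def by (simp only: sum.empty)
qed

lemma push_list_0: "push (list_cells U 0) (map f) c ys = (if ys = [] then c [] else 0)"
proof -
  have "{x \<in> list_cells U 0. map f x = ys} = (if ys = [] then {[]} else {})"
    by (auto simp: list_cells_def)
  then show ?thesis by (simp add: push_def)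
qed

lemma push_pair_list:
  assumes "finite U"
  shows "push (U \<times> list_cells U k) (\<lambda>(x, xs). (f x, map f xs)) c (y, ys) =
    push (list_cells U (Suc k)) (map f) (\<lambda>zs. case zs of [] \<Rightarrow> 0 | z # zs \<Rightarrow> c (z, zs)) (y # ys)"
proof -
  have "{z \<in> U \<times> list_cells U k. (case z of (x, xs) \<Rightarrow> (f x, map f xs)) = (y, ys)} =
      (SIGMA x:{x\<in>U. f x = y}. {zs \<in> list_cells U k. map f zs = ys})"
    by auto
  then show ?thesis
    unfolding push_list_Cons[OF assms] using assms
    by (simp add: push_def sum.Sigma finite_list_cells case_prod_unfold)
qed

text \<open>The alternating sum over j of g (ys ! j) applied to ys with its j-th entry removed.\<close>

primrec wsum :: "'b list \<Rightarrow> ('b \<Rightarrow> 'b list \<Rightarrow> rat) \<Rightarrow> rat" where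
  "wsum [] g = 0"
| "wsum (y # ys) g = g y ys - wsum ys (\<lambda>x zs. g x (y # zs))"

text \<open>Adjacent transpositions generate all permutations and suit induction on lists. Over the
  rationals a skew function vanishes on tuples with a repeated entry, so skew functions on k-tuples
  of cells model the k-th exterior power.\<close>

definition skew :: "('b list \<Rightarrow> rat) \<Rightarrow> bool" where
  "skew c \<longleftrightarrow> (\<forall>us a b vs. c (us @ a # b # vs) = - c (us @ b # a # vs))"

text \<open>On k-tuples this is the unnormalised antisymmetrizer, the signed sum over all
  reorderings, expanded along the entry that is put first.\<close>

primrec alt :: "nat \<Rightarrow> ('b list \<Rightarrow> rat) \<Rightarrow> 'b list \<Rightarrow> rat" where
  "alt 0 c = c"
| "alt (Suc k) c = (\<lambda>ys. wsum ys (\<lambda>x. alt k (\<lambda>zs. c (x # zs))))"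

lemma wsum_add: "wsum ys (\<lambda>x zs. g x zs + h x zs) = wsum ys g + wsum ys h"
  by (induction ys arbitrary: g h) auto

lemma wsum_minus: "wsum ys (\<lambda>x zs. - g x zs) = - wsum ys g"
  by (induction ys arbitrary: g) auto

lemma wsum_zero: "wsum ys (\<lambda>x zs. 0) = 0"
  by (induction ys) auto

lemma wsum_mult: "wsum ys (\<lambda>x zs. a * g x zs) = a * wsum ys g"
  by (induction ys arbitrary: g) (auto simp: algebra_simps)

lemma wsum_sum: "wsum ys (\<lambda>x zs. \<Sum>i\<in>A. g i x zs) = (\<Sum>i\<in>A. wsum ys (g i))"
  by (induction A rule: infinite_finite_induct) (auto simp: wsum_zero wsum_add)

lemma wsum_nonzero:
  "wsum ys g \<noteq> 0 \<Longrightarrow> \<exists>us y vs. ys = us @ y # vs \<and> g y (us @ vs) \<noteq> 0"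
proof (induction ys arbitrary: g)
  case (Cons y ys)
  show ?case
  proof (cases "g y ys = 0")
    case True
    then have "wsum ys (\<lambda>x zs. g x (y # zs)) \<noteq> 0" using Cons.prems by simp
    from Cons.IH[OF this] obtain us z vs where "ys = us @ z # vs" "g z (y # us @ vs) \<noteq> 0" by blast
    then show ?thesis by (intro exI[of _ "y # us"] exI[of _ z] exI[of _ vs]) simp
  next
    case False
    then show ?thesis by (intro exI[of _ "[]"] exI[of _ y] exI[of _ ys]) simp
  qed
qed simp

lemma skew_Cons: "skew c \<Longrightarrow> skew (\<lambda>zs. c (x # zs))"
  unfolding skew_def by (metis append_Cons)

lemma skew_swap: "skew c \<Longrightarrow> c (a # b # vs) = - c (b # a # vs)"
  unfolding skew_def by (metis append_Nil)

text \<open>When a and b are swapped, the terms that extract another entry change sign because g is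
  skew; the terms that extract a and b trade places, and their signs are opposite since the
  positions differ by one.\<close>

lemma skew_wsum:
  assumes "\<And>x. skew (g x)"
  shows "skew (\<lambda>ys. wsum ys g)"
proof -
  have "wsum (us @ a # b # vs) g = - wsum (us @ b # a # vs) g" if "\<And>x. skew (g x)" for us a b vs and g :: "'a \<Rightarrow> 'a list \<Rightarrow> rat"
    using that
  proof (induction us arbitrary: g)
    case Nil
    have "g x (a # b # zs) = - g x (b # a # zs)" for x zs using Nil by (intro skew_swap)
    then show ?case by (simp add: wsum_minus)
  next
    case (Cons u us)
    have "g u (us @ a # b # vs) = - g u (us @ b # a # vs)" using Cons.prems[of u] unfolding skew_def by blast
    moreover have "wsum (us @ a # b # vs) (\<lambda>x zs. g x (u # zs)) = - wsum (us @ b # a # vs) (\<lambda>x zs. g x (u # zs))"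
      using Cons.prems by (intro Cons.IH skew_Cons)
    ultimately show ?case by simp
  qed
  from this[OF assms] show ?thesis unfolding skew_def by (intro allI)
qed

text \<open>Moving the extracted entry back to its place costs exactly the sign with which it was
  extracted, so all terms equal \<open>c ys\<close>.\<close>

lemma wsum_skew:
  assumes "skew c"
  shows "wsum ys (\<lambda>x zs. c (x # zs)) = of_nat (length ys) * c ys"
  using assms
proof (induction ys arbitrary: c)
  case (Cons y ys)
  have "(\<lambda>x zs. c (x # y # zs)) = (\<lambda>x zs. - c (y # x # zs))"
    by (intro ext skew_swap Cons.prems)
  then have "wsum ys (\<lambda>x zs. c (x # y # zs)) = wsum ys (\<lambda>x zs. - c (y # x # zs))"
    by simp
  also have "\<dots> = - (of_nat (length ys) * c (y # ys))"
    using Cons.IH[OF skew_Cons[OF Cons.prems]] by (simp add: wsum_minus)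
  finally show ?case by (simp add: algebra_simps)
qed simp

text \<open>Level by level \<open>wsum_skew\<close> contributes the length of the tuple, and these
  lengths multiply to k!. After division by k! the antisymmetrizer is a projection onto the skew
  functions.\<close>

lemma alt_skew:
  assumes "skew c" "\<And>ys. c ys \<noteq> 0 \<Longrightarrow> length ys = k"
  shows "alt k c = (\<lambda>ys. fact k * c ys)"
  using assms
proof (induction k arbitrary: c)
  case (Suc k)
  have "alt k (\<lambda>zs. c (x # zs)) = (\<lambda>zs. fact k * c (x # zs))" for x
    using Suc.prems(2) by (intro Suc.IH skew_Cons Suc.prems) fastforce
  then have "alt (Suc k) c ys = fact k * (of_nat (length ys) * c ys)" for ys
    using wsum_skew[OF Suc.prems(1)] by (simp add: wsum_mult)
  moreover have "length ys = Suc k" if "c ys \<noteq> 0" for ys using Suc.prems that by blast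
  ultimately have "alt (Suc k) c ys = fact (Suc k) * c ys" for ys
    by (cases "c ys = 0") (auto simp: algebra_simps)
  then show ?case by blast
qed simp

lemma skew_alt:
  assumes "\<And>ys. c ys \<noteq> 0 \<Longrightarrow> length ys = k"
  shows "skew (alt k c)"
  using assms
proof (induction k arbitrary: c)
  case 0
  then have "c (us @ a # vs) = 0" for us a vs by (metis Nil_is_append_conv length_0_conv list.distinct(1))
  then show ?case by (simp add: skew_def)
next
  case (Suc k)
  show ?case unfolding alt.simps
  proof (intro skew_wsum Suc.IH)
    fix x ys assume "c (x # ys) \<noteq> 0"
    from Suc.prems[OF this] show "length ys = k" by simp
  qed
qed

lemma alt_zero: "alt k (\<lambda>ys. 0) = (\<lambda>ys. 0)"
  by (induction k) (auto simp: wsum_zero)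

lemma alt_add: "alt k (\<lambda>ys. c ys + c' ys) = (\<lambda>ys. alt k c ys + alt k c' ys)"
  by (induction k arbitrary: c c') (auto simp: wsum_add)

lemma alt_sum: "alt k (\<lambda>ys. \<Sum>i\<in>A. c i ys) = (\<lambda>ys. \<Sum>i\<in>A. alt k (c i) ys)"
  by (induction A rule: infinite_finite_induct) (auto simp: alt_zero alt_add)

lemma alt_fsupp:
  assumes "c \<in> fsupp (list_cells E k)"
  shows "alt k c \<in> fsupp (list_cells E k)"
  using assms
proof (induction k arbitrary: c)
  case (Suc k)
  show ?case unfolding fsupp_def
  proof (intro CollectI allI impI)
    fix ys assume "alt (Suc k) c ys \<noteq> 0"
    then have "wsum ys (\<lambda>x. alt k (\<lambda>zs. c (x # zs))) \<noteq> 0" by simp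
    from wsum_nonzero[OF this] obtain us y vs where ys: "ys = us @ y # vs" "alt k (\<lambda>zs. c (y # zs)) (us @ vs) \<noteq> 0" by blast
    have cy: "(\<lambda>zs. c (y # zs)) \<in> fsupp (list_cells E k)"
      using Suc.prems by (force simp: fsupp_def list_cells_def)
    from Suc.IH[OF cy] ys(2) have usvs: "us @ vs \<in> list_cells E k" unfolding fsupp_def by blast
    have "y \<in> E"
    proof (rule ccontr)
      assume "y \<notin> E"
      then have "(\<lambda>zs. c (y # zs)) = (\<lambda>zs. 0)" using Suc.prems by (fastforce simp: fsupp_def list_cells_def)
      then show False using ys(2) by (simp add: alt_zero)
    qed
    then show "ys \<in> list_cells E (Suc k)" using usvs ys(1) by (auto simp: list_cells_def)
  qed
qed simp

text \<open>The map f may identify cells, so extracting y after the entrywise pushforward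
  corresponds to extracting any x over y before it. The induction peels off the first entry and
  exchanges the two sums over preimages.\<close>

lemma push_wsum:
  assumes U: "finite U"
  shows "push (list_cells U (Suc k)) (map f) (\<lambda>ys. wsum ys g) ys =
    wsum ys (\<lambda>y. \<lambda>zs. \<Sum>x\<in>{x\<in>U. f x = y}. push (list_cells U k) (map f) (g x) zs)"
proof (induction k arbitrary: ys g)
  case 0
  show ?case
  proof (cases ys)
    case (Cons y ys')
    show ?thesis
      by (cases ys') (simp_all add: Cons push_list_Cons[OF U] wsum_zero push_list_0)
  qed (simp add: push_list_Nil)
next
  case (Suc k)
  show ?case
  proof (cases ys)
    case (Cons y ys')
    have "push (list_cells U (Suc (Suc k))) (map f) (\<lambda>ys. wsum ys g) ys =
       (\<Sum>x\<in>{x\<in>U. f x = y}. push (list_cells U (Suc k)) (map f) (\<lambda>zs. g x zs - wsum zs (\<lambda>x' ws. g x' (x # ws))) ys')"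
      by (simp add: Cons push_list_Cons[OF U])
    also have "\<dots> = (\<Sum>x\<in>{x\<in>U. f x = y}. push (list_cells U (Suc k)) (map f) (g x) ys')
        - (\<Sum>x\<in>{x\<in>U. f x = y}. push (list_cells U (Suc k)) (map f) (\<lambda>zs. wsum zs (\<lambda>x' ws. g x' (x # ws))) ys')"
      unfolding sum_subtractf[symmetric] by (simp add: push_def sum_subtractf)
    also have "(\<Sum>x\<in>{x\<in>U. f x = y}. push (list_cells U (Suc k)) (map f) (\<lambda>zs. wsum zs (\<lambda>x' ws. g x' (x # ws))) ys')
        = wsum ys' (\<lambda>y' zs. \<Sum>x\<in>{x\<in>U. f x = y}. \<Sum>x'\<in>{x'\<in>U. f x' = y'}. push (list_cells U k) (map f) (\<lambda>ws. g x' (x # ws)) zs)"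
      by (simp add: Suc.IH wsum_sum)
    also have "\<dots> = wsum ys' (\<lambda>y' zs. \<Sum>x'\<in>{x'\<in>U. f x' = y'}. push (list_cells U (Suc k)) (map f) (g x') (y # zs))"
      unfolding push_list_Cons[OF U] by (subst sum.swap) (rule refl)
    finally show ?thesis by (simp add: Cons)
  qed (simp add: push_list_Nil)
qed

text \<open>Naturality of the antisymmetrizer: deletions of colours, which act entrywise, commute
  with it.\<close>

lemma push_alt:
  assumes U: "finite U"
  shows "push (list_cells U k) (map f) (alt k c) = alt k (push (list_cells U k) (map f) c)"
proof (induction k arbitrary: c)
  case (Suc k)
  show ?case
    by (rule ext) (simp add: push_wsum[OF U] Suc.IH push_list_Cons[OF U] alt_sum)
qed simp

text \<open>Adjacent swaps bring the equal entries together; swapping these gives c = - c, hence 0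
  over the rationals.\<close>

lemma skew_repeat: "skew c \<Longrightarrow> c (us @ a # ws @ a # vs) = 0"
proof (induction ws arbitrary: us)
  case Nil
  then have "c (us @ a # a # vs) = - c (us @ a # a # vs)" unfolding skew_def by blast
  then show ?case by simp
next
  case (Cons b ws)
  have "c (us @ a # b # ws @ a # vs) = - c (us @ b # a # ws @ a # vs)" using Cons.prems unfolding skew_def by blast
  also have "\<dots> = 0" using Cons.IH[of "us @ [b]"] Cons.prems by simp
  finally show ?case by simp
qed

lemma skew_not_distinct:
  assumes "skew c" "\<not> distinct xs"
  shows "c xs = 0"
proof -
  obtain us a ws vs where "xs = us @ [a] @ ws @ [a] @ vs" using not_distinct_decomp[OF assms(2)] by blast
  then show ?thesis using skew_repeat[OF assms(1), of us a ws vs] by simp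
qed

section \<open>The exterior power resolution\<close>

text \<open>Fibres of the entrywise map are not permuted explicitly. By naturality k! times the
  pushforward is the antisymmetrizer of the pushforward, thus skew, and k! can be cancelled.\<close>

lemma skew_push:
  assumes "finite U" "skew c" "\<And>ys. c ys \<noteq> 0 \<Longrightarrow> length ys = k"
  shows "skew (push (list_cells U k) (map f) c)"
proof -
  have len: "length ys = k" if "push (list_cells U k) (map f) c ys \<noteq> 0" for ys
  proof -
    have "c \<in> fsupp {ys. length ys = k}" using assms(3) by (simp add: fsupp_def)
    then have "push (list_cells U k) (map f) c \<in> fsupp {ys. length ys = k}" by (rule push_fsupp) simp
    then show ?thesis using that by (simp add: fsupp_def)
  qed
  have "alt k c = (\<lambda>ys. fact k * c ys)" using assms(2,3) by (intro alt_skew)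
  then have "alt k (push (list_cells U k) (map f) c) = push (list_cells U k) (map f) (\<lambda>ys. fact k * c ys)"
    by (simp only: push_alt[OF assms(1), symmetric])
  also have "\<dots> = (\<lambda>ys. fact k * push (list_cells U k) (map f) c ys)"
    by (simp add: push_def fun_eq_iff sum_distrib_left)
  finally have "skew (\<lambda>ys. fact k * push (list_cells U k) (map f) c ys)"
    using skew_alt[OF len] by metis
  then have "fact k * push (list_cells U k) (map f) c (us @ a # b # vs) =
      - (fact k * push (list_cells U k) (map f) c (us @ b # a # vs))" for us a b vs
    unfolding skew_def by blast
  then show ?thesis unfolding skew_def by (metis fact_nonzero mult_cancel_left mult_minus_right)
qed

lemma skew_minus: "skew c \<Longrightarrow> skew (- c)"
  unfolding skew_def by (metis fun_Compl_def)

lemma skew_add: "skew c \<Longrightarrow> skew c' \<Longrightarrow> skew (c + c')"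
  unfolding skew_def by (metis (no_types, lifting) minus_add_distrib plus_fun_apply)

lemma skew_zero: "skew 0"
  by (simp add: skew_def)

context cells
begin

lemma subcells:
  assumes "S \<subseteq> I"
  shows "cells S U E del"
proof
  show "finite S" using assms finI finite_subset by blast
  show "finite U" by (rule finU)
  fix \<tau> assume "\<tau> \<subseteq> S"
  then have \<tau>: "\<tau> \<subseteq> I" using assms by auto
  show "E \<tau> \<subseteq> U" using \<tau> by (rule E_subset)
  show "del i x \<in> E \<tau>" if "i \<in> S" "i \<notin> \<tau>" "x \<in> E (insert i \<tau>)" for i x
    using that assms by (intro del_mem[OF \<tau>]) auto
  show "del i (del j x) = del j (del i x)"
    if "i \<in> S" "j \<in> S" "i \<notin> \<tau>" "j \<notin> \<tau>" "i \<noteq> j" "x \<in> E (insert i (insert j \<tau>))" for i j x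
    using that assms by (intro del_commute[OF \<tau>]) auto
qed

text \<open>The empty fibre has no tuples, not even the empty one: so the case k = 0 is the functor of the
  image complex.\<close>

definition tuples :: "nat \<Rightarrow> 'i set \<Rightarrow> 'b list set" where
  "tuples k \<tau> = (if E \<tau> = {} then {} else list_cells (E \<tau>) k)"

abbreviation "tR k i \<equiv> push (list_cells U k) (map (del i))"

lemma tuples_iff: "xs \<in> tuples k \<tau> \<longleftrightarrow> E \<tau> \<noteq> {} \<and> set xs \<subseteq> E \<tau> \<and> length xs = k"
  by (simp add: tuples_def list_cells_def)

lemma cells_tuples: "cells I (list_cells U k) (tuples k) (\<lambda>i. map (del i))"
proof
  show "finite I" "finite (list_cells U k)" using finI finU finite_list_cells by auto
  fix \<tau> assume \<tau>: "\<tau> \<subseteq> I"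
  show "tuples k \<tau> \<subseteq> list_cells U k" using E_subset[OF \<tau>] by (simp add: tuples_def list_cells_def) blast
  show "map (del i) x \<in> tuples k \<tau>" if "i \<in> I" "i \<notin> \<tau>" "x \<in> tuples k (insert i \<tau>)" for i x
    using that del_mem[OF \<tau>] by (fastforce simp: tuples_iff)
  show "map (del i) (map (del j) x) = map (del j) (map (del i) x)"
    if "i \<in> I" "j \<in> I" "i \<notin> \<tau>" "j \<notin> \<tau>" "i \<noteq> j" "x \<in> tuples k (insert i (insert j \<tau>))" for i j x
    using that del_commute[OF \<tau> that(1-5)] by (auto simp: tuples_iff)
qed

lemmas cube_tuples = cells.cube[OF cells_tuples]

text \<open>A tuple is a head cell and a tail over the same colours, so the tensor power is a
  pointwise product of F with the previous power; each factor adds d to the bound. The base case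
  identifies cells with tuples of length one.\<close>

lemma exact_at_tuples:
  assumes inj: "inj_on \<rho> I" and ex: "\<And>S s. S \<subseteq> I \<Longrightarrow> d < s \<Longrightarrow> exact_at S \<rho> cF cR s"
    and "S \<subseteq> I" "Suc k * d < s"
  shows "exact_at S \<rho> (\<lambda>\<tau>. fsupp (tuples (Suc k) \<tau>)) (tR (Suc k)) s"
  using assms(3,4)
proof (induction k arbitrary: S s)
  case 0
  \<comment> \<open>The maps f and g translate between cells and one-element tuples; f is 0 on lists
    of any other length.\<close>
  define f :: "('b \<Rightarrow> rat) \<Rightarrow> 'b list \<Rightarrow> rat" where "f c ys = (case ys of [x] \<Rightarrow> c x | _ \<Rightarrow> 0)" for c ys
  define g :: "('b list \<Rightarrow> rat) \<Rightarrow> 'b \<Rightarrow> rat" where "g c = (\<lambda>x. c [x])" for c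
  have push1: "push (list_cells U 1) (map h) c [y] = push U h (g c) y" for h :: "'b \<Rightarrow> 'b" and c y
    using push_list_Cons[OF finU, of 0 h c y "[]"] unfolding push_list_0 by (simp add: push_def g_def)
  have push1': "push (list_cells U 1) (map h) c ys = 0" if "length ys \<noteq> 1" for h :: "'b \<Rightarrow> 'b" and c ys
  proof -
    have "{x \<in> list_cells U 1. map h x = ys} = {}" using that by (auto simp: list_cells_def)
    then show ?thesis unfolding push_def by (simp only: sum.empty)
  qed
  have gf: "g (f c) = c" for c by (simp add: f_def g_def fun_eq_iff)
  have f_other: "f c ys = 0" if "length ys \<noteq> 1" for c ys
    using that by (auto simp: f_def split: list.splits)
  have f1: "f c [x] = c x" for c x by (simp add: f_def)
  have ext1: "u = v" if "\<And>y. u [y] = v [y]" "\<And>ys. length ys \<noteq> 1 \<Longrightarrow> u ys = v ys" for u v :: "'b list \<Rightarrow> rat"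
  proof
    fix ys show "u ys = v ys"
    proof (cases "length ys = 1")
      case True
      then obtain y where "ys = [y]" by (auto simp: length_Suc_conv)
      then show ?thesis using that(1) by simp
    qed (rule that(2))
  qed
  have "cube_map S cF cR (\<lambda>\<tau>. fsupp (tuples 1 \<tau>)) (tR 1) f"
    unfolding cube_map_def
  proof (intro conjI allI impI ballI)
    show "additive f" by (auto simp: additive_def f_def fun_eq_iff split: list.splits)
    show "f ` cF \<tau> \<subseteq> fsupp (tuples 1 \<tau>)" for \<tau>
      by (auto simp: fsupp_def f_def tuples_iff split: list.splits)
    show "f (cR i x) = tR 1 i (f x)" for i x
      by (rule ext1) (simp_all add: f1 push1[unfolded One_nat_def] push1'[unfolded One_nat_def] gf f_other)
  qed
  moreover have "cube_map S (\<lambda>\<tau>. fsupp (tuples 1 \<tau>)) (tR 1) cF cR g"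
    unfolding cube_map_def
  proof (intro conjI allI impI ballI)
    show "additive g" by (auto simp: additive_def g_def)
    show "g ` fsupp (tuples 1 \<tau>) \<subseteq> cF \<tau>" for \<tau>
      by (auto simp: fsupp_def g_def tuples_iff)
    show "g (tR 1 i x) = cR i (g x)" for i x
      unfolding g_def[of "tR 1 i x"] push1 by (rule refl)
  qed
  moreover have "f (g x) = x" if "x \<in> fsupp (tuples 1 \<tau>)" for \<tau> x
    by (rule ext1) (use that f_other in \<open>auto simp: f1 g_def fsupp_def tuples_iff\<close>)
  ultimately have "exact_at S \<rho> (\<lambda>\<tau>. fsupp (tuples 1 \<tau>)) (tR 1) s"
    using 0 ex by (intro exact_at_retract[OF cube.subcube[OF cube] cube.subcube[OF cube_tuples]]) auto
  then show ?case by simp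
next
  case (Suc k)
  let ?k = "Suc k"
  interpret pr: cells_pair S U E del "list_cells U ?k" "tuples ?k" "\<lambda>i. map (del i)" \<rho>
    using Suc.prems by (intro cells_pair.intro cells_pair_axioms.intro subcells cells.subcells[OF cells_tuples] inj_on_subset[OF inj])
  let ?PF = "\<lambda>\<tau>. fsupp (E \<tau> \<times> tuples ?k \<tau>)"
  let ?PR = "\<lambda>i. push (U \<times> list_cells U ?k) (\<lambda>(x, y). (del i x, map (del i) y))"
  have ex_pair: "exact_at S \<rho> ?PF ?PR s"
  proof (rule pr.exact_at_product)
    show "exact_at S' \<rho> cF cR t" if "S' \<subseteq> S" "d < t" for S' t using that Suc.prems by (intro ex) auto
    show "exact_at S' \<rho> (\<lambda>\<tau>. fsupp (tuples ?k \<tau>)) (tR ?k) t" if "S' \<subseteq> S" "?k * d < t" for S' t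
      using that Suc.prems by (intro Suc.IH) auto
    show "d + ?k * d < s" using Suc.prems by simp
  qed
  have cube_pair: "cube S ?PF ?PR"
    using cells.cube[OF pr.cells_pcell[of "{}" "{}"]] by (simp add: pr.pcell_def pr.pdel_def)
  \<comment> \<open>Here f and g translate between pairs of head and tail and nonempty tuples; f is
    0 on the empty list.\<close>
  define f :: "('b \<times> 'b list \<Rightarrow> rat) \<Rightarrow> 'b list \<Rightarrow> rat" where
    "f c = (\<lambda>zs. case zs of [] \<Rightarrow> 0 | z # zs \<Rightarrow> c (z, zs))" for c
  define g :: "('b list \<Rightarrow> rat) \<Rightarrow> 'b \<times> 'b list \<Rightarrow> rat" where "g c = (\<lambda>(x, xs). c (x # xs))" for c
  have push_f: "push (U \<times> list_cells U ?k) (\<lambda>(x, xs). (h x, map h xs)) c (y, ys) =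
      push (list_cells U (Suc ?k)) (map h) (f c) (y # ys)" for h c y ys
    unfolding f_def by (rule push_pair_list[OF finU])
  have fg: "f (g x) = x" if "x \<in> fsupp (tuples (Suc ?k) \<tau>)" for \<tau> x
  proof
    fix zs show "f (g x) zs = x zs"
      using that by (cases zs) (auto simp: f_def g_def fsupp_def tuples_iff)
  qed
  have "cube_map S ?PF ?PR (\<lambda>\<tau>. fsupp (tuples (Suc ?k) \<tau>)) (tR (Suc ?k)) f"
    unfolding cube_map_def
  proof (intro conjI allI impI ballI)
    show "additive f" by (auto simp: additive_def f_def fun_eq_iff split: list.splits)
    show "f ` ?PF \<tau> \<subseteq> fsupp (tuples (Suc ?k) \<tau>)" for \<tau>
      by (auto simp: fsupp_def f_def tuples_iff split: list.splits) blast
    show "f (?PR i x) = tR (Suc ?k) i (f x)" for i x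
    proof
      fix zs show "f (?PR i x) zs = tR (Suc ?k) i (f x) zs"
      proof (cases zs)
        case Nil
        then show ?thesis by (simp add: push_list_Nil) (simp add: f_def)
      next
        case (Cons z zs')
        then show ?thesis using push_f[of "del i" x z zs'] by (simp add: f_def[of "?PR i x"])
      qed
    qed
  qed
  moreover have "cube_map S (\<lambda>\<tau>. fsupp (tuples (Suc ?k) \<tau>)) (tR (Suc ?k)) ?PF ?PR g"
    unfolding cube_map_def
  proof (intro conjI allI impI ballI)
    show "additive g" by (auto simp: additive_def g_def)
    show "g ` fsupp (tuples (Suc ?k) \<tau>) \<subseteq> ?PF \<tau>" for \<tau>
      by (auto simp: fsupp_def g_def tuples_iff) force
    fix \<tau> i x assume x: "x \<in> fsupp (tuples (Suc ?k) (insert i \<tau>))"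
    show "g (tR (Suc ?k) i x) = ?PR i (g x)"
    proof
      fix z :: "'b \<times> 'b list"
      obtain y ys where z: "z = (y, ys)" by (cases z)
      have "g (tR (Suc ?k) i x) z = tR (Suc ?k) i (f (g x)) (y # ys)"
        using fg[OF x] by (simp add: g_def[of "tR (Suc ?k) i x"] z)
      then show "g (tR (Suc ?k) i x) z = ?PR i (g x) z"
        using push_f[of "del i" "g x" y ys] z by simp
    qed
  qed
  ultimately show ?case
    using Suc.prems fg ex_pair
    by (intro exact_at_retract[OF cube_pair cube.subcube[OF cube_tuples]]) auto
qed

section \<open>Exterior powers and the Koszul complex\<close>

definition skew_tuples :: "nat \<Rightarrow> 'i set \<Rightarrow> ('b list \<Rightarrow> rat) set" where
  "skew_tuples k \<tau> = {c \<in> fsupp (tuples k \<tau>). skew c}"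

lemma skew_tuples_length: "c \<in> fsupp (tuples k \<tau>) \<Longrightarrow> c ys \<noteq> 0 \<Longrightarrow> length ys = k"
  unfolding fsupp_def using tuples_iff by blast

lemma cube_skew_tuples: "cube I (skew_tuples k) (tR k)"
proof (rule cube.intro)
  interpret T: cube I "\<lambda>\<tau>. fsupp (tuples k \<tau>)" "tR k" by (rule cube_tuples)
  show "finite I" by (rule finI)
  show "additive (tR k i)" for i by (rule push_additive)
  fix \<tau> assume \<tau>: "\<tau> \<subseteq> I"
  show "0 \<in> skew_tuples k \<tau>" by (simp add: skew_tuples_def skew_zero)
  show "x + y \<in> skew_tuples k \<tau>" if "x \<in> skew_tuples k \<tau>" "y \<in> skew_tuples k \<tau>" for x y
    using that by (simp add: skew_tuples_def fsupp_add skew_add)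
  show "- x \<in> skew_tuples k \<tau>" if "x \<in> skew_tuples k \<tau>" for x
    using that by (simp add: skew_tuples_def fsupp_minus skew_minus)
  show "tR k i x \<in> skew_tuples k \<tau>" if "i \<in> I" "i \<notin> \<tau>" "x \<in> skew_tuples k (insert i \<tau>)" for i x
    using that T.R_mem[OF \<tau> that(1,2), of x] skew_push[OF finU, of x k "del i"]
      skew_tuples_length[of x k "insert i \<tau>"] by (simp add: skew_tuples_def)
  show "tR k i (tR k j x) = tR k j (tR k i x)"
    if "i \<in> I" "j \<in> I" "i \<notin> \<tau>" "j \<notin> \<tau>" "i \<noteq> j" "x \<in> skew_tuples k (insert i (insert j \<tau>))" for i j x
    using that T.R_commute[OF \<tau> that(1-5), of x] by (simp add: skew_tuples_def)
qed

text \<open>The normalised antisymmetrizer is natural in the colours and retracts the tensor power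
  onto the exterior power, so exactness passes to the summand.\<close>

lemma exact_at_skew_tuples:
  assumes S: "S \<subseteq> I" and ex: "exact_at S \<rho> (\<lambda>\<tau>. fsupp (tuples k \<tau>)) (tR k) s"
  shows "exact_at S \<rho> (skew_tuples k) (tR k) s"
proof (rule exact_at_retract[OF cube.subcube[OF cube_tuples S] cube.subcube[OF cube_skew_tuples S]])
  let ?f = "\<lambda>c ys. alt k c ys / (fact k :: rat)"
  show "cube_map S (\<lambda>\<tau>. fsupp (tuples k \<tau>)) (tR k) (skew_tuples k) (tR k) ?f"
    unfolding cube_map_def
  proof (intro conjI allI impI ballI)
    show "additive ?f"
      by (simp add: additive_def plus_fun_def alt_add add_divide_distrib)
    show "?f ` fsupp (tuples k \<tau>) \<subseteq> skew_tuples k \<tau>" for \<tau>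
    proof
      fix b assume "b \<in> ?f ` fsupp (tuples k \<tau>)"
      then obtain c where c: "c \<in> fsupp (tuples k \<tau>)" and b: "b = ?f c" by auto
      have "skew (alt k c)" using skew_tuples_length[OF c] by (intro skew_alt)
      then have "skew b" unfolding b skew_def by (metis minus_divide_left)
      moreover have "alt k c \<in> fsupp (tuples k \<tau>)"
      \<comment> \<open>Over an empty fibre \<open>tuples k\<close> is empty even for k = 0, whereas
        \<open>list_cells\<close> would contain the empty tuple.\<close>
      proof (cases "E \<tau> = {}")
        case True
        then have "c = (\<lambda>ys. 0)" using c by (auto simp: fsupp_def tuples_def)
        then show ?thesis by (simp add: alt_zero fsupp_def)
      next
        case False
        then show ?thesis using alt_fsupp c by (simp add: tuples_def)
      qed
      then have "b \<in> fsupp (tuples k \<tau>)" by (auto simp: b fsupp_def)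
      ultimately show "b \<in> skew_tuples k \<tau>" by (simp add: skew_tuples_def)
    qed
    show "?f (tR k i x) = tR k i (?f x)" for i x
      unfolding push_alt[OF finU, symmetric] by (simp add: push_def fun_eq_iff sum_divide_distrib)
  qed
  show "cube_map S (skew_tuples k) (tR k) (\<lambda>\<tau>. fsupp (tuples k \<tau>)) (tR k) (\<lambda>x. x)"
    by (auto simp: cube_map_def additive_def skew_tuples_def)
  show "?f x = x" if "x \<in> skew_tuples k \<tau>" for \<tau> x
  proof -
    have "skew x" "x \<in> fsupp (tuples k \<tau>)" using that by (auto simp: skew_tuples_def)
    then have "alt k x = (\<lambda>ys. fact k * x ys)" using skew_tuples_length by (intro alt_skew) auto
    then show ?thesis by simp
  qed
qed (rule ex)

text \<open>Interior product with the augmentation, the functional with value 1 on every cell: the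
  differential of a Koszul complex.\<close>

definition contract :: "('b list \<Rightarrow> rat) \<Rightarrow> 'b list \<Rightarrow> rat" where
  "contract c ys = (\<Sum>x\<in>U. c (x # ys))"

lemma contract_additive: "additive contract"
  by (auto simp: additive_def contract_def fun_eq_iff sum.distrib)

lemma contract_fsupp:
  assumes "c \<in> fsupp (tuples (Suc k) \<tau>)"
  shows "contract c \<in> fsupp (tuples k \<tau>)"
  unfolding fsupp_def
proof (intro CollectI allI impI)
  fix ys assume "contract c ys \<noteq> 0"
  then obtain x where "c (x # ys) \<noteq> 0" unfolding contract_def by (meson sum.neutral)
  then have "x # ys \<in> tuples (Suc k) \<tau>" using assms unfolding fsupp_def by blast
  then show "ys \<in> tuples k \<tau>" by (simp add: tuples_iff)
qed

lemma contract_skew: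
  assumes "skew c"
  shows "skew (contract c)"
proof -
  have "c (x # us @ a # b # vs) = - c (x # us @ b # a # vs)" for x us a b vs
    using skew_Cons[OF assms, of x] unfolding skew_def by blast
  then have "contract c (us @ a # b # vs) = - contract c (us @ b # a # vs)" for us a b vs
    unfolding contract_def sum_negf[symmetric] by (intro sum.cong refl)
  then show ?thesis unfolding skew_def by blast
qed

text \<open>Exchanging the two summation variables changes the sign of the double sum.\<close>

lemma contract_contract:
  assumes "skew c"
  shows "contract (contract c) = 0"
proof
  fix ys
  define t where "t = (\<Sum>x\<in>U. \<Sum>y\<in>U. c (y # x # ys))"
  have "t = (\<Sum>y\<in>U. \<Sum>x\<in>U. c (y # x # ys))" unfolding t_def by (rule sum.swap)
  also have "\<dots> = (\<Sum>y\<in>U. \<Sum>x\<in>U. - c (x # y # ys))"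
    by (intro sum.cong refl skew_swap assms)
  also have "\<dots> = - t" by (simp add: t_def sum_negf)
  finally have "t = 0" by simp
  then show "contract (contract c) ys = 0 ys" by (simp add: contract_def t_def)
qed

text \<open>A deletion sends each cell over \<open>insert i \<tau>\<close> to exactly one cell over
  \<tau>, so it preserves the augmentation. The support hypothesis puts the image cell into U, the
  range of the summation.\<close>

lemma contract_push:
  assumes c: "c \<in> fsupp (tuples (Suc k) (insert i \<tau>))" and "\<tau> \<subseteq> I" "i \<in> I" "i \<notin> \<tau>"
  shows "contract (tR (Suc k) i c) = tR k i (contract c)"
proof
  fix ys
  have "contract (tR (Suc k) i c) ys = (\<Sum>y\<in>U. \<Sum>x\<in>U. if del i x = y then tR k i (\<lambda>zs. c (x # zs)) ys else 0)"
    unfolding contract_def push_list_Cons[OF finU] using finU by (simp add: sum.inter_filter)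
  also have "\<dots> = (\<Sum>x\<in>U. \<Sum>y\<in>U. if del i x = y then tR k i (\<lambda>zs. c (x # zs)) ys else 0)"
    by (rule sum.swap)
  also have "\<dots> = (\<Sum>x\<in>U. tR k i (\<lambda>zs. c (x # zs)) ys)"
  proof (intro sum.cong refl)
    fix x assume "x \<in> U"
    show "(\<Sum>y\<in>U. if del i x = y then tR k i (\<lambda>zs. c (x # zs)) ys else 0) = tR k i (\<lambda>zs. c (x # zs)) ys"
    proof (cases "x \<in> E (insert i \<tau>)")
      case True
      then have "del i x \<in> U" using del_mem[OF assms(2-4)] E_subset[OF assms(2)] by blast
      then show ?thesis using finU by simp
    next
      case False
      then have "x # zs \<notin> tuples (Suc k) (insert i \<tau>)" for zs by (simp add: tuples_iff)
      then have "c (x # zs) = 0" for zs using c unfolding fsupp_def by blast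
      then have "tR k i (\<lambda>zs. c (x # zs)) ys = 0" by (simp add: push_def)
      then show ?thesis by (simp only: if_cancel sum.neutral_const)
    qed
  qed
  also have "\<dots> = tR k i (contract c) ys"
    unfolding push_def contract_def by (rule sum.swap)
  finally show "contract (tR (Suc k) i c) ys = tR k i (contract c) ys" .
qed

text \<open>The syzygies of the resolution. For k = 0 this is the functor of the image complex, the
  object being resolved.\<close>

definition contract_cycles :: "nat \<Rightarrow> 'i set \<Rightarrow> ('b list \<Rightarrow> rat) set" where
  "contract_cycles k \<tau> = {c \<in> skew_tuples k \<tau>. contract c = 0}"

lemma contract_0:
  assumes "c \<in> fsupp (tuples 0 \<tau>)"
  shows "contract c = 0"
proof
  fix ys
  have "x # ys \<notin> tuples 0 \<tau>" for x by (simp add: tuples_iff)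
  then have "c (x # ys) = 0" for x using assms unfolding fsupp_def by blast
  then show "contract c ys = 0 ys" by (simp add: contract_def)
qed

lemma contract_cycles_0: "contract_cycles 0 \<tau> = fsupp (tuples 0 \<tau>)"
proof -
  have "skew c" if "c \<in> fsupp (tuples 0 \<tau>)" for c
  proof -
    have "c (us @ a # vs) = 0" for us a vs using skew_tuples_length[OF that, of "us @ a # vs"] by auto
    then show ?thesis by (simp add: skew_def)
  qed
  then show ?thesis using contract_0 by (auto simp: contract_cycles_def skew_tuples_def)
qed

lemma cube_contract_cycles: "cube I (contract_cycles k) (tR k)"
proof (rule cube.intro)
  interpret T: cube I "skew_tuples k" "tR k" by (rule cube_skew_tuples)
  interpret contract: additive contract by (rule contract_additive)
  show "finite I" by (rule finI)
  show "additive (tR k i)" for i by (rule push_additive)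
  fix \<tau> assume \<tau>: "\<tau> \<subseteq> I"
  show "0 \<in> contract_cycles k \<tau>" using T.F_0[OF \<tau>] by (simp add: contract_cycles_def contract.zero)
  show "x + y \<in> contract_cycles k \<tau>" if "x \<in> contract_cycles k \<tau>" "y \<in> contract_cycles k \<tau>" for x y
    using that T.F_add[OF \<tau>] by (simp add: contract_cycles_def contract.add)
  show "- x \<in> contract_cycles k \<tau>" if "x \<in> contract_cycles k \<tau>" for x
    using that T.F_minus[OF \<tau>] by (simp add: contract_cycles_def contract.minus)
  show "tR k i x \<in> contract_cycles k \<tau>" if "i \<in> I" "i \<notin> \<tau>" "x \<in> contract_cycles k (insert i \<tau>)" for i x
  proof -
    have x: "x \<in> skew_tuples k (insert i \<tau>)" "contract x = 0" using that by (auto simp: contract_cycles_def)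
    have m: "tR k i x \<in> skew_tuples k \<tau>" using T.R_mem[OF \<tau> that(1,2) x(1)] .
    have "contract (tR k i x) = 0"
    proof (cases k)
      case 0
      then show ?thesis using m contract_0[of "tR k i x" \<tau>] by (simp add: skew_tuples_def)
    next
      case (Suc j)
      then have "contract (tR k i x) = tR j i (contract x)"
        using x(1) \<tau> that(1,2) contract_push[of x j i \<tau>] by (simp add: skew_tuples_def)
      then show ?thesis using x(2) additive.zero[OF push_additive] by simp
    qed
    then show ?thesis using m by (simp add: contract_cycles_def)
  qed
  show "tR k i (tR k j x) = tR k j (tR k i x)"
    if "i \<in> I" "j \<in> I" "i \<notin> \<tau>" "j \<notin> \<tau>" "i \<noteq> j" "x \<in> contract_cycles k (insert i (insert j \<tau>))" for i j x
    using that T.R_commute[OF \<tau> that(1-5), of x] by (simp add: contract_cycles_def)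
qed

text \<open>Exactness of the Koszul complex over a nonempty fibre: the b of the proof is the
  exterior product of a chosen cell x0 with c, and its contraction is c minus the product of x0 with
  the contraction of c, which is 0. Over an empty fibre there are no tuples, so c = 0.\<close>

lemma contract_surj:
  assumes \<tau>: "\<tau> \<subseteq> I" and c: "c \<in> contract_cycles k \<tau>"
  shows "\<exists>b\<in>skew_tuples (Suc k) \<tau>. contract b = c"
proof (cases "E \<tau> = {}")
  case True
  then have "c = 0" using c by (auto simp: contract_cycles_def skew_tuples_def fsupp_def tuples_def fun_eq_iff)
  then show ?thesis
    by (intro bexI[of _ 0]) (auto simp: additive.zero[OF contract_additive] skew_tuples_def skew_zero)
next
  case False
  then obtain x0 where x0: "x0 \<in> E \<tau>" by auto
  have c': "c \<in> fsupp (tuples k \<tau>)" "skew c" "contract c = 0"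
    using c by (auto simp: contract_cycles_def skew_tuples_def)
  define b where "b ys = wsum ys (\<lambda>x zs. if x = x0 then c zs else 0)" for ys
  have "skew (\<lambda>zs. if x = x0 then c zs else 0)" for x
    using c'(2) skew_zero by (cases "x = x0") (auto simp: zero_fun_def)
  then have "skew b" unfolding b_def by (rule skew_wsum)
  moreover have "b \<in> fsupp (tuples (Suc k) \<tau>)"
    unfolding fsupp_def
  proof (intro CollectI allI impI)
    fix ys assume "b ys \<noteq> 0"
    then obtain us y vs where "ys = us @ y # vs" "(if y = x0 then c (us @ vs) else 0) \<noteq> 0"
      unfolding b_def using wsum_nonzero by blast
    then have ys: "ys = us @ x0 # vs" "c (us @ vs) \<noteq> 0" by (auto split: if_splits)
    then have "us @ vs \<in> tuples k \<tau>" using c'(1) unfolding fsupp_def by blast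
    then show "ys \<in> tuples (Suc k) \<tau>" using x0 ys(1) by (auto simp: tuples_iff)
  qed
  moreover have "contract b = c"
  proof
    fix ys
    have "contract b ys = (\<Sum>x\<in>U. if x = x0 then c ys else 0) - wsum ys (\<lambda>y zs. \<Sum>x\<in>U. if y = x0 then c (x # zs) else 0)"
      by (simp add: contract_def b_def sum_subtractf wsum_sum)
    also have "(\<Sum>x\<in>U. if x = x0 then c ys else 0) = c ys"
      using x0 E_subset[OF \<tau>] finU by auto
    also have "(\<lambda>y zs. \<Sum>x\<in>U. if y = x0 then c (x # zs) else 0) = (\<lambda>y zs. if y = x0 then contract c zs else 0)"
      by (auto simp: contract_def fun_eq_iff)
    also have "\<dots> = (\<lambda>y zs. 0)" using c'(3) by (auto simp: fun_eq_iff)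
    finally show "contract b ys = c ys" by (simp add: wsum_zero)
  qed
  ultimately show ?thesis by (auto simp: skew_tuples_def)
qed

lemma cube_map_contract: "cube_map I (skew_tuples (Suc k)) (tR (Suc k)) (contract_cycles k) (tR k) contract"
  unfolding cube_map_def
proof (intro conjI allI impI ballI)
  show "additive contract" by (rule contract_additive)
  show "contract ` skew_tuples (Suc k) \<tau> \<subseteq> contract_cycles k \<tau>" for \<tau>
    by (auto simp: skew_tuples_def contract_cycles_def contract_fsupp contract_skew contract_contract)
  show "contract (tR (Suc k) i x) = tR k i (contract x)"
    if "\<tau> \<subseteq> I" "i \<in> I - \<tau>" "x \<in> skew_tuples (Suc k) (insert i \<tau>)" for \<tau> i x
    using that by (intro contract_push[of _ _ _ \<tau>]) (auto simp: skew_tuples_def)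
qed

text \<open>Dimension shifting along the Koszul resolution. The k-th syzygy is the quotient of the
  exterior power of degree k + 1 by the next syzygy, and the r-th syzygy is zero.\<close>

lemma exact_at_image:
  assumes inj: "inj_on \<rho> I" and ex: "\<And>S s. S \<subseteq> I \<Longrightarrow> d < s \<Longrightarrow> exact_at S \<rho> cF cR s"
    and r: "\<And>\<tau>. \<tau> \<subseteq> I \<Longrightarrow> card (E \<tau>) \<le> r" and s: "r * (d + 1) \<le> s"
  shows "exact_at I \<rho> (\<lambda>\<tau>. fsupp (tuples 0 \<tau>)) (tR 0) s"
proof -
  \<comment> \<open>Passing to the next syzygy lowers the size by one, so s + k stays constant in
    the induction, which runs from k = r down to 0.\<close>
  have "exact_at I \<rho> (contract_cycles k) (tR k) s" if "k \<le> r" "r * (d + 1) \<le> s + k" for k s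
    using that
  proof (induction "r - k" arbitrary: k s)
    case 0
    then have "k = r" by simp
    \<comment> \<open>A fibre has at most r cells, so every tuple of length r + 1 repeats one and
      skew functions on such tuples vanish.\<close>
    have zero: "contract_cycles r \<tau> \<subseteq> {0}" if \<tau>: "\<tau> \<subseteq> I" for \<tau>
    proof
      fix c assume "c \<in> contract_cycles r \<tau>"
      then obtain b where b: "b \<in> skew_tuples (Suc r) \<tau>" "contract b = c" using contract_surj[OF \<tau>] by blast
      have "b ys = 0" for ys
      proof (rule ccontr)
        assume nz: "b ys \<noteq> 0"
        then have "ys \<in> tuples (Suc r) \<tau>" using b(1) unfolding skew_tuples_def fsupp_def by blast
        then have ys: "set ys \<subseteq> E \<tau>" "length ys = Suc r" by (auto simp: tuples_iff)
        have "finite (E \<tau>)" using E_subset[OF \<tau>] finU finite_subset by blast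
        then have "card (set ys) < length ys" using card_mono[OF _ ys(1)] r[OF \<tau>] ys(2) by simp
        then have "\<not> distinct ys" using distinct_card by force
        then show False using skew_not_distinct b(1) nz by (auto simp: skew_tuples_def)
      qed
      then have "b = 0" by (simp add: fun_eq_iff)
      then show "c \<in> {0}" using b(2) additive.zero[OF contract_additive] by simp
    qed
    have "c = 0" if c: "c \<in> cube_chains I (contract_cycles r) s" for c
    proof (intro ext)
      fix \<tau> ys
      have "c \<tau> = 0"
        using cube_chains_mem[OF c, of \<tau>] cube_chains_zero[OF c, of \<tau>] zero[of \<tau>] by blast
      then show "c \<tau> ys = 0 \<tau> ys" by simp
    qed
    moreover have "cube_bd I \<rho> (tR r) 0 = 0"
      by (rule additive.zero[OF cube.bd_additive[OF cube_contract_cycles]])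
    ultimately show ?case
      unfolding exact_at_def \<open>k = r\<close> using cube.chains_zero[OF cube_contract_cycles] by blast
  next
    case (Suc n)
    then have k: "Suc k \<le> r" by simp
    have "Suc k * (d + 1) \<le> r * (d + 1)" using k by (rule mult_le_mono1)
    \<comment> \<open>Equivalent to (k + 1) d < s: the size is in the range where the exterior power
      of degree k + 1 is exact.\<close>
    then have sk: "Suc k * d + Suc k \<le> s + k" using Suc.prems by simp
    then obtain t where t: "s = Suc t" by (cases s) auto
    show ?case unfolding t
    proof (rule exact_at_quotient[OF cube_contract_cycles cube_skew_tuples cube_contract_cycles cube_map_contract inj])
      show "contract_cycles (Suc k) \<tau> = {x \<in> skew_tuples (Suc k) \<tau>. contract x = 0}" for \<tau>
        by (simp add: contract_cycles_def)
      show "\<exists>x\<in>skew_tuples (Suc k) \<tau>. contract x = y" if "\<tau> \<subseteq> I" "y \<in> contract_cycles k \<tau>" for \<tau> y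
        using contract_surj[OF that] .
      show "exact_at I \<rho> (skew_tuples (Suc k)) (tR (Suc k)) (Suc t)"
        using sk t by (intro exact_at_skew_tuples exact_at_tuples[OF inj ex]) auto
      show "exact_at I \<rho> (contract_cycles (Suc k)) (tR (Suc k)) t"
        using Suc.hyps(2) Suc.prems k t by (intro Suc.hyps(1)) auto
    qed
  qed
  moreover have "contract_cycles 0 = (\<lambda>\<tau>. fsupp (tuples 0 \<tau>))"
    by (rule ext) (rule contract_cycles_0)
  ultimately show ?thesis using s by (metis add_0_right le0)
qed

end

section \<open>Projections of subcomplexes of joins\<close>

lemma signed_rat: "signed n (x::rat) = (-1) ^ n * x"
  by (simp add: signed_def)

lemma bdry_zero: "bdry K (\<lambda>\<sigma>. 0) \<tau> = 0"
  by (simp add: bdry_def)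

lemma red_hom_vanishes_trivial:
  assumes "\<And>\<sigma>. \<sigma> \<in> K \<Longrightarrow> card \<sigma> \<noteq> i + 1"
  shows "red_hom_vanishes K i"
  unfolding red_hom_vanishes_def
proof (intro ballI impI)
  fix c assume "c \<in> chains K (i + 1)"
  then have "c \<sigma> = 0" for \<sigma> using assms unfolding chains_def by blast
  then show "\<exists>d\<in>chains K (i + 2). \<forall>\<tau>. bdry K d \<tau> = c \<tau>"
    by (intro bexI[of _ "\<lambda>\<sigma>. 0"]) (auto simp: bdry_zero chains_def)
qed

text \<open>The least value in the definition is attained: homology vanishes in every dimension from
  the number of vertices on, as no face is that large.\<close>

lemma red_hom_vanishes_leray:
  assumes fin: "finite (\<Union>K)" and "S \<subseteq> \<Union>K" "leray K \<le> i"
  shows "red_hom_vanishes (induced K S) i"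
proof -
  have "red_hom_vanishes (induced K S) i" if "card (\<Union>K) \<le> i" for S i
  proof (rule red_hom_vanishes_trivial)
    fix \<sigma> assume "\<sigma> \<in> induced K S"
    then have "\<sigma> \<subseteq> \<Union>K" by (auto simp: induced_def)
    then show "card \<sigma> \<noteq> i + 1" using card_mono[OF fin, of \<sigma>] that by linarith
  qed
  then have "\<exists>d. \<forall>S \<subseteq> \<Union>K. \<forall>i\<ge>d. red_hom_vanishes (induced K S) i" by blast
  from LeastI_ex[OF this] show ?thesis using assms(2,3) unfolding leray_def by blast
qed

lemma leray_le:
  assumes "\<And>S i. S \<subseteq> \<Union>K \<Longrightarrow> d \<le> i \<Longrightarrow> red_hom_vanishes (induced K S) i"
  shows "leray K \<le> d"
  unfolding leray_def using assms by (intro Least_le) blast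

section \<open>The functor of faces of a subcomplex of a join\<close>

locale join_subcomplex =
  fixes V :: "nat \<Rightarrow> 'a::linorder set" and m :: nat and X :: "'a set set"
  assumes finV: "\<And>i. i \<in> {1..m} \<Longrightarrow> finite (V i)"
    and disj: "\<And>i j. i \<in> {1..m} \<Longrightarrow> j \<in> {1..m} \<Longrightarrow> i \<noteq> j \<Longrightarrow> V i \<inter> V j = {}"
    and complex: "simplicial_complex X"
    and X_join: "X \<subseteq> join V m"
begin

abbreviation "p \<equiv> pimap V m"
abbreviation "I \<equiv> {1..m}"

lemma pimap_eq: "i \<in> I \<Longrightarrow> v \<in> V i \<Longrightarrow> p v = i"
  unfolding pimap_def using disj by (intro the_equality) auto

lemma X_vertex: "\<sigma> \<in> X \<Longrightarrow> v \<in> \<sigma> \<Longrightarrow> p v \<in> I \<and> v \<in> V (p v)"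
proof -
  assume "\<sigma> \<in> X" "v \<in> \<sigma>"
  then have "v \<in> (\<Union>i\<in>I. V i)" using X_join unfolding join_def by blast
  then obtain i where "i \<in> I" "v \<in> V i" by blast
  then show ?thesis using pimap_eq by simp
qed

lemma p_eq_iff: "\<sigma> \<in> X \<Longrightarrow> v \<in> \<sigma> \<Longrightarrow> i \<in> I \<Longrightarrow> p v = i \<longleftrightarrow> v \<in> V i"
  using X_vertex pimap_eq by blast

lemma X_finite: "\<sigma> \<in> X \<Longrightarrow> finite \<sigma>"
  and X_subset: "\<sigma> \<in> X \<Longrightarrow> \<tau> \<subseteq> \<sigma> \<Longrightarrow> \<tau> \<in> X"
  using complex by (auto simp: simplicial_complex_def)

lemma inj_p:
  assumes "\<sigma> \<in> X"
  shows "inj_on p \<sigma>"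
proof (rule inj_onI)
  fix v w assume *: "v \<in> \<sigma>" "w \<in> \<sigma>" "p v = p w"
  then have "{v, w} \<subseteq> \<sigma> \<inter> V (p v)" "p v \<in> I"
    using X_vertex[OF assms, of v] X_vertex[OF assms, of w] by auto
  moreover have "card (\<sigma> \<inter> V (p v)) \<le> 1" using assms X_join \<open>p v \<in> I\<close> unfolding join_def by blast
  moreover have "finite (\<sigma> \<inter> V (p v))" using X_finite[OF assms] by simp
  ultimately have "card {v, w} \<le> 1" using card_mono by (metis le_trans)
  then show "v = w" by (cases "v = w") auto
qed

lemma card_p: "\<sigma> \<in> X \<Longrightarrow> card (p ` \<sigma>) = card \<sigma>"
  by (rule card_image) (rule inj_p)

lemma finite_vertices: "finite (\<Union>X)"
  by (rule finite_subset[of _ "\<Union>i\<in>I. V i"]) (use X_join finV in \<open>auto simp: join_def\<close>)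

lemma finite_X: "finite X"
  by (rule finite_subset[of _ "Pow (\<Union>X)"]) (use finite_vertices in auto)

definition fib :: "nat set \<Rightarrow> 'a set set" where
  "fib \<tau> = {\<sigma> \<in> X. p ` \<sigma> = \<tau>}"

definition del :: "nat \<Rightarrow> 'a set \<Rightarrow> 'a set" where
  "del i \<sigma> = \<sigma> - V i"

lemma p_del:
  assumes "\<sigma> \<in> X" "i \<in> I"
  shows "p ` del i \<sigma> = p ` \<sigma> - {i}"
  using p_eq_iff[OF assms(1) _ assms(2)] by (auto simp: del_def)

sublocale cells I X fib del
proof
  fix \<tau> i \<sigma> assume "i \<in> I" "i \<notin> \<tau>" "\<sigma> \<in> fib (insert i \<tau>)"
  then show "del i \<sigma> \<in> fib \<tau>"
    using p_del[of \<sigma> i] X_subset[of \<sigma> "del i \<sigma>"] by (auto simp: fib_def del_def)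
qed (auto simp: finite_X fib_def del_def)

text \<open>The induced subcomplex of X that corresponds to restricting the functor to the colours
  in S.\<close>

definition pre :: "nat set \<Rightarrow> 'a set set" where
  "pre S = induced X {v \<in> \<Union>X. p v \<in> S}"

lemma pre_iff: "\<sigma> \<in> pre S \<longleftrightarrow> \<sigma> \<in> X \<and> p ` \<sigma> \<subseteq> S"
  by (auto simp: pre_def induced_def)

text \<open>Simplicial chains orient faces by the order of the vertices, cube chains by the order of the
  colours; the sign compares the two.\<close>

definition twist :: "(nat set \<Rightarrow> 'a set \<Rightarrow> rat) \<Rightarrow> 'a set \<Rightarrow> rat" where
  "twist b \<sigma> = signed (inversions p (\<lambda>x. x) \<sigma>) (b (p ` \<sigma>) \<sigma>)"

lemma bdry_twist:
  assumes S: "S \<subseteq> I" and b: "b \<in> cube_chains S cF s" and \<sigma>: "\<sigma> \<in> pre S"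
  shows "bdry (pre S) (twist b) \<sigma> = signed (inversions p (\<lambda>x. x) \<sigma>) (cube_bd S (\<lambda>i. i) cR b (p ` \<sigma>) \<sigma>)"
proof -
  define N where "N = {v. v \<notin> \<sigma> \<and> insert v \<sigma> \<in> pre S}"
  have \<sigma>X: "\<sigma> \<in> X" "p ` \<sigma> \<subseteq> S" using \<sigma> by (auto simp: pre_iff)
  have finN: "finite N"
    by (rule finite_subset[OF _ finite_vertices]) (auto simp: N_def pre_iff)
  have N: "v \<notin> \<sigma>" "insert v \<sigma> \<in> X" "p v \<in> S" "p v \<notin> p ` \<sigma>" "v \<in> V (p v)" if "v \<in> N" for v
  proof -
    show *: "v \<notin> \<sigma>" "insert v \<sigma> \<in> X" "p v \<in> S" using that by (auto simp: N_def pre_iff)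
    show "p v \<notin> p ` \<sigma>" using inj_p[OF *(2)] *(1) by (auto simp: inj_on_def)
    show "v \<in> V (p v)" using X_vertex[OF *(2)] by auto
  qed
  have fiber: "push X (del i) (b (insert i (p ` \<sigma>))) \<sigma> = (\<Sum>v\<in>{v\<in>N. p v = i}. b (p ` insert v \<sigma>) (insert v \<sigma>))"
    if i: "i \<in> S - p ` \<sigma>" for i
  proof -
    have bi: "b (insert i (p ` \<sigma>)) \<in> cF (insert i (p ` \<sigma>))"
      using cube_chains_mem[OF b, of "insert i (p ` \<sigma>)"] cube_chains_zero[OF b, of "insert i (p ` \<sigma>)"]
      by (metis fsupp_0)
    have iI: "i \<in> I" using i S by auto
    have inj: "inj_on (\<lambda>v. insert v \<sigma>) {v\<in>N. p v = i}" using N(1) by (auto simp: inj_on_def)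
    have "(\<Sum>x\<in>{x\<in>X. del i x = \<sigma>}. b (insert i (p ` \<sigma>)) x) = (\<Sum>x\<in>(\<lambda>v. insert v \<sigma>) ` {v\<in>N. p v = i}. b (insert i (p ` \<sigma>)) x)"
    proof (rule sum.mono_neutral_right)
      show "finite {x \<in> X. del i x = \<sigma>}" using finite_X by simp
      show "(\<lambda>v. insert v \<sigma>) ` {v\<in>N. p v = i} \<subseteq> {x \<in> X. del i x = \<sigma>}"
      proof clarsimp
        fix v assume v: "v \<in> N" "i = p v"
        have "w \<notin> V (p v)" if "w \<in> \<sigma>" for w
          using p_eq_iff[OF \<sigma>X(1) that, of "p v"] N(4)[OF v(1)] X_vertex[OF N(2)[OF v(1)], of v] that
          by (metis image_eqI insertI1)
        then show "insert v \<sigma> \<in> X \<and> del (p v) (insert v \<sigma>) = \<sigma>"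
          using N[OF v(1)] by (auto simp: del_def)
      qed
      \<comment> \<open>The face \<sigma> has no vertex of colour i, so it is itself a solution of
        \<open>del i x = \<sigma>\<close>; its coefficient is 0 because its colour set lacks
        i.\<close>
      show "\<forall>x\<in>{x \<in> X. del i x = \<sigma>} - (\<lambda>v. insert v \<sigma>) ` {v\<in>N. p v = i}. b (insert i (p ` \<sigma>)) x = 0"
      proof (rule ballI, rule ccontr)
        fix x assume x: "x \<in> {x \<in> X. del i x = \<sigma>} - (\<lambda>v. insert v \<sigma>) ` {v\<in>N. p v = i}"
          and nz: "b (insert i (p ` \<sigma>)) x \<noteq> 0"
        then have px: "p ` x = insert i (p ` \<sigma>)" using bi by (auto simp: fsupp_def fib_def)
        then obtain v where v: "v \<in> x" "p v = i" by (metis image_iff insertI1)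
        have xX: "x \<in> X" "x - V i = \<sigma>" using x by (auto simp: del_def)
        have uniq: "w = v" if "w \<in> x" "w \<in> V i" for w
          using inj_p[OF xX(1)] p_eq_iff[OF xX(1) that(1) iI] v that by (auto simp: inj_on_def)
        have vi: "v \<in> V i" using p_eq_iff[OF xX(1) v(1) iI] v by simp
        then have "v \<notin> \<sigma>" using xX(2) by blast
        have "x = insert v \<sigma>" using xX(2) v(1) uniq by blast
        have "p ` x \<subseteq> S" unfolding px using i \<sigma>X(2) by blast
        then have "x \<in> pre S" using xX(1) by (simp only: pre_iff simp_thms)
        then have "v \<in> N" using \<open>v \<notin> \<sigma>\<close> \<open>x = insert v \<sigma>\<close> by (simp only: N_def mem_Collect_eq simp_thms)
        then have "x \<in> (\<lambda>v. insert v \<sigma>) ` {v\<in>N. p v = i}"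
          using v(2) \<open>x = insert v \<sigma>\<close> by (intro image_eqI[of x _ v]) simp_all
        then show False using x by blast
      qed
    qed
    also have "\<dots> = (\<Sum>v\<in>{v\<in>N. p v = i}. b (p ` insert v \<sigma>) (insert v \<sigma>))"
      by (subst sum.reindex[OF inj]) (auto intro!: sum.cong)
    finally show ?thesis by (simp add: push_def)
  qed
  have sign: "(-1) ^ card {w\<in>\<sigma>. w < v} * twist b (insert v \<sigma>) =
      signed (inversions p (\<lambda>x. x) \<sigma>) (signed (pos (\<lambda>i. i) (p v) (p ` \<sigma>)) (b (p ` insert v \<sigma>) (insert v \<sigma>)))"
    if v: "v \<in> N" for v
  proof -
    have pos: "pos (\<lambda>i. i) (p v) (p ` \<sigma>) = pos p v \<sigma>"
    proof -
      have "{j \<in> p ` \<sigma>. j < p v} = p ` {w\<in>\<sigma>. p w < p v}" by auto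
      then show ?thesis unfolding pos_def
        using inj_on_subset[OF inj_p[OF \<sigma>X(1)], of "{w\<in>\<sigma>. p w < p v}"] by (auto simp: card_image)
    qed
    have even: "even (pos (\<lambda>x. x) v \<sigma> + inversions p (\<lambda>x. x) (insert v \<sigma>)) = even (inversions p (\<lambda>x. x) \<sigma> + pos p v \<sigma>)"
      using N[OF v] X_finite[OF \<sigma>X(1)] inj_p by (intro even_pos_inversions) auto
    have "(-1) ^ card {w\<in>\<sigma>. w < v} * twist b (insert v \<sigma>) = signed (pos (\<lambda>x. x) v \<sigma>) (twist b (insert v \<sigma>))"
      by (simp add: signed_rat pos_def)
    then show ?thesis unfolding twist_def signed_signed pos using signed_cong[OF even] by simp
  qed
  have "bdry (pre S) (twist b) \<sigma> = (\<Sum>v\<in>N. (-1) ^ card {w\<in>\<sigma>. w < v} * twist b (insert v \<sigma>))"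
    by (simp add: bdry_def N_def)
  also have "\<dots> = signed (inversions p (\<lambda>x. x) \<sigma>)
      (\<Sum>v\<in>N. signed (pos (\<lambda>i. i) (p v) (p ` \<sigma>)) (b (p ` insert v \<sigma>) (insert v \<sigma>)))"
    unfolding signed_sum by (intro sum.cong refl sign)
  also have "(\<Sum>v\<in>N. signed (pos (\<lambda>i. i) (p v) (p ` \<sigma>)) (b (p ` insert v \<sigma>) (insert v \<sigma>)))
      = (\<Sum>i\<in>S-p`\<sigma>. \<Sum>v\<in>{v\<in>N. p v = i}. signed (pos (\<lambda>i. i) (p v) (p ` \<sigma>)) (b (p ` insert v \<sigma>) (insert v \<sigma>)))"
    using finN finite_subset[OF S] N(3,4) by (intro sum.group[symmetric]) (simp_all add: image_subset_iff)
  also have "\<dots> = (\<Sum>i\<in>S-p`\<sigma>. signed (pos (\<lambda>i. i) i (p ` \<sigma>)) (push X (del i) (b (insert i (p ` \<sigma>))) \<sigma>))"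
    by (intro sum.cong refl) (simp add: fiber signed_sum)
  also have "\<dots> = cube_bd S (\<lambda>i. i) cR b (p ` \<sigma>) \<sigma>"
    using \<sigma>X by (simp add: cube_bd_def sum_fun_apply signed_fun)
  finally show ?thesis .
qed

text \<open>Up to \<open>twist\<close>, the total complex over S is the simplicial chain complex of
  the induced subcomplex \<open>pre S\<close>. Size s is dimension s - 1, which is at least the
  Leray number.\<close>

lemma exact_at_fibers:
  assumes S: "S \<subseteq> I" and s: "leray X < s"
  shows "exact_at S (\<lambda>i. i) cF cR s"
  unfolding exact_at_def
proof (intro ballI impI)
  fix c assume c: "c \<in> cube_chains S cF s" "cube_bd S (\<lambda>i. i) cR c = 0"
  obtain n where n: "s = Suc n" "leray X \<le> n" using s by (cases s) auto
  interpret S: cube S cF cR by (rule cube.subcube[OF cube S])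
  have van: "red_hom_vanishes (pre S) n"
    unfolding pre_def using n by (intro red_hom_vanishes_leray finite_vertices) auto
  have c_nz: "\<sigma> \<in> X \<and> \<tau> = p ` \<sigma> \<and> \<tau> \<subseteq> S \<and> card \<tau> = k" if "f \<in> cube_chains S cF k" "f \<tau> \<sigma> \<noteq> 0" for f k \<tau> \<sigma>
  proof -
    have \<tau>: "\<tau> \<subseteq> S \<and> card \<tau> = k" using cube_chains_zero[OF that(1), of \<tau>] that(2) by (metis zero_fun_def)
    then have "f \<tau> \<in> cF \<tau>" using cube_chains_mem[OF that(1)] by blast
    then have "\<sigma> \<in> fib \<tau>" using that(2) unfolding fsupp_def by blast
    then show ?thesis using \<tau> by (auto simp: fib_def)
  qed
  have tw_ch: "twist c \<in> chains (pre S) (n + 1)"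
    unfolding chains_def
  proof (intro CollectI allI impI)
    fix \<sigma> assume "twist c \<sigma> \<noteq> 0"
    then have "c (p ` \<sigma>) \<sigma> \<noteq> 0" by (auto simp: twist_def)
    from c_nz[OF c(1) this] show "\<sigma> \<in> pre S \<and> card \<sigma> = n + 1" using n card_p by (auto simp: pre_iff)
  qed
  have "bdry (pre S) (twist c) \<tau> = 0" for \<tau>
  proof (cases "\<tau> \<in> pre S")
    case True
    then show ?thesis using bdry_twist[OF S c(1) True] c(2) by simp
  next
    case False
    then have "insert v \<tau> \<notin> pre S" for v using X_subset[of "insert v \<tau>" \<tau>] by (auto simp: pre_iff)
    then show ?thesis by (simp add: bdry_def)
  qed
  then obtain D where D: "D \<in> chains (pre S) (n + 2)" "\<And>\<tau>. bdry (pre S) D \<tau> = twist c \<tau>"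
    using van tw_ch unfolding red_hom_vanishes_def by blast
  have D_nz: "\<sigma> \<in> X \<and> p ` \<sigma> \<subseteq> S \<and> card (p ` \<sigma>) = Suc s" if "D \<sigma> \<noteq> 0" for \<sigma>
  proof -
    have "\<sigma> \<in> pre S" "card \<sigma> = n + 2" using D(1) that unfolding chains_def by blast+
    then show ?thesis using n card_p by (auto simp: pre_iff)
  qed
  \<comment> \<open>The inverse of \<open>twist\<close>: the coefficient of a face is placed over
    its colour set, with the same sign.\<close>
  define b where "b \<tau> \<sigma> = (if p ` \<sigma> = \<tau> then signed (inversions p (\<lambda>x. x) \<sigma>) (D \<sigma>) else 0)" for \<tau> \<sigma>
  have b: "b \<in> cube_chains S cF (Suc s)"
  proof (rule cube_chainsI)
    fix \<tau>
    show "b \<tau> \<in> cF \<tau>" using D_nz by (auto simp: b_def fsupp_def fib_def split: if_splits)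
    show "b \<tau> = 0" if "\<not> (\<tau> \<subseteq> S \<and> card \<tau> = Suc s)"
    proof
      fix \<sigma> show "b \<tau> \<sigma> = 0 \<sigma>" using D_nz[of \<sigma>] that by (auto simp: b_def)
    qed
  qed
  have "twist b = D"
    by (rule ext) (simp add: twist_def b_def signed_signed, simp add: signed_def)
  have "cube_bd S (\<lambda>i. i) cR b \<tau> \<sigma> = c \<tau> \<sigma>" for \<tau> \<sigma>
  proof (cases "\<sigma> \<in> X \<and> \<tau> = p ` \<sigma> \<and> \<tau> \<subseteq> S")
    case True
    then have "\<sigma> \<in> pre S" by (auto simp: pre_iff)
    from bdry_twist[OF S b this] \<open>twist b = D\<close> D(2)[of \<sigma>]
    have "signed (inversions p (\<lambda>x. x) \<sigma>) (c (p ` \<sigma>) \<sigma>) = signed (inversions p (\<lambda>x. x) \<sigma>) (cube_bd S (\<lambda>i. i) cR b (p ` \<sigma>) \<sigma>)"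
      by (simp add: twist_def)
    then show ?thesis using True by (auto simp: signed_def split: if_splits)
  next
    case False
    have "cube_bd S (\<lambda>i. i) cR b \<in> cube_chains S cF s" by (rule S.bd_chains[OF b])
    then show ?thesis using c_nz[of "cube_bd S (\<lambda>i. i) cR b" s \<tau> \<sigma>] c_nz[OF c(1), of \<tau> \<sigma>] False by metis
  qed
  then have "cube_bd S (\<lambda>i. i) cR b = c" by blast
  then show "\<exists>b\<in>cube_chains S cF (Suc s). cube_bd S (\<lambda>i. i) cR b = c" using b by blast
qed

section \<open>Chains of the image complex\<close>

abbreviation "Y \<equiv> (\<lambda>\<sigma>. p ` \<sigma>) ` X"

lemma tuples_0: "tuples 0 \<tau> = (if \<tau> \<in> Y then {[]} else {})"
  by (auto simp: tuples_def fib_def list_cells_def)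

text \<open>The faces of Y are sets of colours and both boundaries use the order of the natural
  numbers, so no sign correction occurs.\<close>

lemma bdry_image:
  assumes S: "S \<subseteq> I" and "\<tau> \<subseteq> S" and D: "\<And>\<sigma>. D \<sigma> \<noteq> 0 \<Longrightarrow> \<sigma> \<in> induced Y S"
  shows "bdry (induced Y S) D \<tau> = cube_bd S (\<lambda>i. i) (tR 0) (\<lambda>\<sigma> xs. if xs = [] then D \<sigma> else 0) \<tau> []"
proof -
  have "cube_bd S (\<lambda>i. i) (tR 0) (\<lambda>\<sigma> xs. if xs = [] then D \<sigma> else 0) \<tau> [] =
      (\<Sum>v\<in>S-\<tau>. (-1) ^ card {w\<in>\<tau>. w < v} * D (insert v \<tau>))"
    using assms(2) by (simp add: cube_bd_def sum_fun_apply signed_fun push_list_0 signed_rat pos_def)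
  also have "\<dots> = (\<Sum>v\<in>{v. v \<notin> \<tau> \<and> insert v \<tau> \<in> induced Y S}. (-1) ^ card {w\<in>\<tau>. w < v} * D (insert v \<tau>))"
  proof (rule sum.mono_neutral_right)
    show "finite (S - \<tau>)" using finite_subset[OF S] by simp
    show "{v. v \<notin> \<tau> \<and> insert v \<tau> \<in> induced Y S} \<subseteq> S - \<tau>" by (auto simp: induced_def)
  qed (use D in auto)
  finally show ?thesis by (simp add: bdry_def)
qed

lemma red_hom_vanishes_image:
  assumes S: "S \<subseteq> I" and ex: "exact_at S (\<lambda>i. i) (\<lambda>\<tau>. fsupp (tuples 0 \<tau>)) (tR 0) (Suc n)"
  shows "red_hom_vanishes (induced Y S) n"
  unfolding red_hom_vanishes_def
proof (intro ballI impI)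
  fix c assume c: "c \<in> chains (induced Y S) (n + 1)" "\<forall>\<tau>. bdry (induced Y S) c \<tau> = 0"
  have c_nz: "\<sigma> \<in> induced Y S" "card \<sigma> = Suc n" if "c \<sigma> \<noteq> 0" for \<sigma>
    using c(1) that by (auto simp: chains_def)
  interpret S: cube S "\<lambda>\<tau>. fsupp (tuples 0 \<tau>)" "tR 0" by (rule cube.subcube[OF cube_tuples S])
  define c' :: "nat set \<Rightarrow> 'a set list \<Rightarrow> rat" where "c' = (\<lambda>\<sigma> xs. if xs = [] then c \<sigma> else 0)"
  have c': "c' \<in> cube_chains S (\<lambda>\<tau>. fsupp (tuples 0 \<tau>)) (Suc n)"
  proof (rule cube_chainsI)
    fix \<tau>
    show "c' \<tau> \<in> fsupp (tuples 0 \<tau>)"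
      using c_nz(1)[of \<tau>] by (auto simp: c'_def fsupp_def tuples_0 induced_def split: if_splits)
    show "c' \<tau> = 0" if "\<not> (\<tau> \<subseteq> S \<and> card \<tau> = Suc n)"
      using c_nz[of \<tau>] that by (auto simp: c'_def fun_eq_iff induced_def)
  qed
  \<comment> \<open>The only possible basis element over \<tau> is the empty tuple, so chains are
    compared through their values at \<open>[]\<close>.\<close>
  have eq_Nil: "f \<tau> = g \<tau>" if "f \<in> cube_chains S (\<lambda>\<tau>. fsupp (tuples 0 \<tau>)) k" "g \<in> cube_chains S (\<lambda>\<tau>. fsupp (tuples 0 \<tau>)) k"
    "\<tau> \<subseteq> S \<Longrightarrow> f \<tau> [] = g \<tau> []" for f g k \<tau>
  proof (cases "\<tau> \<subseteq> S \<and> card \<tau> = k")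
    case True
    then have "f \<tau> \<in> fsupp (tuples 0 \<tau>)" "g \<tau> \<in> fsupp (tuples 0 \<tau>)"
      using cube_chains_mem[OF that(1)] cube_chains_mem[OF that(2)] by auto
    then have "f \<tau> xs = 0" "g \<tau> xs = 0" if "xs \<noteq> []" for xs
      using that by (auto simp: fsupp_def tuples_0 split: if_splits)
    then show ?thesis using that(3) True by (metis ext)
  next
    case False
    then show ?thesis using cube_chains_zero[OF that(1) False] cube_chains_zero[OF that(2) False] by simp
  qed
  have "cube_bd S (\<lambda>i. i) (tR 0) c' = 0"
  proof
    fix \<tau>
    show "cube_bd S (\<lambda>i. i) (tR 0) c' \<tau> = 0 \<tau>"
    proof (rule eq_Nil[OF S.bd_chains[OF c'] S.chains_zero])
      assume "\<tau> \<subseteq> S"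
      then show "cube_bd S (\<lambda>i. i) (tR 0) c' \<tau> [] = 0 \<tau> []"
        using bdry_image[where D=c, OF S _ c_nz(1), of \<tau>] c(2) by (simp add: c'_def)
    qed
  qed
  then obtain b where b: "b \<in> cube_chains S (\<lambda>\<tau>. fsupp (tuples 0 \<tau>)) (Suc (Suc n))"
      "cube_bd S (\<lambda>i. i) (tR 0) b = c'"
    using ex c' by (auto simp: exact_at_def)
  define D where "D \<sigma> = b \<sigma> []" for \<sigma>
  have D_nz: "\<sigma> \<in> induced Y S" "card \<sigma> = Suc (Suc n)" if "D \<sigma> \<noteq> 0" for \<sigma>
  proof -
    have \<sigma>: "\<sigma> \<subseteq> S" "card \<sigma> = Suc (Suc n)"
      using cube_chains_zero[OF b(1), of \<sigma>] that by (metis D_def zero_fun_def)+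
    have "[] \<in> tuples 0 \<sigma>" using cube_chains_mem[OF b(1) \<sigma>] that by (auto simp: D_def fsupp_def)
    then show "\<sigma> \<in> induced Y S" "card \<sigma> = Suc (Suc n)" using \<sigma> by (auto simp: tuples_0 induced_def split: if_splits)
  qed
  have b_D: "b = (\<lambda>\<sigma> xs. if xs = [] then D \<sigma> else 0)"
  proof (rule ext, rule eq_Nil[OF b(1)])
    show "(\<lambda>\<sigma> xs. if xs = [] then D \<sigma> else 0) \<in> cube_chains S (\<lambda>\<tau>. fsupp (tuples 0 \<tau>)) (Suc (Suc n))"
    proof (rule cube_chainsI)
      fix \<tau>
      show "(\<lambda>xs. if xs = [] then D \<tau> else 0) \<in> fsupp (tuples 0 \<tau>)"
        using D_nz(1)[of \<tau>] by (auto simp: fsupp_def tuples_0 induced_def split: if_splits)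
      show "(\<lambda>xs. if xs = [] then D \<tau> else 0) = 0" if "\<not> (\<tau> \<subseteq> S \<and> card \<tau> = Suc (Suc n))"
        using D_nz[of \<tau>] that by (auto simp: fun_eq_iff induced_def)
    qed
  qed (simp add: D_def)
  have "bdry (induced Y S) D \<tau> = c \<tau>" for \<tau>
  proof (cases "\<tau> \<subseteq> S")
    case True
    then show ?thesis
      using bdry_image[where D=D, OF S True D_nz(1)] b(2) b_D by (simp add: c'_def)
  next
    case False
    then have "{v. v \<notin> \<tau> \<and> insert v \<tau> \<in> induced Y S} = {}" "c \<tau> = 0"
      using c_nz(1)[of \<tau>] by (auto simp: induced_def)
    then show ?thesis unfolding bdry_def by (simp only: sum.empty)
  qed
  moreover have "D \<in> chains (induced Y S) (n + 2)" using D_nz by (auto simp: chains_def)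
  ultimately show "\<exists>d\<in>chains (induced Y S) (n + 2). \<forall>\<tau>. bdry (induced Y S) d \<tau> = c \<tau>" by blast
qed

section \<open>Fibres of the map of realizations\<close>

abbreviation "supp x \<equiv> {v. x v \<noteq> (0::real)}"

text \<open>The support is a face and has at most one vertex of each colour, so \<pi> adds no two of
  its coordinates.\<close>

lemma pilin_supp:
  assumes "y \<in> realization X" "v \<in> supp y"
  shows "pilin V m y (p v) = y v"
proof -
  have "supp y \<in> X" using assms by (simp add: realization_def)
  then have "{w. y w \<noteq> 0 \<and> p w = p v} = {v}"
    using inj_p[of "supp y"] assms(2) by (auto simp: inj_on_def)
  then show ?thesis by (simp add: pilin_def)
qed

text \<open>Within a fibre of \<pi> a point is determined by its support, since its coordinates
  there are read off from the image. The uniform bound makes the set of fibre sizes finite, so that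
  its maximum in \<open>rXpi\<close> is an upper bound.\<close>

lemma card_fiber_le: "card {y \<in> realization X. pilin V m y = q} \<le> card X"
  and finite_fiber: "finite {y \<in> realization X. pilin V m y = q}"
proof -
  let ?F = "{y \<in> realization X. pilin V m y = q}"
  have inj: "inj_on (\<lambda>y. supp y) ?F"
  proof (rule inj_onI)
    fix y z assume yz: "y \<in> ?F" "z \<in> ?F" "supp y = supp z"
    show "y = z"
    proof
      fix v show "y v = z v"
      proof (cases "v \<in> supp y")
        case True
        then have "v \<in> supp z" using yz(3) by blast
        then show ?thesis using True pilin_supp[of y v] pilin_supp[of z v] yz by auto
      next
        case False
        then have "v \<notin> supp z" using yz(3) by blast
        then show ?thesis using False by simp
      qed
    qed
  qed
  have sub: "(\<lambda>y. supp y) ` ?F \<subseteq> X" by (auto simp: realization_def)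
  show "card ?F \<le> card X" using card_inj_on_le[OF inj sub finite_X] .
  show "finite ?F" using finite_imageD[OF finite_subset[OF sub finite_X] inj] .
qed

lemma card_fiber_le_rXpi:
  assumes "x \<in> realization X"
  shows "card {y \<in> realization X. pilin V m y = pilin V m x} \<le> rXpi V m X"
proof -
  have "(\<lambda>x. card {y \<in> realization X. pilin V m y = pilin V m x}) ` realization X \<subseteq> {..card X}"
    using card_fiber_le by auto
  then show ?thesis unfolding rXpi_def using assms finite_subset by (intro Max_ge) auto
qed

text \<open>Converts faces to points: the image of a barycenter depends only on the colour set of
  the face, so the faces with one colour set give points of one fibre of \<pi>.\<close>

definition barycenter :: "'a set \<Rightarrow> 'a \<Rightarrow> real" where
  "barycenter \<sigma> v = (if v \<in> \<sigma> then 1 / card \<sigma> else 0)"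

lemma barycenter:
  assumes "\<sigma> \<in> X" "\<sigma> \<noteq> {}"
  shows "supp (barycenter \<sigma>) = \<sigma>" "barycenter \<sigma> \<in> realization X"
    and "pilin V m (barycenter \<sigma>) = (\<lambda>i. if i \<in> p ` \<sigma> then 1 / card (p ` \<sigma>) else 0)"
proof -
  have c: "card \<sigma> \<noteq> 0" using X_finite[OF assms(1)] assms(2) by simp
  show s: "supp (barycenter \<sigma>) = \<sigma>" using c by (auto simp: barycenter_def)
  show r: "barycenter \<sigma> \<in> realization X"
    unfolding realization_def mem_Collect_eq s using assms(1) c by (auto simp: barycenter_def)
  show "pilin V m (barycenter \<sigma>) = (\<lambda>i. if i \<in> p ` \<sigma> then 1 / card (p ` \<sigma>) else 0)"
  proof
    fix i
    show "pilin V m (barycenter \<sigma>) i = (if i \<in> p ` \<sigma> then 1 / card (p ` \<sigma>) else 0)"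
    proof (cases "i \<in> p ` \<sigma>")
      case True
      then obtain v where v: "v \<in> \<sigma>" "i = p v" by auto
      then have "v \<in> supp (barycenter \<sigma>)" using s by blast
      from pilin_supp[OF r this] show ?thesis using v card_p[OF assms(1)] by (simp add: barycenter_def[of \<sigma> v])
    next
      case False
      then have "{v. barycenter \<sigma> v \<noteq> 0 \<and> p v = i} = {}" using s by blast
      then show ?thesis using False unfolding pilin_def by (simp only: sum.empty if_False)
    qed
  qed
qed

text \<open>The barycenters of the faces with colour set \<tau> are distinct, as their supports
  differ, and have a common image. The hypothesis provides a nonempty face, and with it a nonempty
  fibre.\<close>

lemma card_fib_le:
  assumes "\<Union>X \<noteq> {}"
  shows "card (fib \<tau>) \<le> rXpi V m X" and "1 \<le> rXpi V m X"
proof -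
  have main: "card (fib \<tau>) \<le> rXpi V m X" if \<sigma>: "\<sigma> \<in> fib \<tau>" "\<sigma> \<noteq> {}" for \<sigma> \<tau>
  proof -
    have ne: "\<sigma>' \<in> X" "\<sigma>' \<noteq> {}" "p ` \<sigma>' = \<tau>" if "\<sigma>' \<in> fib \<tau>" for \<sigma>' using that \<sigma> by (auto simp: fib_def)
    let ?F = "{y \<in> realization X. pilin V m y = pilin V m (barycenter \<sigma>)}"
    have "inj_on barycenter (fib \<tau>)"
      by (rule inj_on_inverseI[of _ "\<lambda>y. supp y"]) (use ne barycenter(1) in blast)
    moreover have "barycenter ` fib \<tau> \<subseteq> ?F"
      using ne[OF \<sigma>(1)] ne barycenter(2,3) by auto
    ultimately have "card (fib \<tau>) \<le> card ?F" using card_inj_on_le[OF _ _ finite_fiber] by blast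
    also have "\<dots> \<le> rXpi V m X" using ne[OF \<sigma>(1)] by (intro card_fiber_le_rXpi barycenter(2))
    finally show ?thesis .
  qed
  from assms obtain \<sigma> v where \<sigma>: "\<sigma> \<in> X" "v \<in> \<sigma>" by auto
  then have "\<sigma> \<in> fib (p ` \<sigma>)" by (simp add: fib_def)
  moreover have "finite (fib (p ` \<sigma>))" using finite_X by (simp add: fib_def)
  ultimately have "1 \<le> card (fib (p ` \<sigma>))" by (metis One_nat_def Suc_leI card_gt_0_iff empty_iff)
  then show one: "1 \<le> rXpi V m X" using main[OF \<open>\<sigma> \<in> fib (p ` \<sigma>)\<close>] \<sigma> by force
  show "card (fib \<tau>) \<le> rXpi V m X"
  \<comment> \<open>The empty face has no barycenter. It is alone over the empty colour set, so
    there the bound follows from r \<ge> 1.\<close>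
  proof (cases "fib \<tau> \<subseteq> {{}}")
    case True
    then have "card (fib \<tau>) \<le> card {{} :: 'a set}" by (intro card_mono) auto
    then show ?thesis using one by simp
  qed (use main in blast)
qed

lemma leray_image_le: "leray Y \<le> rXpi V m X * leray X + rXpi V m X - 1"
proof (rule leray_le)
  let ?r = "rXpi V m X"
  fix S i assume S: "S \<subseteq> \<Union>Y" and i: "?r * leray X + ?r - 1 \<le> i"
  show "red_hom_vanishes (induced Y S) i"
  proof (cases "\<Union>X = {}")
    case True
    \<comment> \<open>Without vertices the realization is empty and \<open>rXpi\<close> is the
      maximum of an empty set, about which nothing is known; but then Y has no nonempty
      face.\<close>
    then show ?thesis by (intro red_hom_vanishes_trivial) (auto simp: induced_def)
  next
    case False
    have "\<Union>Y \<subseteq> I" using X_vertex by blast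
    then have SI: "S \<subseteq> I" using S by blast
    interpret S: cells S X fib del by (rule subcells[OF SI])
    have "exact_at S (\<lambda>i. i) (\<lambda>\<tau>. fsupp (S.tuples 0 \<tau>)) (tR 0) (Suc i)"
    proof (rule S.exact_at_image[of _ "leray X" ?r])
      show "exact_at S' (\<lambda>i. i) cF cR s" if "S' \<subseteq> S" "leray X < s" for S' s
        using that SI by (intro exact_at_fibers) auto
      \<comment> \<open>Dimension i is size i + 1; this turns the bound r L(X) + r - 1 on dimensions
        into r (L(X) + 1) on sizes.\<close>
      show "?r * (leray X + 1) \<le> Suc i" using i card_fib_le(2)[OF False] by simp
    qed (use card_fib_le(1)[OF False] in auto)
    then show ?thesis by (intro red_hom_vanishes_image SI)
  qed
qed

end

theorem theorem1p2:
  fixes V :: "nat \<Rightarrow> 'a::linorder set" and m :: nat and X :: "'a set set"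
  assumes "\<forall>i\<in>{1..m}. finite (V i)"
    and "\<forall>i\<in>{1..m}. \<forall>j\<in>{1..m}. i \<noteq> j \<longrightarrow> V i \<inter> V j = {}"
    and "simplicial_complex X"
    and "X \<subseteq> join V m"
  shows "leray ((\<lambda>\<sigma>. pimap V m ` \<sigma>) ` X) \<le> rXpi V m X * leray X + rXpi V m X - 1"
proof -
  interpret join_subcomplex V m X using assms by unfold_locales auto
  show ?thesis by (rule leray_image_le)
qed

end
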